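(* Let $P$ be an element of the polytope group $\mathcal{P}^d$ and let $L$ be a lattice in $\mathbb{R}^d$. Then $P$ tiles at some level $k$ by translations with respect to $L$ if and only if $H_\Phi(P,L)=0$ for every $r$-flag $\Phi$ with $0\le r\le d-1$.
   Context: A simplex in $\mathbb{R}^d$ is the convex hull of $d+1$ points not all lying in a hyperplane; a polytope is a finite union of simplices with pairwise disjoint interiors. The polytope group $\mathcal{P}^d$ is the abelian group generated by symbols $[A]$, $A$ a polytope, subject to $[A]+[B]=[A\cup B]$ whenever $A,B$ have disjoint interiors; any additive function on polytopes extends uniquely to an additive function on $\mathcal{P}^d$. In particular $A\mapsto\chi_A\in L^1(\mathbb{R}^d)$ extends to $P\mapsto\chi_P$. A lattice $L$ is the subgroup generated by $d$ linearly independent vectors. $P$ tiles at level $k$ (an integer) with respect to $L$ if $\sum_{\lambda\in L}\chi_P(x-\lambda)=k$ a.e. For $0\le r\le d-1$, an $r$-flag $\Phi$ is a sequence of affine subspaces $V_r\subset\cdots\subset V_{d-1}\subset V_d=\mathbb{R}^d$, $\dim V_j=j$, with, for each $r\le j\le d-1$, one of the two half-spaces of $V_{j+1}$ bounded by $V_j$ designated positive and the other negative. For a polytope $A$, consider chains of faces $F_r\subset\cdots\subset F_{d-1}\subset F_d=A$ with $F_j$ a $j$-dimensional face of $A$ contained in $V_j$; set $\varepsilon_j=+1$ if $F_{j+1}$ adjoins $V_j$ from the positive side and $-1$ otherwise. Let $\omega_\Phi(A)=\sum\varepsilon_r\cdots\varepsilon_{d-1}\mathrm{Vol}_r(F_r)$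 over all such chains ($0$ if none; a $0$-dimensional face is a vertex of volume $1$). Let $H_\Phi(A,L)=\sum_\Psi\omega_\Psi(A)$ over all distinct $r$-flags $\Psi$ obtainable from $\Phi$ by translating all subspaces and half-spaces by some $\lambda\in L$ (each counted once). $\omega_\Phi$ and $H_\Phi(\cdot,L)$ are additive and are extended additively to $\mathcal{P}^d$. *)

theory Defs
  imports
    "HOL-Analysis.Analysis"
    "HOL-Algebra.Free_Abelian_Groups"
    "HOL-Computational_Algebra.Group_Closure"
begin

section \<open>Polytopes and the polytope group\<close>

text \<open>
  The library constant \<^const>\<open>polytope\<close> denotes convex, possibly lower-dimensional polytopes. Here
  polytopes are full-dimensional but need not be convex or connected.
\<close>

definition solid_polytope :: "'a::euclidean_space set \<Rightarrow> bool" where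
  "solid_polytope A \<longleftrightarrow>
     (\<exists>\<T>. finite \<T> \<and> (\<forall>T\<in>\<T>. int DIM('a) simplex T) \<and>
          pairwise (\<lambda>S T. interior S \<inter> interior T = {}) \<T> \<and> A = \<Union>\<T>)"

definition polytope_relators :: "('a::euclidean_space set \<Rightarrow>\<^sub>0 int) set" where
  "polytope_relators =
     {frag_of A + frag_of B - frag_of (A \<union> B) | A B.
        solid_polytope A \<and> solid_polytope B \<and> interior A \<inter> interior B = {}}"

definition polytope_group :: "('a::euclidean_space set \<Rightarrow>\<^sub>0 int) set monoid" where
  "polytope_group =
     free_Abelian_group {A. solid_polytope A} Mod
     generate (free_Abelian_group {A. solid_polytope A}) polytope_relators"

definition additive_on_polytopes :: "('a::euclidean_space set \<Rightarrow> real) \<Rightarrow> bool" where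
  "additive_on_polytopes \<phi> \<longleftrightarrow>
     (\<forall>A B. solid_polytope A \<and> solid_polytope B \<and> interior A \<inter> interior B = {} \<longrightarrow>
        \<phi> (A \<union> B) = \<phi> A + \<phi> B)"

definition frag_eval :: "('b \<Rightarrow> real) \<Rightarrow> ('b \<Rightarrow>\<^sub>0 int) \<Rightarrow> real" where
  "frag_eval \<phi> c = (\<Sum>A\<in>Poly_Mapping.keys c. of_int (Poly_Mapping.lookup c A) * \<phi> A)"

text \<open>
  The value does not depend on the chosen representative when \<open>\<phi>\<close> is additive
  (\<open>extend_additive_eq\<close> below).
\<close>

definition extend_additive ::
  "('a::euclidean_space set \<Rightarrow> real) \<Rightarrow> ('a set \<Rightarrow>\<^sub>0 int) set \<Rightarrow> real" where
  "extend_additive \<phi> P = frag_eval \<phi> (SOME c. c \<in> P)"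

text \<open>
  A version of the element \<open>\<chi>\<^sub>P\<close> of \<open>L\<^sup>1\<close>; other representatives of \<open>P\<close> give the same function
  almost everywhere (\<open>polytope_chi_AE\<close> below).
\<close>

definition polytope_chi :: "('a::euclidean_space set \<Rightarrow>\<^sub>0 int) set \<Rightarrow> 'a \<Rightarrow> real" where
  "polytope_chi P x = frag_eval (\<lambda>A. indicator A x) (SOME c. c \<in> P)"


section \<open>Lattices and tilings\<close>

definition is_lattice :: "'a::euclidean_space set \<Rightarrow> bool" where
  "is_lattice L \<longleftrightarrow> (\<exists>B. independent B \<and> card B = DIM('a) \<and> L = group_closure B)"

definition tiles_at_level ::
  "('a::euclidean_space set \<Rightarrow>\<^sub>0 int) set \<Rightarrow> 'a set \<Rightarrow> int \<Rightarrow> bool" where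
  "tiles_at_level P L k \<longleftrightarrow>
     (AE x in lborel. (\<Sum>\<^sub>\<infinity>l\<in>L. polytope_chi P (x - l)) = of_int k)"


section \<open>Flags\<close>

definition halfspace_in :: "'a::euclidean_space set \<Rightarrow> 'a set \<Rightarrow> 'a set \<Rightarrow> bool" where
  "halfspace_in W V H \<longleftrightarrow>
     (\<exists>a b. V = {x\<in>W. a \<bullet> x = b} \<and> H = {x\<in>W. a \<bullet> x \<ge> b} \<and> V \<noteq> W)"

text \<open>
  \<open>flat \<Phi> j\<close> is the affine subspace \<open>V\<^sub>j\<close> and \<open>pos \<Phi> j\<close> the (closed) positive half-space of
  \<open>V\<^sub>j\<^sub>+\<^sub>1\<close> bounded by \<open>V\<^sub>j\<close>. Both are empty at indices that do not belong to the flag, so that two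
  flags are equal iff they have the same subspaces and the same half-spaces.
\<close>

datatype 'a flag = Flag (flat: "nat \<Rightarrow> 'a set") (pos: "nat \<Rightarrow> 'a set")

definition is_flag :: "nat \<Rightarrow> 'a::euclidean_space flag \<Rightarrow> bool" where
  "is_flag r \<Phi> \<longleftrightarrow>
     r < DIM('a) \<and>
     flat \<Phi> DIM('a) = UNIV \<and>
     (\<forall>j\<in>{r..DIM('a)}. affine (flat \<Phi> j) \<and> aff_dim (flat \<Phi> j) = int j) \<and>
     (\<forall>j\<in>{r..<DIM('a)}. flat \<Phi> j \<subseteq> flat \<Phi> (Suc j) \<and>
        halfspace_in (flat \<Phi> (Suc j)) (flat \<Phi> j) (pos \<Phi> j)) \<and>
     (\<forall>j. j \<notin> {r..DIM('a)} \<longrightarrow> flat \<Phi> j = {}) \<and>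
     (\<forall>j. j \<notin> {r..<DIM('a)} \<longrightarrow> pos \<Phi> j = {})"

definition translate_flag :: "'a::euclidean_space \<Rightarrow> 'a flag \<Rightarrow> 'a flag" where
  "translate_flag l \<Phi> =
     Flag (\<lambda>j. (\<lambda>x. l + x) ` flat \<Phi> j) (\<lambda>j. (\<lambda>x. l + x) ` pos \<Phi> j)"


section \<open>Faces and Hadwiger functionals\<close>

definition locally_coincide :: "'a::euclidean_space \<Rightarrow> 'a set \<Rightarrow> 'a set \<Rightarrow> bool" where
  "locally_coincide x G H \<longleftrightarrow> (\<exists>e>0. ball x e \<inter> G = ball x e \<inter> H)"

text \<open>
  Facets of a polytope \<open>G\<close> that is full-dimensional in its affine hull \<open>W\<close> but not necessarily
  convex. For a hyperplane \<open>V\<close> of \<open>W\<close> and one of the two half-spaces \<open>H\<close> of \<open>W\<close> bounded by \<open>V\<close>,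
  consider the points of \<open>V\<close> near which \<open>G\<close> is exactly \<open>H\<close>; the facets are the closures of the
  connected components of this relatively open subset of \<open>V\<close>. Parts of \<open>V\<close> that \<open>G\<close> adjoins from
  opposite sides are different facets, even if they touch. For convex \<open>G\<close> these are the facets in
  the usual sense.
\<close>

definition polytope_facet :: "'a::euclidean_space set \<Rightarrow> 'a set \<Rightarrow> bool" where
  "polytope_facet F G \<longleftrightarrow>
     (\<exists>V H. halfspace_in (affine hull G) V H \<and>
        (\<exists>C \<in> components {x\<in>V. locally_coincide x G H}. F = closure C))"

text \<open>
  Faces of \<open>A\<close> are iterated facets, so \<open>F j\<close> is a \<open>j\<close>-dimensional face of \<open>A\<close>. That \<open>F j\<close> is
  a face of \<open>F (Suc j)\<close>, and not only a face of \<open>A\<close> that is a subset of it, is automatic for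
  convex \<open>A\<close> only: a wedge may stand with its edge in the middle of a facet of a cube.
\<close>

definition face_chains ::
  "nat \<Rightarrow> 'a::euclidean_space flag \<Rightarrow> 'a set \<Rightarrow> (nat \<Rightarrow> 'a set) set" where
  "face_chains r \<Phi> A =
     {F. F DIM('a) = A \<and>
         (\<forall>j\<in>{r..<DIM('a)}. polytope_facet (F j) (F (Suc j)) \<and> F j \<subseteq> flat \<Phi> j) \<and>
         (\<forall>j. j \<notin> {r..DIM('a)} \<longrightarrow> F j = {})}"

text \<open>
  For a facet \<open>F\<close> of \<open>G\<close> in the boundary of \<open>H\<close>, one point of local coincidence suffices:
  \<open>G\<close> cannot lie on different sides of \<open>F\<close> at different points.
\<close>

definition side_sign :: "'a::euclidean_space set \<Rightarrow> 'a set \<Rightarrow> 'a set \<Rightarrow> real" where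
  "side_sign H F G = (if \<exists>x\<in>F. locally_coincide x G H then 1 else - 1)"

text \<open>
  Lebesgue measure on the affine subspace \<open>V\<close>, in Cartesian coordinates given by an origin \<open>p\<close> and
  an orthonormal basis \<open>B\<close> of the direction of \<open>V\<close>. If \<open>V\<close> is a point, then \<open>B\<close> is empty and
  the point has volume 1.
\<close>

definition flat_volume :: "'a::euclidean_space set \<Rightarrow> 'a set \<Rightarrow> real" where
  "flat_volume V S =
     (let (p, B) = SOME (p, B). pairwise orthogonal B \<and> (\<forall>b\<in>B. norm b = 1) \<and>
                                V = (\<lambda>x. p + x) ` span B
      in measure (\<Pi>\<^sub>M b\<in>B. lborel)
           {t \<in> space (\<Pi>\<^sub>M b\<in>B. lborel). p + (\<Sum>b\<in>B. t b *\<^sub>R b) \<in> S})"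

definition flag_weight :: "nat \<Rightarrow> 'a::euclidean_space flag \<Rightarrow> 'a set \<Rightarrow> real" where
  "flag_weight r \<Phi> A =
     (\<Sum>F\<in>face_chains r \<Phi> A.
        (\<Prod>j\<in>{r..<DIM('a)}. side_sign (pos \<Phi> j) (F j) (F (Suc j))) *
        flat_volume (flat \<Phi> r) (F r))"

definition Hadwiger :: "nat \<Rightarrow> 'a::euclidean_space flag \<Rightarrow> 'a set \<Rightarrow> 'a set \<Rightarrow> real" where
  "Hadwiger r \<Phi> L A = (\<Sum>\<^sub>\<infinity>\<Psi>\<in>{translate_flag l \<Phi> | l. l \<in> L}. flag_weight r \<Psi> A)"

definition Hadwiger_ext ::
  "nat \<Rightarrow> 'a::euclidean_space flag \<Rightarrow> 'a set \<Rightarrow> ('a set \<Rightarrow>\<^sub>0 int) set \<Rightarrow> real" where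
  "Hadwiger_ext r \<Phi> L = extend_additive (Hadwiger r \<Phi> L)"


section \<open>Independence of representatives\<close>

lemma frag_eval_superset:
  assumes "finite S" "Poly_Mapping.keys c \<subseteq> S"
  shows "frag_eval \<phi> c = (\<Sum>A\<in>S. of_int (Poly_Mapping.lookup c A) * \<phi> A)"
  unfolding frag_eval_def
  using assms by (intro sum.mono_neutral_left) (auto simp: in_keys_iff)

lemma frag_eval_add: "frag_eval \<phi> (c + d) = frag_eval \<phi> c + frag_eval \<phi> d"
proof -
  let ?S = "Poly_Mapping.keys c \<union> Poly_Mapping.keys d"
  have "Poly_Mapping.keys (c + d) \<subseteq> ?S"
    by (rule keys_add)
  then show ?thesis
    by (simp add: frag_eval_superset[of ?S] lookup_add algebra_simps sum.distrib)
qed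

lemma frag_eval_0 [simp]: "frag_eval \<phi> 0 = 0"
  by (simp add: frag_eval_def)

lemma frag_eval_minus: "frag_eval \<phi> (- c) = - frag_eval \<phi> c"
  using frag_eval_add[of \<phi> c "- c"] by simp

lemma frag_eval_diff: "frag_eval \<phi> (c - d) = frag_eval \<phi> c - frag_eval \<phi> d"
  using frag_eval_add[of \<phi> c "- d"] by (simp add: frag_eval_minus)

lemma frag_eval_of [simp]: "frag_eval \<phi> (frag_of A) = \<phi> A"
  by (simp add: frag_eval_def)

lemma solid_polytope_Un:
  fixes A B :: "'a::euclidean_space set"
  assumes "solid_polytope A" "solid_polytope B" "interior A \<inter> interior B = {}"
  shows "solid_polytope (A \<union> B)"
proof -
  obtain S where S: "finite S" "\<forall>T\<in>S. int DIM('a) simplex T"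
    "pairwise (\<lambda>S T. interior S \<inter> interior T = {}) S" "A = \<Union>S"
    using assms(1) unfolding solid_polytope_def by blast
  obtain R where R: "finite R" "\<forall>T\<in>R. int DIM('a) simplex T"
    "pairwise (\<lambda>S T. interior S \<inter> interior T = {}) R" "B = \<Union>R"
    using assms(2) unfolding solid_polytope_def by blast
  have 1: "interior T \<inter> interior T' = {}" if "T \<in> S" "T' \<in> R" for T T'
    using that assms(3) S(4) R(4) interior_mono[of T A] interior_mono[of T' B] by blast
  have "pairwise (\<lambda>S T. interior S \<inter> interior T = {}) (S \<union> R)"
    using S(3) R(3) 1 unfolding pairwise_def by blast
  then show ?thesis
    unfolding solid_polytope_def using S R
    by (intro exI[of _ "S \<union> R"]) auto
qed

lemma polytope_relators_subset:
  "polytope_relators \<subseteq> carrier (free_Abelian_group {A. solid_polytope A})"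
proof
  fix c :: "'a set \<Rightarrow>\<^sub>0 int"
  assume "c \<in> polytope_relators"
  then obtain A B where c: "c = frag_of A + frag_of B - frag_of (A \<union> B)"
    and AB: "solid_polytope A" "solid_polytope B" "interior A \<inter> interior B = {}"
    unfolding polytope_relators_def by blast
  have "Poly_Mapping.keys c \<subseteq> {A, B, A \<union> B}"
    unfolding c by (auto simp: in_keys_iff lookup_add lookup_minus split: if_splits)
  then show "c \<in> carrier (free_Abelian_group {A. solid_polytope A})"
    using AB solid_polytope_Un[OF AB] by auto
qed

lemma keys_polytope_relator:
  "h \<in> polytope_relators \<Longrightarrow> Poly_Mapping.keys h \<subseteq> {A. solid_polytope A}"
  using subsetD[OF polytope_relators_subset, of h] by (simp only: carrier_free_Abelian_group_iff)

lemma polytope_group_diff: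
  assumes "P \<in> carrier polytope_group" "c \<in> P" "d \<in> P"
  shows "c - d \<in> generate (free_Abelian_group {A. solid_polytope A}) polytope_relators"
proof -
  let ?G = "free_Abelian_group {A :: 'a set. solid_polytope A}"
  let ?R = "generate ?G polytope_relators"
  interpret comm_group ?G by (rule abelian_free_Abelian_group)
  have sub: "subgroup ?R ?G"
    by (rule generate_is_subgroup[OF polytope_relators_subset])
  obtain g where "P = ?R #>\<^bsub>?G\<^esub> g"
    using assms(1) unfolding polytope_group_def FactGroup_def RCOSETS_def by auto
  then obtain u v where u: "u \<in> ?R" "c = u + g" and v: "v \<in> ?R" "d = v + g"
    using assms(2,3) unfolding r_coset_def by auto
  have "Poly_Mapping.keys v \<subseteq> {A. solid_polytope A}"
    using subgroup.mem_carrier[OF sub v(1)] by simp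
  then have "- v \<in> ?R"
    using subgroup.m_inv_closed[OF sub v(1)] by simp
  from subgroup.m_closed[OF sub u(1) this] have "u + - v \<in> ?R"
    by (simp only: mult_free_Abelian_group)
  then show ?thesis
    using u v by simp
qed

lemma frag_eval_relators:
  assumes "additive_on_polytopes \<phi>"
    and "c \<in> generate (free_Abelian_group {A. solid_polytope A}) polytope_relators"
  shows "frag_eval \<phi> c = 0"
proof -
  have rel: "frag_eval \<phi> h = 0" if hR: "h \<in> polytope_relators" for h
  proof -
    obtain A B where h: "h = frag_of A + frag_of B - frag_of (A \<union> B)"
      and AB: "solid_polytope A" "solid_polytope B" "interior A \<inter> interior B = {}"
      using hR unfolding polytope_relators_def by blast
    then have "\<phi> (A \<union> B) = \<phi> A + \<phi> B"
      using assms(1) unfolding additive_on_polytopes_def by blast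
    then show ?thesis
      by (simp add: h frag_eval_add frag_eval_diff)
  qed
  show ?thesis
    using assms(2)
  proof induction
    case one
    then show ?case by simp
  next
    case (incl h)
    then show ?case by (rule rel)
  next
    case (inv h)
    then have keys: "Poly_Mapping.keys h \<subseteq> {A. solid_polytope A}"
      by (rule keys_polytope_relator)
    show ?case
      by (simp only: inv_free_Abelian_group[OF keys] frag_eval_minus rel[OF inv] minus_zero)
  next
    case (eng h1 h2)
    then show ?case by (simp add: frag_eval_add)
  qed
qed

lemma extend_additive_eq:
  assumes "additive_on_polytopes \<phi>" "P \<in> carrier polytope_group" "c \<in> P"
  shows "extend_additive \<phi> P = frag_eval \<phi> c"
proof -
  have "(SOME c. c \<in> P) \<in> P"
    using assms(3) by (rule someI)
  from polytope_group_diff[OF assms(2) this assms(3)] show ?thesis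
    using frag_eval_relators[OF assms(1)] by (fastforce simp: extend_additive_def frag_eval_diff)
qed

lemma solid_polytope_closed:
  fixes A :: "'a::euclidean_space set"
  assumes "solid_polytope A"
  shows "closed A"
proof -
  obtain S where S: "finite S" "\<forall>T\<in>S. int DIM('a) simplex T" "A = \<Union>S"
    using assms unfolding solid_polytope_def by blast
  then have "\<forall>T\<in>S. closed T"
    using simplex_imp_polytope polytope_imp_closed by metis
  then show ?thesis
    using S closed_Union by metis
qed

lemma solid_polytope_frontier_null:
  fixes A :: "'a::euclidean_space set"
  assumes "solid_polytope A"
  shows "negligible (frontier A)"
proof -
  obtain S where S: "finite S" "\<forall>T\<in>S. int DIM('a) simplex T" "A = \<Union>S"
    using assms unfolding solid_polytope_def by blast
  have "frontier A \<subseteq> \<Union>(frontier ` S)"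
    using frontier_Union_subset[OF S(1)] S(3) by blast
  moreover have "negligible (\<Union>(frontier ` S))"
    using S(1,2) by (intro negligible_Union) (auto simp: simplex_def negligible_convex_frontier)
  ultimately show ?thesis
    by (rule negligible_subset[rotated])
qed

lemma indicator_Un_AE:
  fixes A B :: "'a::euclidean_space set"
  assumes "solid_polytope A" "solid_polytope B" "interior A \<inter> interior B = {}"
  shows "AE x in lborel. (indicator (A \<union> B) x :: real) = indicator A x + indicator B x"
proof -
  have "negligible (frontier A \<union> frontier B)"
    by (intro negligible_Un solid_polytope_frontier_null assms)
  then have null: "frontier A \<union> frontier B \<in> null_sets lebesgue"
    by (simp add: negligible_iff_null_sets)
  moreover have "frontier A \<union> frontier B \<in> sets lborel"
    by (simp add: borel_closed closed_Un)
  ultimately have "frontier A \<union> frontier B \<in> null_sets lborel"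
    by (simp add: null_sets_def)
  moreover have "A \<inter> B \<subseteq> frontier A \<union> frontier B"
    using assms solid_polytope_closed[of A] solid_polytope_closed[of B]
    by (auto simp: frontier_def)
  ultimately show ?thesis
    by (intro AE_I') (auto simp: indicator_def)
qed

lemma polytope_chi_AE:
  fixes P :: "('a::euclidean_space set \<Rightarrow>\<^sub>0 int) set"
  assumes "P \<in> carrier polytope_group" "c \<in> P"
  shows "AE x in lborel. polytope_chi P x = frag_eval (\<lambda>A. indicator A x) c"
proof -
  have rel: "AE x in lborel. frag_eval (\<lambda>A. indicator A x) h = 0"
    if hR: "h \<in> polytope_relators" for h :: "'a set \<Rightarrow>\<^sub>0 int"
  proof -
    obtain A B where h: "h = frag_of A + frag_of B - frag_of (A \<union> B)"
      and AB: "solid_polytope A" "solid_polytope B" "interior A \<inter> interior B = {}"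
      using hR unfolding polytope_relators_def by blast
    from indicator_Un_AE[OF AB] show ?thesis
      by eventually_elim (simp add: h frag_eval_add frag_eval_diff)
  qed
  have 0: "AE x in lborel. frag_eval (\<lambda>A. indicator A x) u = 0"
    if "u \<in> generate (free_Abelian_group {A :: 'a set. solid_polytope A}) polytope_relators" for u
    using that
  proof induction
    case one
    then show ?case by simp
  next
    case (incl h)
    then show ?case by (rule rel)
  next
    case (inv h)
    then have keys: "Poly_Mapping.keys h \<subseteq> {A. solid_polytope A}"
      by (rule keys_polytope_relator)
    from rel[OF inv] show ?case
      by eventually_elim (simp only: inv_free_Abelian_group[OF keys] frag_eval_minus neg_equal_0_iff_equal)
  next
    case (eng h1 h2)
    from eng.IH show ?case
      by eventually_elim (simp add: frag_eval_add)
  qed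
  have "(SOME c. c \<in> P) \<in> P"
    using assms(2) by (rule someI)
  from 0[OF polytope_group_diff[OF assms(1) this assms(2)]] show ?thesis
    by eventually_elim (simp add: polytope_chi_def frag_eval_diff)
qed

end

theory Submission
  imports Defs
begin

text \<open>
  The tiling sum \<open>f(x) = \<Sum>\<^sub>l \<chi>\<^sub>P(x - l)\<close> is locally constant off a locally finite family of
  hyperplane pieces. Along a flag one takes iterated jumps of \<open>f\<close>: first the jump across \<open>V\<^sub>d\<^sub>-\<^sub>1\<close>,
  a function on \<open>V\<^sub>d\<^sub>-\<^sub>1\<close>, then its jump across \<open>V\<^sub>d\<^sub>-\<^sub>2\<close>, down to a function on \<open>V\<^sub>r\<close>. At
  generic points of \<open>V\<^sub>r\<close> the iterated jump of the indicator of a polytope is the signed sum of the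
  indicators of the end faces of its face chains, so that its integral over \<open>V\<^sub>r\<close> is \<open>\<omega>\<^sub>\<Phi>\<close>.
  If the iterated jump of \<open>f\<close> equals a constant \<open>\<gamma>\<close> on \<open>V\<^sub>r\<close>, then unfolding the lattice sum with a
  partition of unity for the stabilizer of the flag gives \<open>H\<^sub>\<Phi>(P, L) = \<gamma> \<kappa>\<close> with \<open>\<kappa> > 0\<close>.
  If \<open>f\<close> is constant, all iterated jumps vanish, and so do all Hadwiger functionals. If \<open>f\<close> is not
  constant, it has a nonzero jump across some hyperplane; as long as the iterated jump is not constant
  on \<open>V\<^sub>j\<close>, it has a nonzero jump across some \<open>V\<^sub>j\<^sub>-\<^sub>1\<close>. This descent ends with a nonzero constant, at
  the latest on the point \<open>V\<^sub>0\<close>.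
\<close>

section \<open>Hyperplane arrangements\<close>

text \<open>A flat of the flag is a null set in the next one, so a function known only almost
  everywhere on the larger flat has no jump across the smaller. All functions are therefore kept
  pointwise, and "almost everywhere" is replaced by "at points generic for a finite arrangement of
  hyperplanes": a ray leaving a generic point of a flat transversally runs through generic points of
  the next larger flat, so identities between functions at generic points survive repeated jumps.
  Integration takes place on the bottom flat only. Since the tiling sum has infinitely many pieces,
  each statement about it is made in a ball, with an arrangement depending on the radius. A second
  obstacle is that volume on a flat is defined through an arbitrarily chosen orthonormal frame;
  comparing the translates of a flag requires independence of this choice, which is obtained from
  uniqueness of Haar measure. The factor \<kappa> is the integral over the bottom flat of a cutoff
  function whose translates by the stabilizer sum to one on a large ball.\<close>

definition same_side :: "('a::euclidean_space \<times> real) set \<Rightarrow> 'a \<Rightarrow> 'a \<Rightarrow> bool" where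
  "same_side H x y \<longleftrightarrow> (\<forall>(a, b)\<in>H. sgn (a \<bullet> x - b) = sgn (a \<bullet> y - b))"

text \<open>The classes of \<open>same_side H\<close> are the cells, of every dimension, of the
  arrangement; saturated sets are the unions of cells. Normals in \<open>H\<close> may be zero, in
  which case the sign is constant.\<close>

definition saturated :: "('a::euclidean_space \<times> real) set \<Rightarrow> 'a set \<Rightarrow> bool" where
  "saturated H S \<longleftrightarrow> (\<forall>x y. same_side H x y \<longrightarrow> x \<in> S \<longrightarrow> y \<in> S)"

text \<open>Hyperplanes containing \<open>V\<close> have to be exempt, because the flats of a flag
  lie in hyperplanes of the arrangement. For finite \<open>H\<close> the points of \<open>V\<close>
  that are excluded form a finite union of proper subflats.\<close>

definition generic_in :: "('a::euclidean_space \<times> real) set \<Rightarrow> 'a set \<Rightarrow> 'a \<Rightarrow> bool" where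
  "generic_in H V x \<longleftrightarrow> x \<in> V \<and> (\<forall>(a, b)\<in>H. a \<bullet> x = b \<longrightarrow> V \<subseteq> {y. a \<bullet> y = b})"

lemma same_side_refl [simp]: "same_side H x x"
  by (auto simp: same_side_def)

lemma same_side_sym: "same_side H x y \<Longrightarrow> same_side H y x"
  by (auto simp: same_side_def split: prod.splits)

lemma same_side_trans: "same_side H x y \<Longrightarrow> same_side H y z \<Longrightarrow> same_side H x z"
  by (fastforce simp: same_side_def)

lemma same_side_mono: "same_side H' x y \<Longrightarrow> H \<subseteq> H' \<Longrightarrow> same_side H x y"
  by (auto simp: same_side_def)

lemma saturated_mono: "saturated H S \<Longrightarrow> H \<subseteq> H' \<Longrightarrow> saturated H' S"
  unfolding saturated_def using same_side_mono by blast

lemma saturated_iff: "saturated H S \<Longrightarrow> same_side H x y \<Longrightarrow> x \<in> S \<longleftrightarrow> y \<in> S"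
  unfolding saturated_def using same_side_sym by blast

lemma saturated_UNIV [simp]: "saturated H UNIV"
  by (simp add: saturated_def)

lemma saturated_Int: "saturated H S \<Longrightarrow> saturated H T \<Longrightarrow> saturated H (S \<inter> T)"
  unfolding saturated_def by blast

lemma saturated_Union: "(\<And>S. S \<in> \<A> \<Longrightarrow> saturated H S) \<Longrightarrow> saturated H (\<Union>\<A>)"
  unfolding saturated_def by blast

lemma saturated_Inter: "(\<And>S. S \<in> \<A> \<Longrightarrow> saturated H S) \<Longrightarrow> saturated H (\<Inter>\<A>)"
  unfolding saturated_def by blast

lemma saturated_hyperplane: "(a, b) \<in> H \<Longrightarrow> saturated H {x. a \<bullet> x = b}"
  unfolding saturated_def same_side_def by (fastforce simp: sgn_if split: if_splits)

lemma saturated_halfspace_ge: "(a, b) \<in> H \<Longrightarrow> saturated H {x. a \<bullet> x \<ge> b}"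
  unfolding saturated_def same_side_def by (fastforce simp: sgn_if split: if_splits)

lemma saturated_halfspace_le: "(a, b) \<in> H \<Longrightarrow> saturated H {x. a \<bullet> x \<le> b}"
  unfolding saturated_def same_side_def by (fastforce simp: sgn_if split: if_splits)

lemma generic_in_mono: "generic_in H' V x \<Longrightarrow> H \<subseteq> H' \<Longrightarrow> generic_in H V x"
  unfolding generic_in_def by blast

lemma generic_inD: "generic_in H V x \<Longrightarrow> x \<in> V"
  by (simp add: generic_in_def)

text \<open>A saturated set is the preimage of a set of sign vectors, and each hyperplane offers
  three signs. Finiteness of the facets, and later of the translated flags that matter, rests on
  this count.\<close>

lemma finite_saturated:
  assumes "finite H"
  shows "finite {S. saturated H S}"
proof -
  define s where "s x = (\<lambda>h\<in>H. sgn (fst h \<bullet> x - snd h))" for x :: 'a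
  have "range s \<subseteq> (\<Pi>\<^sub>E h\<in>H. {-1, 0, 1})"
  proof -
    have sgn: "sgn t \<in> {- 1, 0, 1}" for t :: real by (simp add: sgn_if)
    show ?thesis
      unfolding s_def by (rule image_subsetI, subst restrict_PiE_iff, rule ballI, rule sgn)
  qed
  then have fin: "finite (range s)"
    by (rule finite_subset) (intro finite_PiE assms, simp)
  have eq: "same_side H x y" if "s x = s y" for x y
    unfolding same_side_def
  proof clarify
    fix a b assume "(a, b) \<in> H"
    then show "sgn (a \<bullet> x - b) = sgn (a \<bullet> y - b)"
      using fun_cong[OF that, of "(a, b)"] by (simp add: s_def)
  qed
  have "S \<in> (\<lambda>K. s -` K) ` Pow (range s)" if S: "saturated H S" for S
  proof (rule image_eqI)
    have "x \<in> S" if "s x = s y" "y \<in> S" for x y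
      using S that eq[of y x] unfolding saturated_def by simp
    then show "S = s -` (s ` S)" by auto
  qed auto
  then have "{S. saturated H S} \<subseteq> (\<lambda>K. s -` K) ` Pow (range s)"
    by (intro subsetI) simp
  then show ?thesis
    by (rule finite_subset) (simp add: fin)
qed

text \<open>Near \<open>x\<close> the arrangement is a cone with apex \<open>x\<close>: hyperplanes
  missing \<open>x\<close> keep their sign, those through \<open>x\<close> see only the
  displacement.\<close>

lemma local_signs:
  fixes x :: "'a::euclidean_space"
  assumes "finite H"
  shows "\<exists>e>0. \<forall>z. norm z < e \<longrightarrow> (\<forall>(a, b)\<in>H.
           sgn (a \<bullet> (x + z) - b) = (if a \<bullet> x = b then sgn (a \<bullet> z) else sgn (a \<bullet> x - b)))"
proof -
  have ev: "eventually (\<lambda>z. sgn (a \<bullet> (x + z) - b) =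
          (if a \<bullet> x = b then sgn (a \<bullet> z) else sgn (a \<bullet> x - b))) (nhds 0)" for a b
  proof (cases "a \<bullet> x = b")
    case True
    then show ?thesis by (simp add: inner_add_right)
  next
    case False
    have "((\<lambda>z. \<bar>a \<bullet> z\<bar>) \<longlongrightarrow> \<bar>a \<bullet> 0\<bar>) (nhds 0)"
      by (intro tendsto_intros filterlim_ident)
    then have "eventually (\<lambda>z. \<bar>a \<bullet> z\<bar> < \<bar>a \<bullet> x - b\<bar>) (nhds 0)"
      using False by (intro order_tendstoD) auto
    then show ?thesis
      by eventually_elim (use False in \<open>auto simp: inner_add_right sgn_if\<close>)
  qed
  have "eventually (\<lambda>z. \<forall>h\<in>H. (\<lambda>(a, b). sgn (a \<bullet> (x + z) - b) =
          (if a \<bullet> x = b then sgn (a \<bullet> z) else sgn (a \<bullet> x - b))) h) (nhds 0)"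
  proof (intro eventually_ball_finite assms ballI)
    fix h assume "h \<in> H"
    obtain a b where "h = (a, b)" by force
    then show "eventually (\<lambda>z. (\<lambda>(a, b). sgn (a \<bullet> (x + z) - b) =
          (if a \<bullet> x = b then sgn (a \<bullet> z) else sgn (a \<bullet> x - b))) h) (nhds 0)"
      using ev[of a b] by (simp only: prod.case)
  qed
  then show ?thesis
    by (simp add: eventually_nhds_metric dist_norm)
qed

text \<open>By \<open>local_signs\<close> the signs at \<open>x + z\<close> depend only on
  \<open>z\<close> and the signs at \<open>x\<close>. The arrangement looks the same near all points
  of a cell, which is why local operations (closure, local coincidence, limits along rays) need no
  new hyperplanes.\<close>

lemma same_side_shift:
  fixes x :: "'a::euclidean_space"
  assumes "finite H" "same_side H x y"
  obtains e where "e > 0" "\<And>z. norm z < e \<Longrightarrow> same_side H (x + z) (y + z)"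
proof -
  obtain e1 where e1: "e1 > 0" "\<And>z a b. norm z < e1 \<Longrightarrow> (a, b) \<in> H \<Longrightarrow>
      sgn (a \<bullet> (x + z) - b) = (if a \<bullet> x = b then sgn (a \<bullet> z) else sgn (a \<bullet> x - b))"
    using local_signs[OF assms(1), of x] by blast
  obtain e2 where e2: "e2 > 0" "\<And>z a b. norm z < e2 \<Longrightarrow> (a, b) \<in> H \<Longrightarrow>
      sgn (a \<bullet> (y + z) - b) = (if a \<bullet> y = b then sgn (a \<bullet> z) else sgn (a \<bullet> y - b))"
    using local_signs[OF assms(1), of y] by blast
  have 0: "a \<bullet> x = b \<longleftrightarrow> a \<bullet> y = b" "sgn (a \<bullet> x - b) = sgn (a \<bullet> y - b)" if "(a, b) \<in> H" for a b
    using assms(2) that unfolding same_side_def by (fastforce simp: sgn_if split: if_splits)+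
  show ?thesis
  proof
    show "min e1 e2 > 0" using e1 e2 by simp
    show "same_side H (x + z) (y + z)" if "norm z < min e1 e2" for z
      unfolding same_side_def using e1(2)[of z] e2(2)[of z] 0 that by auto
  qed
qed

lemma generic_in_cell:
  fixes x :: "'a::euclidean_space"
  assumes "finite H" "generic_in H V x"
  obtains e where "e > 0" "\<And>y. y \<in> V \<Longrightarrow> dist x y < e \<Longrightarrow> same_side H x y"
proof -
  obtain e where e: "e > 0" "\<And>z a b. norm z < e \<Longrightarrow> (a, b) \<in> H \<Longrightarrow>
      sgn (a \<bullet> (x + z) - b) = (if a \<bullet> x = b then sgn (a \<bullet> z) else sgn (a \<bullet> x - b))"
    using local_signs[OF assms(1), of x] by blast
  show ?thesis
  proof
    show "e > 0" by fact
    show "same_side H x y" if "y \<in> V" "dist x y < e" for y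
      unfolding same_side_def
    proof clarify
      fix a b assume ab: "(a, b) \<in> H"
      have "a \<bullet> y = b" if "a \<bullet> x = b"
        using assms(2) ab \<open>y \<in> V\<close> that unfolding generic_in_def by blast
      then show "sgn (a \<bullet> x - b) = sgn (a \<bullet> y - b)"
        using e(2)[of "y - x" a b] ab that(2) by (auto simp: dist_norm norm_minus_commute)
    qed
  qed
qed

lemma generic_in_near:
  fixes x :: "'a::euclidean_space"
  assumes "finite H" "generic_in H V x"
  obtains e where "e > 0" "\<And>y. y \<in> V \<Longrightarrow> dist x y < e \<Longrightarrow> generic_in H V y"
proof -
  obtain e where e: "e > 0" "\<And>y. y \<in> V \<Longrightarrow> dist x y < e \<Longrightarrow> same_side H x y"
    using generic_in_cell[OF assms] by blast
  have "generic_in H V y" if "y \<in> V" "same_side H x y" for y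
    using assms(2) that unfolding generic_in_def same_side_def
    by (fastforce simp: sgn_if split: if_splits)
  then show ?thesis
    using that e by blast
qed

text \<open>Induction over \<open>H\<close>: if the new hyperplane contains \<open>y\<close> but not
  \<open>V\<close>, a small move inside \<open>V\<close> towards a point off the hyperplane leaves
  it, and \<open>generic_in_near\<close> keeps genericity for the earlier ones.\<close>

lemma generic_in_dense:
  fixes V :: "'a::euclidean_space set"
  assumes "finite H" "affine V" "x \<in> V" "e > 0"
  shows "\<exists>y. generic_in H V y \<and> dist x y < e"
  using assms(1)
proof induction
  case empty
  then show ?case using assms by (intro exI[of _ x]) (simp add: generic_in_def)
next
  case (insert h H)
  obtain a b where h: "h = (a, b)" by force
  obtain y where y: "generic_in H V y" "dist x y < e"
    using insert by blast
  have yV: "y \<in> V" using y by (rule_tac generic_inD)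
  show ?case
  proof (cases "V \<subseteq> {y. a \<bullet> y = b} \<or> a \<bullet> y \<noteq> b")
    case True
    then show ?thesis using y by (intro exI[of _ y]) (auto simp: generic_in_def h)
  next
    case False
    then obtain v where v: "v \<in> V" "a \<bullet> v \<noteq> b" "a \<bullet> y = b" by blast
    obtain e' where e': "e' > 0" "\<And>z. z \<in> V \<Longrightarrow> dist y z < e' \<Longrightarrow> generic_in H V z"
      using generic_in_near[OF insert(1) y(1)] by blast
    define d where "d = min e' (e - dist x y)"
    have d: "d > 0" using e' y by (simp add: d_def)
    define t where "t = d / (2 * (norm (v - y) + 1))"
    have t: "t > 0" using d by (simp add: t_def add_nonneg_pos)
    define z where "z = y + t *\<^sub>R (v - y)"
    have zV: "z \<in> V"
      using mem_affine[OF assms(2) yV v(1), of "1 - t" t] by (simp add: z_def algebra_simps)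
    have pos: "norm (v - y) + 1 > 0" using norm_ge_zero[of "v - y"] by linarith
    have "dist y z = t * norm (v - y)" using t by (simp add: z_def dist_norm)
    also have "\<dots> < t * (2 * (norm (v - y) + 1))"
      using t pos by (intro mult_strict_left_mono) auto
    also have "\<dots> = d" using pos by (simp add: t_def)
    finally have dz: "dist y z < d" .
    have "a \<bullet> z - b = t * (a \<bullet> v - b)" using v by (simp add: z_def algebra_simps)
    then have "a \<bullet> z \<noteq> b" using v t by auto
    moreover have "generic_in H V z" using e' zV dz by (simp add: d_def)
    moreover have "dist x z < e" using dz dist_triangle[of x z y] by (simp add: d_def dist_commute)
    ultimately show ?thesis by (intro exI[of _ z]) (auto simp: generic_in_def h)
  qed
qed

lemma saturated_closure:
  assumes "finite H" "saturated H S"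
  shows "saturated H (closure S)"
  unfolding saturated_def
proof (intro allI impI)
  fix x y assume xy: "same_side H x y" and x: "x \<in> closure S"
  obtain e where e: "e > 0" "\<And>z. norm z < e \<Longrightarrow> same_side H (x + z) (y + z)"
    using same_side_shift[OF assms(1) xy] by blast
  show "y \<in> closure S"
    unfolding closure_approachable
  proof (intro allI impI)
    fix d :: real assume "d > 0"
    then have "min d e > 0" using e by simp
    then obtain u where u: "u \<in> S" "dist u x < min d e"
      using x unfolding closure_approachable by blast
    then have "same_side H u (y + (u - x))"
      using e(2)[of "u - x"] by (simp add: dist_norm)
    then show "\<exists>v\<in>S. dist v y < d"
      using u assms(2) unfolding saturated_def by (intro bexI[of _ "y + (u - x)"]) (auto simp: dist_norm)
  qed
qed

lemma saturated_locally_coincide: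
  assumes "finite H" "saturated H G" "saturated H K"
  shows "saturated H {x. locally_coincide x G K}"
  unfolding saturated_def
proof (intro allI impI)
  fix x y assume xy: "same_side H x y" and x: "x \<in> {x. locally_coincide x G K}"
  obtain e where e: "e > 0" "\<And>z. norm z < e \<Longrightarrow> same_side H (x + z) (y + z)"
    using same_side_shift[OF assms(1) xy] by blast
  obtain d where d: "d > 0" "ball x d \<inter> G = ball x d \<inter> K"
    using x by (auto simp: locally_coincide_def)
  have "u \<in> G \<longleftrightarrow> u \<in> K" if "dist y u < min d e" for u
  proof -
    have "same_side H (x + (u - y)) u"
      using e(2)[of "u - y"] that by (simp add: dist_norm norm_minus_commute)
    moreover have "x + (u - y) \<in> ball x d"
      using that by (simp add: dist_norm norm_minus_commute)
    ultimately show ?thesis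
      using d saturated_iff[OF assms(2)] saturated_iff[OF assms(3)] by blast
  qed
  then have "ball y (min d e) \<inter> G = ball y (min d e) \<inter> K" by auto
  then show "y \<in> {x. locally_coincide x G K}"
    using d e unfolding locally_coincide_def by (auto intro!: exI[of _ "min d e"])
qed

lemma sgn_level_set:
  fixes a :: "'a::euclidean_space"
  shows "{y. sgn (a \<bullet> y - b) = sgn (a \<bullet> x - b)} =
      (if a \<bullet> x = b then {y. a \<bullet> y = b} else if a \<bullet> x > b then {y. a \<bullet> y > b} else {y. a \<bullet> y < b})"
  by (auto simp: sgn_if split: if_splits)

lemma cell_eq_Inter:
  "{y. same_side H x y} = (\<Inter>h\<in>H. {y. sgn (fst h \<bullet> y - snd h) = sgn (fst h \<bullet> x - snd h)})"
  by (fastforce simp: same_side_def)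

lemma convex_cell: "convex {y. same_side H x y}"
  unfolding cell_eq_Inter sgn_level_set
  by (rule convex_INT) (simp add: convex_hyperplane convex_halfspace_lt convex_halfspace_gt)

text \<open>Cells are convex, hence connected, so a cell inside \<open>U\<close> lies in a single
  component.\<close>

lemma saturated_components:
  assumes "saturated H U" "C \<in> components U"
  shows "saturated H C"
  unfolding saturated_def
proof (intro allI impI)
  fix x y assume xy: "same_side H x y" and x: "x \<in> C"
  have "x \<in> U" using x in_components_subset[OF assms(2)] by blast
  then have "{y. same_side H x y} \<subseteq> U" using assms(1) unfolding saturated_def by blast
  moreover have "connected {y. same_side H x y}" by (intro convex_connected convex_cell)
  moreover have "C \<inter> {y. same_side H x y} \<noteq> {}" using x by auto
  ultimately have "{y. same_side H x y} \<subseteq> C"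
    using components_maximal[OF assms(2)] by blast
  then show "y \<in> C" using xy by blast
qed

lemma saturated_borel:
  assumes "finite H" "saturated H S"
  shows "S \<in> sets borel"
proof -
  let ?cell = "\<lambda>x. {y. same_side H x y}"
  have cell: "?cell x \<in> sets borel" for x
  proof (cases "H = {}")
    case False
    have "{y. sgn (a \<bullet> y - b) = sgn (a \<bullet> x - b)} \<in> sets borel" for a :: 'a and b
      unfolding sgn_level_set
      by (auto intro: borel_closed borel_open closed_hyperplane open_halfspace_lt open_halfspace_gt)
    then show ?thesis
      unfolding cell_eq_Inter using assms(1) False by (intro sets.finite_INT) auto
  qed (simp add: same_side_def)
  have "S = \<Union>(?cell ` S)"
    using assms(2) unfolding saturated_def by (auto intro: same_side_refl)
  moreover have "finite (?cell ` S)"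
    by (rule finite_subset[OF _ finite_saturated[OF assms(1)]])
       (auto simp: saturated_def intro: same_side_trans)
  ultimately show ?thesis
    using cell by (metis (no_types, lifting) sets.finite_Union image_iff subsetI)
qed

definition side_measurable :: "('a::euclidean_space \<times> real) set \<Rightarrow> ('a \<Rightarrow> real) \<Rightarrow> bool" where
  "side_measurable H f \<longleftrightarrow> (\<forall>x y. same_side H x y \<longrightarrow> f x = f y)"

lemma side_measurable_indicator: "saturated H S \<Longrightarrow> side_measurable H (indicator S)"
  unfolding side_measurable_def using saturated_iff by (fastforce simp: indicator_def)

lemma side_measurable_borel:
  assumes "finite H" "side_measurable H f"
  shows "f \<in> borel_measurable borel"
proof (rule measurableI)
  fix X :: "real set"
  have "saturated H (f -` X)"
    using assms(2) unfolding saturated_def side_measurable_def by auto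
  then show "f -` X \<inter> space borel \<in> sets borel"
    using saturated_borel[OF assms(1)] by simp
qed simp

section \<open>Facets on a hyperplane\<close>

text \<open>Slide \<open>w\<close> along \<open>n\<close> to the hyperplane of \<open>W\<close>,
  where both functionals vanish. The factor compares their slopes along \<open>n\<close>: its sign
  tells whether they have the same or opposite positive sides, and it is zero when the second
  hyperplane contains \<open>W\<close>.\<close>

lemma halfplane_proportional:
  fixes a a0 n :: "'a::euclidean_space"
  assumes dir: "\<And>w s. w \<in> W \<Longrightarrow> w + s *\<^sub>R n \<in> W" and n: "a0 \<bullet> n \<noteq> 0"
    and sub: "{x\<in>W. a0 \<bullet> x = b0} \<subseteq> {x. a \<bullet> x = b}" and w: "w \<in> W"
  shows "a \<bullet> w - b = ((a \<bullet> n) / (a0 \<bullet> n)) * (a0 \<bullet> w - b0)"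
proof -
  define s where "s = (a0 \<bullet> w - b0) / (a0 \<bullet> n)"
  have "w + (- s) *\<^sub>R n \<in> {x\<in>W. a0 \<bullet> x = b0}"
    using dir[OF w, of "- s"] n by (simp add: inner_diff_right s_def)
  then have "a \<bullet> (w + (- s) *\<^sub>R n) = b" using sub by blast
  then show ?thesis by (simp add: inner_diff_right s_def mult.commute)
qed

text \<open>The direction \<open>n\<close> of \<open>W\<close> crosses \<open>V\<close> towards
  \<open>H\<close> but need not be perpendicular to \<open>V\<close>: at generic points only the
  side matters (see \<open>upper_signs\<close>).\<close>

lemma halfspace_in_normal:
  fixes W :: "'a::euclidean_space set"
  assumes "halfspace_in W V H" "affine W" "V \<noteq> {}"
  obtains a b n where "V = {x\<in>W. a \<bullet> x = b}" "H = {x\<in>W. a \<bullet> x \<ge> b}" "a \<bullet> n > 0"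
    "\<And>w s. w \<in> W \<Longrightarrow> w + s *\<^sub>R n \<in> W"
proof -
  obtain a b where ab: "V = {x\<in>W. a \<bullet> x = b}" "H = {x\<in>W. a \<bullet> x \<ge> b}" "V \<noteq> W"
    using assms(1) unfolding halfspace_in_def by blast
  obtain v where v: "v \<in> W" "a \<bullet> v = b" using ab assms(3) by blast
  obtain w where w: "w \<in> W" "a \<bullet> w \<noteq> b" using ab by blast
  define n where "n = (if a \<bullet> w > b then w - v else v - w)"
  have 1: "u + s *\<^sub>R (w - v) \<in> W" if "u \<in> W" for u s
    using mem_affine_3_minus[OF assms(2) that w(1) v(1), of s] by simp
  have 2: "u + s *\<^sub>R n \<in> W" if "u \<in> W" for u s
    using 1[OF that, of s] 1[OF that, of "- s"] by (auto simp: n_def algebra_simps)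
  have "a \<bullet> n > 0" using v w by (auto simp: n_def inner_diff_right)
  then show ?thesis using that ab 2 by blast
qed

lemma locally_coincide_near:
  assumes "locally_coincide x G K"
  obtains e where "e > 0" "\<And>y. dist x y < e \<Longrightarrow> locally_coincide y G K"
proof -
  obtain e where e: "e > 0" "ball x e \<inter> G = ball x e \<inter> K"
    using assms by (auto simp: locally_coincide_def)
  have "locally_coincide y G K" if "dist x y < e" for y
  proof -
    have "ball y (e - dist x y) \<subseteq> ball x e"
    proof
      fix z assume "z \<in> ball y (e - dist x y)"
      then show "z \<in> ball x e" using dist_triangle[of x z y] by simp
    qed
    then have "ball y (e - dist x y) \<inter> G = ball y (e - dist x y) \<inter> K" using e(2) by blast
    then show ?thesis using that unfolding locally_coincide_def by (intro exI[of _ "e - dist x y"]) auto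
  qed
  then show ?thesis using that e by blast
qed

lemma affine_hull_ball_Int:
  fixes V :: "'a::euclidean_space set"
  assumes "affine V" "x \<in> V" "e > 0"
  shows "affine hull (V \<inter> ball x e) = V"
proof -
  have "V \<inter> interior (ball x e) \<noteq> {}"
    using assms by auto
  from affine_hull_affine_Int_nonempty_interior[OF assms(1) this] show ?thesis
    using assms(1) by (simp add: affine_hull_eq)
qed

text \<open>Local coincidence persists in a whole ball. Its trace on \<open>V\<close> is convex and
  meets \<open>C\<close>, hence stays in that component.\<close>

lemma component_ball:
  fixes V :: "'a::euclidean_space set"
  assumes "affine V" "C \<in> components {x\<in>V. locally_coincide x G K}" "x \<in> V"
    "locally_coincide x G K" "x \<in> closure C"
  obtains e where "e > 0" "V \<inter> ball x e \<subseteq> C"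
proof -
  let ?U = "{x\<in>V. locally_coincide x G K}"
  obtain e where e: "e > 0" "\<And>y. dist x y < e \<Longrightarrow> locally_coincide y G K"
    using locally_coincide_near[OF assms(4)] by blast
  have sub: "V \<inter> ball x e \<subseteq> ?U" using e by auto
  have conn: "connected (V \<inter> ball x e)"
    using assms(1) by (intro convex_connected convex_Int affine_imp_convex convex_ball)
  obtain c where "c \<in> C" "dist c x < e"
    using assms(5) e unfolding closure_approachable by blast
  moreover have "C \<subseteq> V" using in_components_subset[OF assms(2)] by blast
  ultimately have "C \<inter> (V \<inter> ball x e) \<noteq> {}" by (auto simp: dist_commute)
  then have "V \<inter> ball x e \<subseteq> C"
    using components_maximal[OF assms(2) conn sub] by blast
  then show ?thesis using that e by blast
qed

lemma affine_subset_of_ball: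
  fixes V V' :: "'a::euclidean_space set"
  assumes "affine V" "affine V'" "x \<in> V'" "e > 0" "V' \<inter> ball x e \<subseteq> V"
  shows "V' \<subseteq> V"
  using affine_hull_ball_Int[OF assms(2-4)] hull_minimal[of _ V affine] assms by metis

text \<open>A point \<open>v\<close> of \<open>V\<close> outside \<open>V'\<close> would give a
  direction \<open>v - x\<close> parallel to \<open>V\<close> and transverse to \<open>V'\<close>.
  Every point of \<open>W\<close> could be slid along it into \<open>V'\<close>, hence into
  \<open>V\<close>, and so would have been in \<open>V\<close> from the start.\<close>

lemma hyperplanes_of_flat_eq:
  fixes W :: "'a::euclidean_space set"
  assumes "affine W" "V = {x\<in>W. a \<bullet> x = b}" "V' = {x\<in>W. a' \<bullet> x = b'}" "V \<noteq> W" "V' \<noteq> {}" "V' \<subseteq> V"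
  shows "V' = V"
proof (rule ccontr)
  assume "V' \<noteq> V"
  then obtain v where v: "v \<in> W" "a \<bullet> v = b" "a' \<bullet> v \<noteq> b'" using assms by blast
  obtain x where x: "x \<in> W" "a' \<bullet> x = b'" "a \<bullet> x = b" using assms by blast
  have "w \<in> V" if w: "w \<in> W" for w
  proof -
    define s where "s = (a' \<bullet> w - b') / (a' \<bullet> v - b')"
    have "w - s *\<^sub>R (v - x) \<in> W"
      using mem_affine_3_minus[OF assms(1) w v(1) x(1), of "- s"] by simp
    moreover have "a' \<bullet> (w - s *\<^sub>R (v - x)) = b'"
      using v x by (simp add: inner_diff_right s_def)
    ultimately have "a \<bullet> (w - s *\<^sub>R (v - x)) = b" using assms by blast
    then show ?thesis using v x w assms(2) by (simp add: inner_diff_right)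
  qed
  then show False using assms by blast
qed

text \<open>The components of this region are the relative interiors of the facets.\<close>

abbreviation facet_region :: "'a::euclidean_space set \<Rightarrow> 'a set \<Rightarrow> 'a set \<Rightarrow> 'a set" where
  "facet_region V G K \<equiv> {x\<in>V. locally_coincide x G K}"

text \<open>The two sides enter symmetrically up to sign: \<open>mirror\<close> exchanges
  \<open>P\<close> and \<open>N\<close>, so facts are proved for the positive side and
  transferred.\<close>

locale flat_cut =
  fixes W V P N :: "'a::euclidean_space set" and a n :: 'a and b :: real
  assumes affW: "affine W"
    and V: "V = {x\<in>W. a \<bullet> x = b}"
    and P: "P = {x\<in>W. a \<bullet> x \<ge> b}"
    and N: "N = {x\<in>W. a \<bullet> x \<le> b}"
    and dir: "\<And>w s. w \<in> W \<Longrightarrow> w + s *\<^sub>R n \<in> W"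
    and pos: "a \<bullet> n > 0"
begin

lemma mirror: "flat_cut W V N P (- a) (- n) (- b)"
proof
  show "w + s *\<^sub>R - n \<in> W" if "w \<in> W" for w s
    using dir[OF that, of "- s"] by simp
qed (use affW V P N pos in auto)

lemma affV: "affine V"
proof -
  have "V = W \<inter> {x. a \<bullet> x = b}" using V by auto
  then show ?thesis using affW by (simp add: affine_Int affine_hyperplane)
qed

lemma V_neq_W: "V \<noteq> {} \<Longrightarrow> V \<noteq> W"
proof -
  assume "V \<noteq> {}"
  then obtain v where v: "v \<in> W" "a \<bullet> v = b" using V by blast
  have "v + 1 *\<^sub>R n \<in> W" "v + 1 *\<^sub>R n \<notin> V"
    using dir[OF v(1), of 1] v pos by (auto simp: V inner_add_right)
  then show ?thesis by blast
qed

lemma region_disjoint: "facet_region V G P \<inter> facet_region V G N = {}"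
proof (rule ccontr)
  assume "\<not> ?thesis"
  then obtain x where x: "x \<in> V" "locally_coincide x G P" "locally_coincide x G N" by blast
  obtain e1 where e1: "e1 > 0" "ball x e1 \<inter> G = ball x e1 \<inter> P"
    using x by (auto simp: locally_coincide_def)
  obtain e2 where e2: "e2 > 0" "ball x e2 \<inter> G = ball x e2 \<inter> N"
    using x by (auto simp: locally_coincide_def)
  have n: "norm n > 0" using pos by auto
  define s where "s = min e1 e2 / (2 * norm n)"
  have s: "s > 0" using e1 e2 n by (simp add: s_def)
  have "dist x (x + s *\<^sub>R n) = s * norm n" using s by (simp add: dist_norm)
  also have "\<dots> < min e1 e2" using n e1 e2 by (auto simp: s_def min_def)
  finally have d: "dist x (x + s *\<^sub>R n) < min e1 e2" .
  have "x + s *\<^sub>R n \<in> P" "x + s *\<^sub>R n \<notin> N"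
    using x dir[of x s] s pos by (auto simp: V P N inner_add_right not_le)
  moreover have "x + s *\<^sub>R n \<in> ball x e1" "x + s *\<^sub>R n \<in> ball x e2" using d by auto
  ultimately show False using e1(2) e2(2) by blast
qed

text \<open>\<open>polytope_facet\<close> quantifies over all hyperplanes of \<open>W\<close>. A
  component of a region is relatively open in its own hyperplane, so if it lies in \<open>V\<close>,
  that hyperplane is \<open>V\<close>; proportionality of the functionals then leaves only
  \<open>P\<close> and \<open>N\<close> as half-spaces.\<close>

lemma facets_in_cut:
  assumes hull: "affine hull G = W"
  shows "{F. polytope_facet F G \<and> F \<subseteq> V} =
    closure ` (components (facet_region V G P) \<union> components (facet_region V G N))"
proof (intro equalityI subsetI)
  fix F assume F: "F \<in> closure ` (components (facet_region V G P) \<union> components (facet_region V G N))"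
  then obtain C where C: "F = closure C"
    "C \<in> components (facet_region V G P) \<or> C \<in> components (facet_region V G N)" by blast
  then have sub: "C \<subseteq> V" "C \<noteq> {}"
    using in_components_subset in_components_nonempty by blast+
  then have "V \<noteq> W" using V_neq_W by blast
  then have "halfspace_in W V P"
    unfolding halfspace_in_def using V P by (intro exI[of _ a] exI[of _ b]) auto
  moreover have "halfspace_in W V N"
    unfolding halfspace_in_def using V N \<open>V \<noteq> W\<close> by (intro exI[of _ "- a"] exI[of _ "- b"]) auto
  moreover have "closure C \<subseteq> V"
    using sub affV by (simp add: closure_minimal affine_closed)
  ultimately show "F \<in> {F. polytope_facet F G \<and> F \<subseteq> V}"
    using C unfolding polytope_facet_def hull by blast
next
  fix F assume F: "F \<in> {F. polytope_facet F G \<and> F \<subseteq> V}"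
  then obtain V' K C where K: "halfspace_in W V' K" and C: "C \<in> components (facet_region V' G K)"
    "F = closure C" and FV: "F \<subseteq> V"
    unfolding polytope_facet_def hull by blast
  obtain a' b' where ab: "V' = {x\<in>W. a' \<bullet> x = b'}" "K = {x\<in>W. a' \<bullet> x \<ge> b'}" "V' \<noteq> W"
    using K unfolding halfspace_in_def by blast
  obtain x where xC: "x \<in> C" using in_components_nonempty[OF C(1)] by blast
  then have x: "x \<in> V'" "locally_coincide x G K" "x \<in> closure C"
    using in_components_subset[OF C(1)] closure_subset[of C] by auto
  have affV': "affine V'"
  proof -
    have "V' = W \<inter> {x. a' \<bullet> x = b'}" using ab by auto
    then show ?thesis using affW by (simp add: affine_Int affine_hyperplane)
  qed
  obtain e where e: "e > 0" "V' \<inter> ball x e \<subseteq> C"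
    using component_ball[OF affV' C(1) x] by blast
  have CV: "C \<subseteq> V" using FV C(2) closure_subset[of C] by blast
  then have "V' \<subseteq> V"
    using affine_subset_of_ball[OF affV affV' x(1) e(1)] e(2) by blast
  moreover have "V \<noteq> W" using V_neq_W xC CV by blast
  ultimately have VV: "V' = V"
    using hyperplanes_of_flat_eq[OF affW V ab(1)] x by blast
  have kappa: "a' \<bullet> w - b' = ((a' \<bullet> n) / (a \<bullet> n)) * (a \<bullet> w - b)" if "w \<in> W" for w
    using that pos VV ab V by (intro halfplane_proportional[OF dir]) auto
  have "a' \<bullet> n \<noteq> 0"
  proof
    assume "a' \<bullet> n = 0"
    then have "V' = W" using kappa ab by auto
    then show False using ab by simp
  qed
  have "K = P \<or> K = N"
  proof (cases "a' \<bullet> n > 0")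
    case True
    then have "(a' \<bullet> n) / (a \<bullet> n) > 0" using pos by simp
    then have "a' \<bullet> w \<ge> b' \<longleftrightarrow> a \<bullet> w \<ge> b" if "w \<in> W" for w
      using kappa[OF that] by (smt (verit) mult_nonneg_nonneg mult_pos_neg)
    then show ?thesis using ab P by auto
  next
    case False
    then have "(a' \<bullet> n) / (a \<bullet> n) < 0" using pos \<open>a' \<bullet> n \<noteq> 0\<close> by (simp add: divide_neg_pos)
    then have "a' \<bullet> w \<ge> b' \<longleftrightarrow> a \<bullet> w \<le> b" if "w \<in> W" for w
      using kappa[OF that] by (smt (verit) mult_nonpos_nonpos mult_neg_pos)
    then show ?thesis using ab N by auto
  qed
  then show "F \<in> closure ` (components (facet_region V G P) \<union> components (facet_region V G N))"
    using C VV by blast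
qed

text \<open>Closing a component adds only points near which \<open>G\<close> is neither
  \<open>P\<close> nor \<open>N\<close>. The component can thus be recovered from the facet, which
  makes \<open>closure\<close> injective in \<open>side_sign_sum\<close>.\<close>

lemma closure_component_Int:
  assumes "C \<in> components (facet_region V G P)"
  shows "closure C \<inter> (facet_region V G P \<union> facet_region V G N) = C"
proof (intro equalityI subsetI)
  fix x assume "x \<in> C"
  then show "x \<in> closure C \<inter> (facet_region V G P \<union> facet_region V G N)"
    using in_components_subset[OF assms] closure_subset[of C] by auto
next
  fix x assume x: "x \<in> closure C \<inter> (facet_region V G P \<union> facet_region V G N)"
  have xV: "x \<in> V" using x by blast
  have "locally_coincide x G P"
  proof (rule ccontr)
    assume "\<not> locally_coincide x G P"
    then have "locally_coincide x G N" using x by blast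
    then obtain e where e: "e > 0" "\<And>y. dist x y < e \<Longrightarrow> locally_coincide y G N"
      using locally_coincide_near by blast
    obtain c where "c \<in> C" "dist c x < e"
      using x e unfolding Int_iff closure_approachable by blast
    then have "c \<in> facet_region V G N" "c \<in> facet_region V G P"
      using e in_components_subset[OF assms] by (auto simp: dist_commute)
    then show False using region_disjoint by blast
  qed
  then obtain e where "e > 0" "V \<inter> ball x e \<subseteq> C"
    using component_ball[OF affV assms xV] x by blast
  then show "x \<in> C" using xV by auto
qed

lemma side_sign_facet_pos:
  assumes "C \<in> components (facet_region V G P)"
  shows "side_sign P (closure C) G = 1"
proof -
  obtain x where "x \<in> C" using in_components_nonempty[OF assms] by blast
  then have "x \<in> closure C" "locally_coincide x G P"
    using in_components_subset[OF assms] closure_subset[of C] by auto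
  then show ?thesis unfolding side_sign_def by auto
qed

text \<open>The value -1 is the default of \<open>side_sign\<close>, so coincidence with
  \<open>P\<close> has to be excluded at every point of the closure, including those added to
  \<open>C\<close>.\<close>

lemma side_sign_facet_neg:
  assumes "C \<in> components (facet_region V G N)"
  shows "side_sign P (closure C) G = - 1"
proof -
  interpret m: flat_cut W V N P "- a" "- n" "- b" by (rule mirror)
  have "\<not> locally_coincide x G P" if "x \<in> closure C" for x
  proof
    assume "locally_coincide x G P"
    moreover have CV: "C \<subseteq> V" using in_components_subset[OF assms] by blast
    have "closure C \<subseteq> V" using affV CV by (simp add: closure_minimal affine_closed)
    ultimately have "x \<in> closure C \<inter> (facet_region V G N \<union> facet_region V G P)" using that by blast
    then have "x \<in> C" using m.closure_component_Int[OF assms] by simp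
    then have "x \<in> facet_region V G N" using in_components_subset[OF assms] by blast
    then show False using region_disjoint[of G] \<open>locally_coincide x G P\<close> by blast
  qed
  then show ?thesis unfolding side_sign_def by auto
qed

lemma side_sign_sum:
  fixes g :: "'a set \<Rightarrow> real"
  assumes hull: "affine hull G = W"
    and fin: "finite (components (facet_region V G P))" "finite (components (facet_region V G N))"
  shows "(\<Sum>F | polytope_facet F G \<and> F \<subseteq> V. side_sign P F G * g F) =
    (\<Sum>C\<in>components (facet_region V G P). g (closure C)) -
    (\<Sum>C\<in>components (facet_region V G N). g (closure C))"
proof -
  interpret m: flat_cut W V N P "- a" "- n" "- b" by (rule mirror)
  let ?A = "components (facet_region V G P)" and ?B = "components (facet_region V G N)"
  let ?U = "facet_region V G P \<union> facet_region V G N"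
  have inv: "closure C \<inter> ?U = C" if "C \<in> ?A \<union> ?B" for C
  proof (cases "C \<in> ?A")
    case True
    then show ?thesis by (rule closure_component_Int)
  next
    case False
    then have "C \<in> ?B" using that by simp
    then show ?thesis
      using m.closure_component_Int[of C G] by (simp only: Un_commute)
  qed
  then have inj: "inj_on closure (?A \<union> ?B)"
    by (intro inj_on_inverseI[where g = "\<lambda>D. D \<inter> ?U"])
  have "False" if C: "C \<in> ?A" "C \<in> ?B" for C
  proof -
    obtain x where "x \<in> C" using in_components_nonempty[OF C(1)] by blast
    then have "x \<in> facet_region V G P" "x \<in> facet_region V G N"
      using in_components_subset[OF C(1)] in_components_subset[OF C(2)] by auto
    then show False using region_disjoint[of G] by blast
  qed
  then have disj: "?A \<inter> ?B = {}" by blast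
  have "(\<Sum>F | polytope_facet F G \<and> F \<subseteq> V. side_sign P F G * g F) =
    (\<Sum>C\<in>?A \<union> ?B. side_sign P (closure C) G * g (closure C))"
    unfolding facets_in_cut[OF hull] by (subst sum.reindex[OF inj]) simp
  also have "\<dots> = (\<Sum>C\<in>?A. side_sign P (closure C) G * g (closure C)) +
      (\<Sum>C\<in>?B. side_sign P (closure C) G * g (closure C))"
    by (rule sum.union_disjoint[OF fin disj])
  also have "(\<Sum>C\<in>?A. side_sign P (closure C) G * g (closure C)) = (\<Sum>C\<in>?A. g (closure C))"
    by (intro sum.cong) (auto simp: side_sign_facet_pos)
  also have "(\<Sum>C\<in>?B. side_sign P (closure C) G * g (closure C)) = - (\<Sum>C\<in>?B. g (closure C))"
    unfolding sum_negf[symmetric] by (intro sum.cong) (auto simp: side_sign_facet_neg)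
  finally show ?thesis by simp
qed

end

section \<open>Jumps of piecewise constant functions\<close>

text \<open>For piecewise constant \<open>f\<close> the values along the ray are eventually constant
  (\<open>eventually_ray_limit\<close>), so that \<open>Lim\<close> exists and is a value of
  \<open>f\<close>.\<close>

definition ray_limit :: "'a::euclidean_space \<Rightarrow> ('a \<Rightarrow> real) \<Rightarrow> 'a \<Rightarrow> real" where
  "ray_limit v f x = Lim (at_right 0) (\<lambda>s. f (x + s *\<^sub>R v))"

definition jump :: "'a::euclidean_space \<Rightarrow> ('a \<Rightarrow> real) \<Rightarrow> 'a \<Rightarrow> real" where
  "jump n f x = ray_limit n f x - ray_limit (- n) f x"

text \<open>\<open>foldr\<close> applies \<open>jump (n (d - 1))\<close> first and
  \<open>jump (n k)\<close> last, so the descent along a flag starts at its hyperplane. For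
  \<open>k = d\<close> no jump is taken.\<close>

definition jumps :: "(nat \<Rightarrow> 'a::euclidean_space) \<Rightarrow> nat \<Rightarrow> nat \<Rightarrow> ('a \<Rightarrow> real) \<Rightarrow> 'a \<Rightarrow> real" where
  "jumps n k d f = foldr (\<lambda>j. jump (n j)) [k..<d] f"

lemma jumps_same [simp]: "jumps n d d f = f"
  by (simp add: jumps_def)

lemma jumps_step: "k < d \<Longrightarrow> jumps n k d f = jump (n k) (jumps n (Suc k) d f)"
  by (simp add: jumps_def upt_conv_Cons)

lemma eventually_ray_near:
  fixes x v :: "'a::euclidean_space"
  assumes "d > 0"
  shows "eventually (\<lambda>s. 0 < s \<and> dist x (x + s *\<^sub>R v) < d) (at_right (0::real))"
proof (rule eventually_conj)
  show "eventually (\<lambda>s. 0 < s) (at_right (0::real))"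
    by (rule eventually_at_right_less)
  have "((\<lambda>s. dist x (x + s *\<^sub>R v)) \<longlongrightarrow> dist x (x + 0 *\<^sub>R v)) (at_right (0::real))"
    by (intro tendsto_intros)
  then show "eventually (\<lambda>s. dist x (x + s *\<^sub>R v) < d) (at_right (0::real))"
    using assms by (intro order_tendstoD) auto
qed

lemma ray_near:
  fixes x v :: "'a::euclidean_space"
  assumes "d > 0"
  obtains s where "s > 0" "dist x (x + s *\<^sub>R v) < d"
  using eventually_happens[OF eventually_ray_near[OF assms, of x v]] by auto

lemma ray_limit_eqI:
  assumes "eventually (\<lambda>s. f (x + s *\<^sub>R v) = c) (at_right 0)"
  shows "ray_limit v f x = c"
proof -
  have "((\<lambda>s. f (x + s *\<^sub>R v)) \<longlongrightarrow> c) (at_right 0)"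
    using assms by (rule tendsto_eventually)
  then show ?thesis
    unfolding ray_limit_def by (intro tendsto_Lim) auto
qed

lemma ray_limit_cong:
  assumes "eventually (\<lambda>s. f (x + s *\<^sub>R v) = g (y + s *\<^sub>R v)) (at_right 0)"
  shows "ray_limit v f x = ray_limit v g y"
proof -
  have "((\<lambda>s. f (x + s *\<^sub>R v)) \<longlongrightarrow> l) (at_right 0) \<longleftrightarrow> ((\<lambda>s. g (y + s *\<^sub>R v)) \<longlongrightarrow> l) (at_right 0)" for l
    using assms by (rule tendsto_cong)
  then show ?thesis
    by (simp add: ray_limit_def Topological_Spaces.Lim_def)
qed

lemma ray_limit_translate: "ray_limit v (\<lambda>y. f (y + t)) x = ray_limit v f (x + t)"
  by (simp add: ray_limit_def algebra_simps)

lemma jump_translate: "jump n (\<lambda>y. f (y + t)) = (\<lambda>y. jump n f (y + t))"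
  by (simp add: jump_def ray_limit_translate fun_eq_iff)

lemma jumps_translate:
  assumes "k \<le> d"
  shows "jumps n k d (\<lambda>y. f (y + t)) = (\<lambda>y. jumps n k d f (y + t))"
  using assms by (induction rule: inc_induct) (simp_all add: jumps_step jump_translate)

lemma ray_limit_cong_open:
  assumes "open U" "x \<in> U" "\<And>y. y \<in> U \<Longrightarrow> f y = g y"
  shows "ray_limit v f x = ray_limit v g x"
proof (rule ray_limit_cong)
  obtain e where e: "e > 0" "ball x e \<subseteq> U" using assms openE by blast
  from eventually_ray_near[OF e(1), of x v]
  show "eventually (\<lambda>s. f (x + s *\<^sub>R v) = g (x + s *\<^sub>R v)) (at_right 0)"
    by eventually_elim (use assms e in auto)
qed

lemma jumps_cong_open:
  assumes "k \<le> d" "open U" "x \<in> U" "\<And>y. y \<in> U \<Longrightarrow> f y = g y"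
  shows "jumps n k d f x = jumps n k d g x"
proof -
  have "\<forall>x\<in>U. jumps n k d f x = jumps n k d g x"
    using assms(1)
  proof (induction rule: inc_induct)
    case base
    then show ?case using assms by simp
  next
    case (step k)
    then show ?case
      using assms(2) by (auto simp: jumps_step jump_def intro!: arg_cong2[of _ _ _ _ "(-)"] ray_limit_cong_open[of U])
  qed
  then show ?thesis using assms by blast
qed

text \<open>The radius is there for the tiling sum: in a given ball only finitely many lattice
  translates contribute, so a finite arrangement suffices there but not globally.\<close>

definition side_measurable_within ::
  "('a::euclidean_space \<times> real) set \<Rightarrow> real \<Rightarrow> ('a \<Rightarrow> real) \<Rightarrow> bool" where
  "side_measurable_within H R f \<longleftrightarrow>
     (\<forall>x y. norm x < R \<longrightarrow> norm y < R \<longrightarrow> same_side H x y \<longrightarrow> f x = f y)"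

definition piecewise_constant :: "('a::euclidean_space \<Rightarrow> real) \<Rightarrow> bool" where
  "piecewise_constant f \<longleftrightarrow> (\<forall>R. \<exists>H. finite H \<and> side_measurable_within H R f)"

lemma side_measurable_within_mono:
  "side_measurable_within H R f \<Longrightarrow> H \<subseteq> H' \<Longrightarrow> R' \<le> R \<Longrightarrow> side_measurable_within H' R' f"
  unfolding side_measurable_within_def using same_side_mono by (meson less_le_trans)

lemma side_measurable_iff_within: "side_measurable H f \<longleftrightarrow> (\<forall>R. side_measurable_within H R f)"
proof
  assume *: "\<forall>R. side_measurable_within H R f"
  show "side_measurable H f"
    unfolding side_measurable_def
  proof (intro allI impI)
    fix x y assume "same_side H x y"
    then show "f x = f y"
      using *[rule_format, of "max (norm x) (norm y) + 1"] unfolding side_measurable_within_def by simp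
  qed
qed (simp add: side_measurable_def side_measurable_within_def)

lemma piecewise_constant_side_measurable:
  "finite H \<Longrightarrow> side_measurable H f \<Longrightarrow> piecewise_constant f"
  unfolding piecewise_constant_def side_measurable_iff_within by blast

text \<open>All short steps along the ray have the same sign vector, since
  \<open>sgn (a \<bullet> (s *\<^sub>R v))\<close> does not depend on \<open>s > 0\<close>.\<close>

lemma eventually_ray_limit:
  assumes "piecewise_constant f"
  shows "eventually (\<lambda>s. f (x + s *\<^sub>R v) = ray_limit v f x) (at_right 0)"
proof -
  obtain H where H: "finite H" "side_measurable_within H (norm x + 1) f"
    using assms unfolding piecewise_constant_def by blast
  obtain e where e: "e > 0" "\<And>z a b. norm z < e \<Longrightarrow> (a, b) \<in> H \<Longrightarrow>
      sgn (a \<bullet> (x + z) - b) = (if a \<bullet> x = b then sgn (a \<bullet> z) else sgn (a \<bullet> x - b))"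
    using local_signs[OF H(1), of x] by blast
  let ?good = "\<lambda>s. 0 < s \<and> dist x (x + s *\<^sub>R v) < min e 1"
  have good: "f (x + s *\<^sub>R v) = f (x + t *\<^sub>R v)" if "?good s" "?good t" for s t
  proof -
    have "norm (x + u *\<^sub>R v) < norm x + 1" if "?good u" for u
      using that norm_triangle_ineq[of x "u *\<^sub>R v"] by (auto simp: dist_norm)
    moreover have "same_side H (x + s *\<^sub>R v) (x + t *\<^sub>R v)"
      unfolding same_side_def
    proof clarify
      fix a b assume "(a, b) \<in> H"
      then show "sgn (a \<bullet> (x + s *\<^sub>R v) - b) = sgn (a \<bullet> (x + t *\<^sub>R v) - b)"
        using e(2)[of "s *\<^sub>R v" a b] e(2)[of "t *\<^sub>R v" a b] that by (auto simp: dist_norm sgn_mult)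
    qed
    ultimately show ?thesis
      using H(2) that unfolding side_measurable_within_def by blast
  qed
  have ev: "eventually ?good (at_right 0)"
    using e(1) by (intro eventually_ray_near) simp
  obtain t where t: "?good t"
    using eventually_happens[OF ev] by auto
  from ev have ev': "eventually (\<lambda>s. f (x + s *\<^sub>R v) = f (x + t *\<^sub>R v)) (at_right 0)"
    by eventually_elim (use t good in blast)
  then show ?thesis
    using ray_limit_eqI[OF ev'] by simp
qed

text \<open>By \<open>same_side_shift\<close>, rays in direction \<open>v\<close> from equivalent
  points run through equivalent points. The arrangement does not grow, so jumps can be iterated with
  the same \<open>H\<close>.\<close>

lemma side_measurable_within_ray_limit:
  assumes "finite H" "side_measurable_within H R f"
  shows "side_measurable_within H R (ray_limit v f)"
  unfolding side_measurable_within_def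
proof (intro allI impI)
  fix x y assume xy: "norm x < R" "norm y < R" "same_side H x y"
  obtain e where e: "e > 0" "\<And>z. norm z < e \<Longrightarrow> same_side H (x + z) (y + z)"
    using same_side_shift[OF assms(1) xy(3)] by blast
  define d where "d = min e (min (R - norm x) (R - norm y))"
  have "d > 0" using e xy by (simp add: d_def)
  from eventually_ray_near[OF this, of x v]
  have "eventually (\<lambda>s. f (x + s *\<^sub>R v) = f (y + s *\<^sub>R v)) (at_right 0)"
  proof eventually_elim
    case (elim s)
    then have s: "norm (s *\<^sub>R v) < d" by (auto simp: dist_norm)
    then have "norm (x + s *\<^sub>R v) < R" "norm (y + s *\<^sub>R v) < R"
      using norm_triangle_ineq[of x "s *\<^sub>R v"] norm_triangle_ineq[of y "s *\<^sub>R v"] by (auto simp: d_def)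
    moreover have "same_side H (x + s *\<^sub>R v) (y + s *\<^sub>R v)"
      using s by (intro e(2)) (simp add: d_def)
    ultimately show ?case
      using assms(2) unfolding side_measurable_within_def by blast
  qed
  then show "ray_limit v f x = ray_limit v f y"
    by (rule ray_limit_cong)
qed

lemma side_measurable_within_jump:
  assumes "finite H" "side_measurable_within H R f"
  shows "side_measurable_within H R (jump n f)"
  using side_measurable_within_ray_limit[OF assms, of n] side_measurable_within_ray_limit[OF assms, of "- n"]
  unfolding side_measurable_within_def jump_def by (intro allI impI arg_cong2[of _ _ _ _ "(-)"]) blast+

lemma piecewise_constant_jump: "piecewise_constant f \<Longrightarrow> piecewise_constant (jump n f)"
  unfolding piecewise_constant_def using side_measurable_within_jump by blast

lemma piecewise_constant_jumps: "k \<le> d \<Longrightarrow> piecewise_constant f \<Longrightarrow> piecewise_constant (jumps n k d f)"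
  by (induction rule: inc_induct) (simp_all add: jumps_step piecewise_constant_jump)

lemma side_measurable_jumps:
  assumes "k \<le> d" "finite H" "side_measurable H f"
  shows "side_measurable H (jumps n k d f)"
  using assms(1) by (induction rule: inc_induct)
    (use assms in \<open>auto simp: jumps_step side_measurable_iff_within side_measurable_within_jump\<close>)

lemma piecewise_constant_sum:
  assumes "finite I" "\<And>i. i \<in> I \<Longrightarrow> piecewise_constant (f i)"
  shows "piecewise_constant (\<lambda>x. \<Sum>i\<in>I. c i * f i x)"
  unfolding piecewise_constant_def
proof
  fix R
  have "\<forall>i\<in>I. \<exists>H. finite H \<and> side_measurable_within H R (f i)"
    using assms(2) unfolding piecewise_constant_def by blast
  then obtain H where H: "\<And>i. i \<in> I \<Longrightarrow> finite (H i) \<and> side_measurable_within (H i) R (f i)"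
    by metis
  have "side_measurable_within (\<Union>i\<in>I. H i) R (f i)" if "i \<in> I" for i
    by (rule side_measurable_within_mono[of "H i" R]) (use H that in auto)
  then have "side_measurable_within (\<Union>i\<in>I. H i) R (\<lambda>x. \<Sum>i\<in>I. c i * f i x)"
    unfolding side_measurable_within_def by (intro allI impI sum.cong refl arg_cong2[of _ _ _ _ "(*)"]) blast
  then show "\<exists>H. finite H \<and> side_measurable_within H R (\<lambda>x. \<Sum>i\<in>I. c i * f i x)"
    using H assms(1) by (intro exI[of _ "\<Union>i\<in>I. H i"]) auto
qed

lemma ray_limit_sum:
  assumes "finite I" "\<And>i. i \<in> I \<Longrightarrow> piecewise_constant (f i)"
  shows "ray_limit v (\<lambda>x. \<Sum>i\<in>I. c i * f i x) x = (\<Sum>i\<in>I. c i * ray_limit v (f i) x)"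
proof (rule ray_limit_eqI)
  have "eventually (\<lambda>s. \<forall>i\<in>I. f i (x + s *\<^sub>R v) = ray_limit v (f i) x) (at_right 0)"
    by (intro eventually_ball_finite assms(1) ballI eventually_ray_limit assms(2))
  then show "eventually (\<lambda>s. (\<Sum>i\<in>I. c i * f i (x + s *\<^sub>R v)) = (\<Sum>i\<in>I. c i * ray_limit v (f i) x)) (at_right 0)"
    by eventually_elim (auto intro!: sum.cong)
qed

lemma jump_sum:
  assumes "finite I" "\<And>i. i \<in> I \<Longrightarrow> piecewise_constant (f i)"
  shows "jump n (\<lambda>x. \<Sum>i\<in>I. c i * f i x) = (\<lambda>x. \<Sum>i\<in>I. c i * jump n (f i) x)"
  unfolding jump_def using assms
  by (simp add: ray_limit_sum sum_subtractf[symmetric] right_diff_distrib)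

lemma jumps_sum:
  assumes "k \<le> d" "finite I" "\<And>i. i \<in> I \<Longrightarrow> piecewise_constant (f i)"
  shows "jumps n k d (\<lambda>x. \<Sum>i\<in>I. c i * f i x) = (\<lambda>x. \<Sum>i\<in>I. c i * jumps n k d (f i) x)"
  using assms(1)
proof (induction rule: inc_induct)
  case (step k)
  then show ?case
    using assms by (simp add: jumps_step jump_sum piecewise_constant_jumps)
qed simp

lemma jumps_zero: "k \<le> d \<Longrightarrow> jumps n k d (\<lambda>x. 0) = (\<lambda>x. 0)"
  using jumps_sum[of k d "{}"] by simp

section \<open>One-sided behaviour at generic points of a cut\<close>

context flat_cut
begin

text \<open>A hyperplane of \<open>H\<close> through \<open>x\<close> contains \<open>V\<close>, so
  it meets \<open>W\<close> in \<open>V\<close> or in all of \<open>W\<close>, and above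
  \<open>V\<close> its sign is that of \<open>\<alpha> \<bullet> n\<close>. The other hyperplanes
  keep their sign near \<open>x\<close>. Hence the upper side of \<open>W\<close> near
  \<open>x\<close> lies in one cell.\<close>

lemma upper_signs:
  assumes "finite H" "generic_in H V x"
  obtains e where "e > 0"
    "\<And>w w'. w \<in> W \<Longrightarrow> w' \<in> W \<Longrightarrow> dist x w < e \<Longrightarrow> dist x w' < e \<Longrightarrow> a \<bullet> w > b \<Longrightarrow> a \<bullet> w' > b \<Longrightarrow> same_side H w w'"
    "\<And>w. w \<in> W \<Longrightarrow> dist x w < e \<Longrightarrow> a \<bullet> w > b \<Longrightarrow> generic_in H W w"
proof -
  obtain e where e: "e > 0" "\<And>z \<alpha> \<beta>. norm z < e \<Longrightarrow> (\<alpha>, \<beta>) \<in> H \<Longrightarrow>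
      sgn (\<alpha> \<bullet> (x + z) - \<beta>) = (if \<alpha> \<bullet> x = \<beta> then sgn (\<alpha> \<bullet> z) else sgn (\<alpha> \<bullet> x - \<beta>))"
    using local_signs[OF assms(1), of x] by blast
  have xV: "x \<in> V" using assms(2) by (rule generic_inD)
  have kappa: "sgn (\<alpha> \<bullet> w - \<beta>) = (if \<alpha> \<bullet> x = \<beta> then sgn (\<alpha> \<bullet> n) else sgn (\<alpha> \<bullet> x - \<beta>))"
    if h: "(\<alpha>, \<beta>) \<in> H" and w: "w \<in> W" "dist x w < e" "a \<bullet> w > b" for \<alpha> \<beta> w
  proof (cases "\<alpha> \<bullet> x = \<beta>")
    case True
    then have "V \<subseteq> {y. \<alpha> \<bullet> y = \<beta>}" using assms(2) h unfolding generic_in_def by blast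
    then have "\<alpha> \<bullet> w - \<beta> = ((\<alpha> \<bullet> n) / (a \<bullet> n)) * (a \<bullet> w - b)"
      using pos w V by (intro halfplane_proportional[OF dir]) auto
    then have "sgn (\<alpha> \<bullet> w - \<beta>) = sgn (\<alpha> \<bullet> n)"
      using pos w by (simp add: sgn_mult sgn_divide)
    then show ?thesis using True by simp
  next
    case False
    then show ?thesis using e(2)[of "w - x" \<alpha> \<beta>] h w by (simp add: dist_norm norm_minus_commute)
  qed
  show ?thesis
  proof
    show "e > 0" by fact
    show "same_side H w w'" if "w \<in> W" "w' \<in> W" "dist x w < e" "dist x w' < e" "a \<bullet> w > b" "a \<bullet> w' > b" for w w'
      unfolding same_side_def
    proof clarify
      fix \<alpha> \<beta> assume "(\<alpha>, \<beta>) \<in> H"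
      then show "sgn (\<alpha> \<bullet> w - \<beta>) = sgn (\<alpha> \<bullet> w' - \<beta>)" using kappa that by simp
    qed
    show "generic_in H W w" if w: "w \<in> W" "dist x w < e" "a \<bullet> w > b" for w
      unfolding generic_in_def
    proof (intro conjI w(1), clarify)
      fix \<alpha> \<beta> y assume h: "(\<alpha>, \<alpha> \<bullet> w) \<in> H" and y: "y \<in> W"
      have *: "sgn (\<alpha> \<bullet> w - \<alpha> \<bullet> w) = (if \<alpha> \<bullet> x = \<alpha> \<bullet> w then sgn (\<alpha> \<bullet> n) else sgn (\<alpha> \<bullet> x - \<alpha> \<bullet> w))"
        using kappa[OF h w] .
      have eq: "\<alpha> \<bullet> x = \<alpha> \<bullet> w" "\<alpha> \<bullet> n = 0"
        using * by (auto simp: sgn_zero_iff split: if_splits)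
      then have "V \<subseteq> {y. \<alpha> \<bullet> y = \<alpha> \<bullet> w}" using assms(2) h unfolding generic_in_def by blast
      then have "\<alpha> \<bullet> y - \<alpha> \<bullet> w = ((\<alpha> \<bullet> n) / (a \<bullet> n)) * (a \<bullet> y - b)"
        using pos y V by (intro halfplane_proportional[OF dir]) auto
      then show "\<alpha> \<bullet> y = \<alpha> \<bullet> w" using eq by simp
    qed
  qed
qed

text \<open>This lets genericity descend along a flag: what is known at generic points of
  \<open>W\<close> can be used along rays from generic points of \<open>V\<close>.\<close>

lemma eventually_generic:
  assumes "finite H" "generic_in H V x"
  shows "eventually (\<lambda>s. generic_in H W (x + s *\<^sub>R n)) (at_right 0)"
proof -
  obtain e where e: "e > 0" "\<And>w. w \<in> W \<Longrightarrow> dist x w < e \<Longrightarrow> a \<bullet> w > b \<Longrightarrow> generic_in H W w"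
    using upper_signs[OF assms] by metis
  have x: "x \<in> W" "a \<bullet> x = b" using generic_inD[OF assms(2)] V by auto
  from eventually_ray_near[OF e(1), of x n] show ?thesis
    by eventually_elim (use e(2) dir x pos in \<open>simp add: inner_add_right\<close>)
qed

lemma upper_dichotomy:
  assumes "finite H" "generic_in H V x" "saturated H G"
  obtains d where "d > 0"
    "ray_limit n (indicator G) x = 1 \<and> (\<forall>w\<in>W. dist x w < d \<longrightarrow> a \<bullet> w > b \<longrightarrow> w \<in> G) \<or>
     ray_limit n (indicator G) x = 0 \<and> (\<forall>w\<in>W. dist x w < d \<longrightarrow> a \<bullet> w > b \<longrightarrow> w \<notin> G)"
proof -
  obtain e where e: "e > 0" "\<And>w w'. w \<in> W \<Longrightarrow> w' \<in> W \<Longrightarrow> dist x w < e \<Longrightarrow> dist x w' < e \<Longrightarrow>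
      a \<bullet> w > b \<Longrightarrow> a \<bullet> w' > b \<Longrightarrow> same_side H w w'"
    using upper_signs[OF assms(1,2)] by metis
  have x: "x \<in> W" "a \<bullet> x = b" using generic_inD[OF assms(2)] V by auto
  have ray: "x + s *\<^sub>R n \<in> W \<and> a \<bullet> (x + s *\<^sub>R n) > b" if "s > 0" for s
    using dir[OF x(1)] x pos that by (simp add: inner_add_right)
  obtain t where t: "t > 0" "dist x (x + t *\<^sub>R n) < e" using ray_near[OF e(1)] by blast
  have all: "w \<in> G \<longleftrightarrow> x + t *\<^sub>R n \<in> G" if "w \<in> W" "dist x w < e" "a \<bullet> w > b" for w
    using saturated_iff[OF assms(3)] e(2)[OF that(1) _ that(2) t(2) that(3)] ray[OF t(1)] by blast
  have lim: "ray_limit n (indicator G) x = indicator G (x + t *\<^sub>R n)"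
  proof (rule ray_limit_eqI)
    from eventually_ray_near[OF e(1), of x n]
    show "eventually (\<lambda>s. indicator G (x + s *\<^sub>R n) = (indicator G (x + t *\<^sub>R n) :: real)) (at_right 0)"
      by eventually_elim (use all ray in \<open>simp add: indicator_def\<close>)
  qed
  show ?thesis
    using that[OF e(1)] lim all by (cases "x + t *\<^sub>R n \<in> G") (auto simp: indicator_def)
qed

text \<open>By \<open>upper_dichotomy\<close> each side of \<open>W\<close> near \<open>x\<close> is
  entirely inside or entirely outside \<open>G\<close>, and the two limits tell which; only the
  points of \<open>V\<close> remain to be decided.\<close>

lemma region_generic:
  assumes "finite H" "generic_in H V x" "saturated H G" "closed G" "G \<subseteq> W"
  shows "x \<in> facet_region V G P \<longleftrightarrow>
    ray_limit n (indicator G) x = 1 \<and> ray_limit (- n) (indicator G) x = 0"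
proof -
  interpret m: flat_cut W V N P "- a" "- n" "- b" by (rule mirror)
  have xV: "x \<in> V" using assms(2) by (rule generic_inD)
  then have x: "x \<in> W" "a \<bullet> x = b" using V by auto
  obtain d1 where d1: "d1 > 0"
    "ray_limit n (indicator G) x = 1 \<and> (\<forall>w\<in>W. dist x w < d1 \<longrightarrow> a \<bullet> w > b \<longrightarrow> w \<in> G) \<or>
     ray_limit n (indicator G) x = 0 \<and> (\<forall>w\<in>W. dist x w < d1 \<longrightarrow> a \<bullet> w > b \<longrightarrow> w \<notin> G)"
    using upper_dichotomy[OF assms(1-3)] by blast
  obtain d2 where d2: "d2 > 0"
    "ray_limit (- n) (indicator G) x = 1 \<and> (\<forall>w\<in>W. dist x w < d2 \<longrightarrow> a \<bullet> w < b \<longrightarrow> w \<in> G) \<or>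
     ray_limit (- n) (indicator G) x = 0 \<and> (\<forall>w\<in>W. dist x w < d2 \<longrightarrow> a \<bullet> w < b \<longrightarrow> w \<notin> G)"
    using m.upper_dichotomy[OF assms(1-3)] by auto
  show ?thesis
  proof
    assume "x \<in> facet_region V G P"
    then obtain e where e: "e > 0" "ball x e \<inter> G = ball x e \<inter> P"
      by (auto simp: locally_coincide_def)
    obtain s where s: "s > 0" "dist x (x + s *\<^sub>R n) < min e (min d1 d2)"
      using ray_near[of "min e (min d1 d2)" x n] e d1 d2 by auto
    have up: "x + s *\<^sub>R n \<in> W" "a \<bullet> (x + s *\<^sub>R n) > b"
      using dir[OF x(1)] x pos s by (auto simp: inner_add_right)
    have low: "x - s *\<^sub>R n \<in> W" "a \<bullet> (x - s *\<^sub>R n) < b" "dist x (x - s *\<^sub>R n) = dist x (x + s *\<^sub>R n)"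
      using dir[OF x(1), of "- s"] x pos s by (auto simp: inner_diff_right dist_norm)
    have "x + s *\<^sub>R n \<in> ball x e \<inter> P" using up s by (auto simp: P)
    then have "x + s *\<^sub>R n \<in> G" using e(2) by blast
    moreover have "x - s *\<^sub>R n \<in> ball x e" "x - s *\<^sub>R n \<notin> P" using low s by (auto simp: P)
    then have "x - s *\<^sub>R n \<notin> G" using e(2) by blast
    ultimately show "ray_limit n (indicator G) x = 1 \<and> ray_limit (- n) (indicator G) x = 0"
      using d1(2) d2(2) up low s by fastforce
  next
    assume lim: "ray_limit n (indicator G) x = 1 \<and> ray_limit (- n) (indicator G) x = 0"
    define d where "d = min d1 d2"
    have d: "d > 0" using d1 d2 by (simp add: d_def)
    have in_up: "w \<in> G" if "w \<in> W" "dist x w < d" "a \<bullet> w > b" for w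
      using that d1(2) lim by (auto simp: d_def)
    have in_low: "w \<notin> G" if "w \<in> W" "dist x w < d" "a \<bullet> w < b" for w
      using that d2(2) lim by (auto simp: d_def)
    \<comment> \<open>Points of \<open>V\<close> are limits of points of the upper side, which is in
      \<open>G\<close>; closedness of \<open>G\<close> puts them in \<open>G\<close> too, as they
      are in the closed half-space \<open>P\<close>.\<close>
    have in_V: "w \<in> G" if w: "w \<in> W" "dist x w < d" "a \<bullet> w = b" for w
    proof -
      have "w \<in> closure G"
        unfolding closure_approachable
      proof (intro allI impI)
        fix e :: real assume "e > 0"
        then have pos': "min e (d - dist x w) > 0" using w by simp
        obtain s where s: "s > 0" "dist w (w + s *\<^sub>R n) < min e (d - dist x w)"
          using ray_near[OF pos', of w n] by blast
        have "dist x (w + s *\<^sub>R n) < d"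
          using dist_triangle[of x "w + s *\<^sub>R n" w] s by simp
        then have "w + s *\<^sub>R n \<in> G"
          using in_up dir[OF w(1)] s w pos by (simp add: inner_add_right)
        then show "\<exists>y\<in>G. dist y w < e" using s by (intro bexI[of _ "w + s *\<^sub>R n"]) (simp add: dist_commute)
      qed
      then show ?thesis using assms(4) by simp
    qed
    have "z \<in> G \<longleftrightarrow> z \<in> P" if "dist x z < d" for z
      using that in_up[of z] in_low[of z] in_V[of z] assms(5) unfolding P
      by (cases "a \<bullet> z" b rule: linorder_cases) auto
    then have "ball x d \<inter> G = ball x d \<inter> P" by auto
    then show "x \<in> facet_region V G P" using xV d unfolding locally_coincide_def by blast
  qed
qed

lemma finite_region_components:
  assumes "finite H" "(a, b) \<in> H" "saturated H W" "saturated H G"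
  shows "finite (components (facet_region V G P))" "\<And>C. C \<in> components (facet_region V G P) \<Longrightarrow> saturated H C"
proof -
  have "V = W \<inter> {x. a \<bullet> x = b}" "P = W \<inter> {x. a \<bullet> x \<ge> b}" using V P by auto
  then have sat: "saturated H V" "saturated H P"
    using assms by (auto intro: saturated_Int saturated_hyperplane saturated_halfspace_ge)
  have "facet_region V G P = V \<inter> {x. locally_coincide x G P}" by auto
  then have U: "saturated H (facet_region V G P)"
    using sat assms by (auto intro: saturated_Int saturated_locally_coincide)
  show *: "saturated H C" if "C \<in> components (facet_region V G P)" for C
    using saturated_components[OF U that] .
  show "finite (components (facet_region V G P))"
    by (rule finite_subset[OF _ finite_saturated[OF assms(1)]]) (use * in blast)
qed

text \<open>A generic point has a neighbourhood in \<open>V\<close> inside one cell, so it is not on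
  the relative boundary of a union of cells.\<close>

lemma generic_closure_component:
  assumes "finite H" "saturated H C" "C \<subseteq> V" "generic_in H V x"
  shows "x \<in> closure C \<longleftrightarrow> x \<in> C"
proof
  assume x: "x \<in> closure C"
  obtain e where e: "e > 0" "\<And>y. y \<in> V \<Longrightarrow> dist x y < e \<Longrightarrow> same_side H x y"
    using generic_in_cell[OF assms(1,4)] by blast
  obtain c where c: "c \<in> C" "dist c x < e" using x e unfolding closure_approachable by blast
  then have "same_side H x c" using e assms(3) by (auto simp: dist_commute)
  then show "x \<in> C" using c saturated_iff[OF assms(2)] by blast
qed (use closure_subset in blast)

lemma sum_components_indicator:
  assumes "finite (components U)"
  shows "(\<Sum>C\<in>components U. indicator C x) = (indicator U x :: real)"
proof (cases "x \<in> U")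
  case True
  then obtain C where C: "C \<in> components U" "x \<in> C" using Union_components[of U] by blast
  have "(\<Sum>D\<in>components U. indicator D x) = (\<Sum>D\<in>components U. if D = C then 1 else 0 :: real)"
    using C components_nonoverlap by (intro sum.cong) (force simp: indicator_def)+
  then show ?thesis using C True assms by simp
next
  case False
  then have "x \<notin> C" if "C \<in> components U" for C using in_components_subset[OF that] by blast
  then show ?thesis using False by simp
qed

text \<open>At generic points closures may be dropped, and the components of a region are disjoint,
  so the sum is the difference of the indicators of the two regions. It is 1 or -1 if the one-sided
  values are 1, 0 or 0, 1, and 0 if they agree, exactly like the jump.\<close>

lemma facet_sum_generic:
  assumes H: "finite H" "(a, b) \<in> H" "(- a, - b) \<in> H" and sat: "saturated H W" "saturated H G"
    and G: "closed G" "G \<subseteq> W" and hull: "affine hull G = W" and x: "generic_in H V x"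
  shows "(\<Sum>F | polytope_facet F G \<and> F \<subseteq> V. side_sign P F G * indicator F x) = jump n (indicator G) x"
proof -
  interpret m: flat_cut W V N P "- a" "- n" "- b" by (rule mirror)
  note 1 = finite_region_components[OF H(1,2) sat]
  note 2 = m.finite_region_components[OF H(1,3) sat]
  have sums: "(\<Sum>C\<in>components U. indicator (closure C) x) = (indicator U x :: real)"
    if "U \<subseteq> V" "finite (components U)" "\<And>C. C \<in> components U \<Longrightarrow> saturated H C" for U
  proof -
    have "(\<Sum>C\<in>components U. indicator (closure C) x) = (\<Sum>C\<in>components U. indicator C x :: real)"
    proof (rule sum.cong[OF refl])
      fix C assume C: "C \<in> components U"
      then have "C \<subseteq> V" using that(1) in_components_subset by blast
      then show "indicator (closure C) x = (indicator C x :: real)"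
        using generic_closure_component[OF H(1) that(3)[OF C] _ x] by (simp add: indicator_def)
    qed
    then show ?thesis using sum_components_indicator[OF that(2)] by simp
  qed
  have 3: "(\<Sum>F | polytope_facet F G \<and> F \<subseteq> V. side_sign P F G * indicator F x) =
      indicator (facet_region V G P) x - indicator (facet_region V G N) x"
    unfolding side_sign_sum[OF hull 1(1) 2(1)]
    by (subst (1 2) sums) (use 1 2 in auto)
  have P: "x \<in> facet_region V G P \<longleftrightarrow>
    ray_limit n (indicator G) x = 1 \<and> ray_limit (- n) (indicator G) x = 0"
    by (rule region_generic[OF H(1) x sat(2) G])
  have N: "x \<in> facet_region V G N \<longleftrightarrow>
    ray_limit (- n) (indicator G) x = 1 \<and> ray_limit n (indicator G) x = 0"
    using m.region_generic[OF H(1) x sat(2) G] by simp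
  have "ray_limit n (indicator G) x \<in> {0, 1}" "ray_limit (- n) (indicator G) x \<in> {0, 1}"
    using upper_dichotomy[OF H(1) x sat(2)] m.upper_dichotomy[OF H(1) x sat(2)] by blast+
  then show ?thesis
    unfolding 3 jump_def indicator_def[of "facet_region V G P" x] indicator_def[of "facet_region V G N" x] P N by auto
qed

text \<open>A facet satisfies the hypotheses made on \<open>G\<close>, with \<open>V\<close> in
  place of \<open>W\<close>. This carries the induction down the face chains.\<close>

lemma facet_in_cut_properties:
  assumes H: "finite H" "(a, b) \<in> H" "(- a, - b) \<in> H" and sat: "saturated H W" "saturated H G"
    and G: "closed G" and hull: "affine hull G = W"
  shows "finite {F. polytope_facet F G \<and> F \<subseteq> V}"
    and "\<And>F. polytope_facet F G \<Longrightarrow> F \<subseteq> V \<Longrightarrow> closed F \<and> saturated H F \<and> F \<subseteq> G \<and> affine hull F = V"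
proof -
  interpret m: flat_cut W V N P "- a" "- n" "- b" by (rule mirror)
  note 1 = finite_region_components[OF H(1,2) sat]
  note 2 = m.finite_region_components[OF H(1,3) sat]
  show "finite {F. polytope_facet F G \<and> F \<subseteq> V}"
    unfolding facets_in_cut[OF hull] using 1 2 by simp
  have PN: "V \<subseteq> P" "V \<subseteq> N" using V P N by auto
  have *: "closed (closure C) \<and> saturated H (closure C) \<and> closure C \<subseteq> G \<and> affine hull (closure C) = V"
    if C: "C \<in> components (facet_region V G K)" and K: "V \<subseteq> K" "saturated H C" for C K
  proof -
    have CV: "C \<subseteq> facet_region V G K" using in_components_subset[OF C] .
    obtain x where xC: "x \<in> C" using in_components_nonempty[OF C] by blast
    then have x: "x \<in> V" "locally_coincide x G K" "x \<in> closure C"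
      using CV closure_subset[of C] by auto
    obtain e where e: "e > 0" "V \<inter> ball x e \<subseteq> C" using component_ball[OF affV C x] by blast
    have "closure C \<subseteq> V" using CV affV by (intro closure_minimal) (auto simp: affine_closed)
    then have "affine hull (closure C) \<subseteq> V" using affV by (intro hull_minimal)
    moreover have "V \<subseteq> affine hull (closure C)"
      using affine_hull_ball_Int[OF affV x(1) e(1)] hull_mono[of "V \<inter> ball x e" "closure C" affine] e(2)
        closure_subset[of C] by blast
    moreover have "C \<subseteq> G"
    proof
      fix y assume "y \<in> C"
      then have "y \<in> K" "locally_coincide y G K" using CV K by auto
      then obtain e' where "e' > 0" "ball y e' \<inter> G = ball y e' \<inter> K" "y \<in> ball y e' \<inter> K"
        unfolding locally_coincide_def by auto
      then show "y \<in> G" by blast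
    qed
    ultimately show ?thesis
      using saturated_closure[OF H(1) K(2)] closure_minimal[OF _ G] by auto
  qed
  show "closed F \<and> saturated H F \<and> F \<subseteq> G \<and> affine hull F = V" if "polytope_facet F G" "F \<subseteq> V" for F
  proof -
    have "F \<in> closure ` (components (facet_region V G P) \<union> components (facet_region V G N))"
      using that facets_in_cut[OF hull] by blast
    then show ?thesis using *[OF _ PN(1)] *[OF _ PN(2)] 1(2) 2(2) by blast
  qed
qed

end

section \<open>Face chains and iterated jumps\<close>

lemma solid_polytope_bounded:
  fixes A :: "'a::euclidean_space set"
  assumes "solid_polytope A"
  shows "bounded A"
proof -
  obtain S where S: "finite S" "\<forall>T\<in>S. int DIM('a) simplex T" "A = \<Union>S"
    using assms unfolding solid_polytope_def by blast
  then show ?thesis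
    using simplex_imp_polytope polytope_imp_bounded by (metis bounded_Union)
qed

lemma solid_polytope_affine_hull:
  fixes A :: "'a::euclidean_space set"
  assumes "solid_polytope A" "A \<noteq> {}"
  shows "affine hull A = UNIV"
proof -
  obtain S where S: "\<forall>T\<in>S. int DIM('a) simplex T" "A = \<Union>S"
    using assms unfolding solid_polytope_def by blast
  then obtain T where T: "int DIM('a) simplex T" "T \<subseteq> A" using assms(2) by blast
  have "aff_dim T = int DIM('a)" using T(1) by (rule aff_dim_simplex)
  then have "affine hull T = UNIV" by (simp add: aff_dim_eq_full)
  then show ?thesis using hull_mono[OF T(2), of affine] by auto
qed

lemma polyhedron_saturated:
  assumes "polyhedron S"
  obtains H where "finite H" "saturated H S"
proof -
  obtain F where F: "finite F" "S = \<Inter>F" "\<forall>h\<in>F. \<exists>a b. a \<noteq> 0 \<and> h = {x. a \<bullet> x \<le> b}"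
    using assms unfolding polyhedron_def by blast
  then have "\<forall>h\<in>F. \<exists>p. h = {x. fst p \<bullet> x \<le> snd p}" by (metis fst_conv snd_conv)
  then obtain p where p: "\<And>h. h \<in> F \<Longrightarrow> h = {x. fst (p h) \<bullet> x \<le> snd (p h)}" by metis
  have "saturated (p ` F) h" if h: "h \<in> F" for h
  proof -
    have "saturated (p ` F) {x. fst (p h) \<bullet> x \<le> snd (p h)}"
      using h by (intro saturated_halfspace_le) simp
    then show ?thesis using p[OF h] by simp
  qed
  then have "saturated (p ` F) S" unfolding F(2) by (rule saturated_Inter)
  then show ?thesis using that[of "p ` F"] F(1) by simp
qed

lemma solid_polytope_saturated:
  fixes A :: "'a::euclidean_space set"
  assumes "solid_polytope A"
  obtains H where "finite H" "saturated H A"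
proof -
  obtain S where S: "finite S" "\<forall>T\<in>S. int DIM('a) simplex T" "A = \<Union>S"
    using assms unfolding solid_polytope_def by blast
  have "\<exists>H. finite H \<and> saturated H T" if "T \<in> S" for T
    using S(2) that polyhedron_saturated simplex_imp_polyhedron by metis
  then obtain H where H: "\<And>T. T \<in> S \<Longrightarrow> finite (H T) \<and> saturated (H T) T" by metis
  have "saturated (\<Union>(H ` S)) T" if "T \<in> S" for T
    by (rule saturated_mono[of "H T"]) (use H that in auto)
  then have "saturated (\<Union>(H ` S)) A" unfolding S(3) by (rule saturated_Union)
  then show ?thesis using that[of "\<Union>(H ` S)"] H S(1) by simp
qed

definition flag_normals ::
  "nat \<Rightarrow> 'a::euclidean_space flag \<Rightarrow> (nat \<Rightarrow> 'a) \<Rightarrow> (nat \<Rightarrow> real) \<Rightarrow> (nat \<Rightarrow> 'a) \<Rightarrow> bool" where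
  "flag_normals r \<Phi> a b n \<longleftrightarrow> r \<le> DIM('a) \<and> flat \<Phi> DIM('a) = UNIV \<and>
     (\<forall>j\<in>{r..<DIM('a)}. flat_cut (flat \<Phi> (Suc j)) (flat \<Phi> j) (pos \<Phi> j)
        {x\<in>flat \<Phi> (Suc j). a j \<bullet> x \<le> b j} (a j) (n j) (b j))"

lemma flag_normals_cut:
  "flag_normals r (\<Phi> :: 'a::euclidean_space flag) a b n \<Longrightarrow> r \<le> j \<Longrightarrow> j < DIM('a) \<Longrightarrow>
     flat_cut (flat \<Phi> (Suc j)) (flat \<Phi> j) (pos \<Phi> j)
        {x\<in>flat \<Phi> (Suc j). a j \<bullet> x \<le> b j} (a j) (n j) (b j)"
  unfolding flag_normals_def by simp

lemma is_flag_normals: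
  fixes \<Phi> :: "'a::euclidean_space flag"
  assumes "is_flag r \<Phi>"
  obtains a b n where "flag_normals r \<Phi> a b n"
proof -
  have "\<exists>a b n. flat_cut (flat \<Phi> (Suc j)) (flat \<Phi> j) (pos \<Phi> j)
        {x\<in>flat \<Phi> (Suc j). a \<bullet> x \<le> b} a n b" if j: "j \<in> {r..<DIM('a)}" for j
  proof -
    have aff: "affine (flat \<Phi> (Suc j))" and dim: "aff_dim (flat \<Phi> j) = int j"
      and hs: "halfspace_in (flat \<Phi> (Suc j)) (flat \<Phi> j) (pos \<Phi> j)"
      using assms j unfolding is_flag_def by auto
    have ne: "flat \<Phi> j \<noteq> {}" using dim by auto
    obtain a b n where abn: "flat \<Phi> j = {x\<in>flat \<Phi> (Suc j). a \<bullet> x = b}"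
      "pos \<Phi> j = {x\<in>flat \<Phi> (Suc j). a \<bullet> x \<ge> b}" "a \<bullet> n > 0"
      "\<And>w s. w \<in> flat \<Phi> (Suc j) \<Longrightarrow> w + s *\<^sub>R n \<in> flat \<Phi> (Suc j)"
      using halfspace_in_normal[OF hs aff ne] by blast
    have "flat_cut (flat \<Phi> (Suc j)) (flat \<Phi> j) (pos \<Phi> j) {x\<in>flat \<Phi> (Suc j). a \<bullet> x \<le> b} a n b"
      by (intro flat_cut.intro aff abn refl)
    then show ?thesis by blast
  qed
  then obtain a b n where "\<And>j. j \<in> {r..<DIM('a)} \<Longrightarrow> flat_cut (flat \<Phi> (Suc j)) (flat \<Phi> j) (pos \<Phi> j)
        {x\<in>flat \<Phi> (Suc j). a j \<bullet> x \<le> b j} (a j) (n j) (b j)" by metis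
  then have "flag_normals r \<Phi> a b n"
    using assms unfolding flag_normals_def is_flag_def by auto
  then show ?thesis using that by blast
qed

lemma flat_translate_flag [simp]: "flat (translate_flag l \<Phi>) j = (+) l ` flat \<Phi> j"
  and pos_translate_flag [simp]: "pos (translate_flag l \<Phi>) j = (+) l ` pos \<Phi> j"
  by (simp_all add: translate_flag_def)

lemma translated_halfspace:
  fixes l :: "'a::euclidean_space"
  shows "(+) l ` {x\<in>W. Q (a \<bullet> x - b)} = {x\<in>(+) l ` W. Q (a \<bullet> x - (b + a \<bullet> l))}"
  by (auto simp: inner_add_right image_iff algebra_simps)

lemma flat_cut_translate:
  assumes "flat_cut W V P N a n b"
  shows "flat_cut ((+) l ` W) ((+) l ` V) ((+) l ` P) ((+) l ` N) a n (b + a \<bullet> l)"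
proof -
  interpret flat_cut W V P N a n b by fact
  show ?thesis
  proof
    show "affine ((+) l ` W)" using affW affine_translation by blast
    show "(+) l ` V = {x \<in> (+) l ` W. a \<bullet> x = b + a \<bullet> l}"
      using translated_halfspace[of l W "\<lambda>t. t = 0" a b] V by simp
    show "(+) l ` P = {x \<in> (+) l ` W. b + a \<bullet> l \<le> a \<bullet> x}"
      using translated_halfspace[of l W "\<lambda>t. t \<ge> 0" a b] P by simp
    show "(+) l ` N = {x \<in> (+) l ` W. a \<bullet> x \<le> b + a \<bullet> l}"
      using translated_halfspace[of l W "\<lambda>t. t \<le> 0" a b] N by simp
    show "w + s *\<^sub>R n \<in> (+) l ` W" if w: "w \<in> (+) l ` W" for w s
    proof -
      obtain u where "u \<in> W" "w = l + u" using w by blast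
      then show ?thesis using dir[of u s] by (auto simp: image_iff add.assoc)
    qed
    show "a \<bullet> n > 0" by (rule pos)
  qed
qed

lemma flag_normals_translate:
  fixes \<Phi> :: "'a::euclidean_space flag"
  assumes "flag_normals r \<Phi> a b n"
  shows "flag_normals r (translate_flag l \<Phi>) a (\<lambda>j. b j + a j \<bullet> l) n"
proof -
  have "flat_cut ((+) l ` flat \<Phi> (Suc j)) ((+) l ` flat \<Phi> j) ((+) l ` pos \<Phi> j)
      {x \<in> (+) l ` flat \<Phi> (Suc j). a j \<bullet> x \<le> b j + a j \<bullet> l} (a j) (n j) (b j + a j \<bullet> l)"
    if "r \<le> j" "j < DIM('a)" for j
  proof -
    have "(+) l ` {x \<in> flat \<Phi> (Suc j). a j \<bullet> x \<le> b j} = {x \<in> (+) l ` flat \<Phi> (Suc j). a j \<bullet> x \<le> b j + a j \<bullet> l}"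
      using translated_halfspace[of l "flat \<Phi> (Suc j)" "\<lambda>t. t \<le> 0" "a j" "b j"] by simp
    then show ?thesis
      using flat_cut_translate[OF flag_normals_cut[OF assms that], of l] by simp
  qed
  moreover have "range ((+) l) = UNIV" by (rule surj_plus)
  ultimately show ?thesis
    using assms unfolding flag_normals_def by simp
qed

definition facets_within :: "'a::euclidean_space set \<Rightarrow> 'a set \<Rightarrow> 'a set set" where
  "facets_within V G = {F. polytope_facet F G \<and> F \<subseteq> V}"

text \<open>The extension is injective because a chain that stops at dimension \<open>Suc k\<close>
  has the empty set at index \<open>k\<close>, so that resetting this index recovers it.\<close>

lemma face_chains_step:
  fixes A :: "'a::euclidean_space set"
  assumes "k < DIM('a)"
  shows "face_chains k \<Phi> A = (\<lambda>(F, E). F(k := E)) `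
      (SIGMA F:face_chains (Suc k) \<Phi> A. facets_within (flat \<Phi> k) (F (Suc k)))"
    and "inj_on (\<lambda>(F, E). F(k := E))
      (SIGMA F:face_chains (Suc k) \<Phi> A. facets_within (flat \<Phi> k) (F (Suc k)))"
proof -
  let ?S = "SIGMA F:face_chains (Suc k) \<Phi> A. facets_within (flat \<Phi> k) (F (Suc k))"
  show "face_chains k \<Phi> A = (\<lambda>(F, E). F(k := E)) ` ?S"
  proof (intro equalityI subsetI)
    fix F assume F: "F \<in> face_chains k \<Phi> A"
    have "F(k := {}) \<in> face_chains (Suc k) \<Phi> A"
      using F assms unfolding face_chains_def by auto
    moreover have "F k \<in> facets_within (flat \<Phi> k) ((F(k := {})) (Suc k))"
      using F assms unfolding face_chains_def facets_within_def by auto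
    ultimately have "(F(k := {}), F k) \<in> ?S" by blast
    moreover have "F = (\<lambda>(F, E). F(k := E)) (F(k := {}), F k)" by simp
    ultimately show "F \<in> (\<lambda>(F, E). F(k := E)) ` ?S" by blast
  next
    fix F assume "F \<in> (\<lambda>(F, E). F(k := E)) ` ?S"
    then obtain F' E where F': "F = F'(k := E)" "F' \<in> face_chains (Suc k) \<Phi> A"
      "E \<in> facets_within (flat \<Phi> k) (F' (Suc k))" by auto
    show "F \<in> face_chains k \<Phi> A"
      unfolding face_chains_def
    proof (intro CollectI conjI ballI allI impI)
      show "F DIM('a) = A" using F' assms unfolding face_chains_def by auto
    next
      fix j assume j: "j \<in> {k..<DIM('a)}"
      show "polytope_facet (F j) (F (Suc j))" "F j \<subseteq> flat \<Phi> j"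
        using F' j unfolding face_chains_def facets_within_def by (cases "j = k"; auto)+
    next
      fix j assume "j \<notin> {k..DIM('a)}"
      then show "F j = {}" using F' assms unfolding face_chains_def by auto
    qed
  qed
  show "inj_on (\<lambda>(F, E). F(k := E)) ?S"
  proof (rule inj_onI, clarify)
    fix F E F' E'
    assume F: "F \<in> face_chains (Suc k) \<Phi> A" "F' \<in> face_chains (Suc k) \<Phi> A" and eq: "F(k := E) = F'(k := E')"
    have "F k = F' k" using F unfolding face_chains_def by simp
    then show "F = F' \<and> E = E'" using eq by (metis fun_upd_eqD fun_upd_triv fun_upd_upd)
  qed
qed

text \<open>With \<open>flat_volume (flat \<Phi> k)\<close> for \<open>g\<close> this is
  \<open>flag_weight\<close>; with the indicator at a point it is the signed count of chains whose
  end face contains the point. A general \<open>g\<close> can absorb the sum over the last facet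
  (\<open>chain_sum_step\<close>).\<close>

definition chain_sum :: "nat \<Rightarrow> 'a::euclidean_space flag \<Rightarrow> 'a set \<Rightarrow> ('a set \<Rightarrow> real) \<Rightarrow> real" where
  "chain_sum k \<Phi> A g = (\<Sum>F\<in>face_chains k \<Phi> A.
     (\<Prod>j\<in>{k..<DIM('a)}. side_sign (pos \<Phi> j) (F j) (F (Suc j))) * g (F k))"

lemma chain_sum_step:
  fixes A :: "'a::euclidean_space set"
  assumes k: "k < DIM('a)" and fin: "finite (face_chains (Suc k) \<Phi> A)"
    "\<And>F. F \<in> face_chains (Suc k) \<Phi> A \<Longrightarrow> finite (facets_within (flat \<Phi> k) (F (Suc k)))"
  shows "chain_sum k \<Phi> A g = chain_sum (Suc k) \<Phi> A
     (\<lambda>G. \<Sum>E\<in>facets_within (flat \<Phi> k) G. side_sign (pos \<Phi> k) E G * g E)"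
proof -
  have set: "{k..<DIM('a)} = insert k {Suc k..<DIM('a)}" using k by auto
  have "chain_sum k \<Phi> A g =
    (\<Sum>(F, E)\<in>(SIGMA F:face_chains (Suc k) \<Phi> A. facets_within (flat \<Phi> k) (F (Suc k))).
      (\<Prod>j\<in>{k..<DIM('a)}. side_sign (pos \<Phi> j) ((F(k := E)) j) ((F(k := E)) (Suc j))) * g E)"
    unfolding chain_sum_def face_chains_step(1)[OF k]
    by (subst sum.reindex[OF face_chains_step(2)[OF k]]) (simp add: case_prod_beta)
  also have "\<dots> = (\<Sum>(F, E)\<in>(SIGMA F:face_chains (Suc k) \<Phi> A. facets_within (flat \<Phi> k) (F (Suc k))).
      (\<Prod>j\<in>{Suc k..<DIM('a)}. side_sign (pos \<Phi> j) (F j) (F (Suc j))) *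
      (side_sign (pos \<Phi> k) E (F (Suc k)) * g E))"
  proof (intro sum.cong refl, clarify)
    fix F :: "nat \<Rightarrow> 'a set" and E
    have "(\<Prod>j\<in>{Suc k..<DIM('a)}. side_sign (pos \<Phi> j) ((F(k := E)) j) ((F(k := E)) (Suc j))) =
      (\<Prod>j\<in>{Suc k..<DIM('a)}. side_sign (pos \<Phi> j) (F j) (F (Suc j)))"
      by (intro prod.cong) auto
    then show "(\<Prod>j\<in>{k..<DIM('a)}. side_sign (pos \<Phi> j) ((F(k := E)) j) ((F(k := E)) (Suc j))) * g E =
      (\<Prod>j\<in>{Suc k..<DIM('a)}. side_sign (pos \<Phi> j) (F j) (F (Suc j))) *
      (side_sign (pos \<Phi> k) E (F (Suc k)) * g E)"
      unfolding set by simp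
  qed
  also have "\<dots> = chain_sum (Suc k) \<Phi> A
     (\<lambda>G. \<Sum>E\<in>facets_within (flat \<Phi> k) G. side_sign (pos \<Phi> k) E G * g E)"
    unfolding chain_sum_def using fin
    by (subst sum.Sigma[symmetric]) (auto simp: sum_distrib_left)
  finally show ?thesis .
qed

text \<open>Both signs of each cutting functional are put into \<open>H\<close>, because the
  negative side is treated through \<open>mirror\<close>, whose functional is \<open>- a j\<close>
  with bound \<open>- b j\<close>.\<close>

locale flag_arrangement =
  fixes r :: nat and \<Phi> :: "'a::euclidean_space flag" and a n :: "nat \<Rightarrow> 'a" and b :: "nat \<Rightarrow> real"
    and H :: "('a \<times> real) set" and A :: "'a set"
  assumes normals: "flag_normals r \<Phi> a b n"
    and finH: "finite H"
    and H: "\<And>j. r \<le> j \<Longrightarrow> j < DIM('a) \<Longrightarrow> (a j, b j) \<in> H \<and> (- a j, - b j) \<in> H"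
    and satA: "saturated H A"
    and closedA: "closed A"
    and hullA: "affine hull A = UNIV"
begin

lemma saturated_flat: "k \<le> DIM('a) \<Longrightarrow> r \<le> k \<Longrightarrow> saturated H (flat \<Phi> k)"
proof (induction rule: inc_induct)
  case base
  then show ?case using normals by (simp add: flag_normals_def)
next
  case (step k)
  interpret flat_cut "flat \<Phi> (Suc k)" "flat \<Phi> k" "pos \<Phi> k"
    "{x\<in>flat \<Phi> (Suc k). a k \<bullet> x \<le> b k}" "a k" "n k" "b k"
    using flag_normals_cut[OF normals step.prems step.hyps(2)] .
  have "flat \<Phi> k = flat \<Phi> (Suc k) \<inter> {x. a k \<bullet> x = b k}" using V by auto
  moreover have "saturated H (flat \<Phi> (Suc k))" using step by simp
  ultimately show ?case
    using H[OF step.prems step.hyps(2)] by (auto intro!: saturated_Int saturated_hyperplane)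
qed

lemma chain_face_properties:
  "k \<le> DIM('a) \<Longrightarrow> r \<le> k \<Longrightarrow> finite (face_chains k \<Phi> A) \<and> (\<forall>F\<in>face_chains k \<Phi> A.
     closed (F k) \<and> saturated H (F k) \<and> F k \<subseteq> A \<and> affine hull (F k) = flat \<Phi> k)"
proof (induction rule: inc_induct)
  case base
  have "face_chains DIM('a) \<Phi> A = {(\<lambda>j. if j = DIM('a) then A else {})}"
    unfolding face_chains_def by (auto simp: fun_eq_iff)
  then show ?case using closedA satA hullA normals by (simp add: flag_normals_def)
next
  case (step k)
  interpret flat_cut "flat \<Phi> (Suc k)" "flat \<Phi> k" "pos \<Phi> k"
    "{x\<in>flat \<Phi> (Suc k). a k \<bullet> x \<le> b k}" "a k" "n k" "b k"
    using flag_normals_cut[OF normals step.prems step.hyps(2)] .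
  have IH: "finite (face_chains (Suc k) \<Phi> A)"
    "\<And>F. F \<in> face_chains (Suc k) \<Phi> A \<Longrightarrow> closed (F (Suc k)) \<and> saturated H (F (Suc k)) \<and>
       F (Suc k) \<subseteq> A \<and> affine hull (F (Suc k)) = flat \<Phi> (Suc k)"
    using step by auto
  have Hk: "(a k, b k) \<in> H" "(- a k, - b k) \<in> H" using H[OF step.prems step.hyps(2)] by auto
  have sat: "saturated H (flat \<Phi> (Suc k))" using saturated_flat step by simp
  note facet = facet_in_cut_properties[OF finH Hk sat]
  have fin: "finite (facets_within (flat \<Phi> k) (F (Suc k)))" if "F \<in> face_chains (Suc k) \<Phi> A" for F
    unfolding facets_within_def using IH(2)[OF that] by (intro facet(1)) auto
  show ?case
  proof (intro conjI ballI)
    show "finite (face_chains k \<Phi> A)"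
      unfolding face_chains_step(1)[OF step.hyps(2)] using IH(1) fin by (intro finite_imageI finite_SigmaI)
  next
    fix F assume "F \<in> face_chains k \<Phi> A"
    then obtain F' where F': "F' \<in> face_chains (Suc k) \<Phi> A" "F k \<in> facets_within (flat \<Phi> k) (F' (Suc k))"
      unfolding face_chains_step(1)[OF step.hyps(2)] by auto
    have *: "closed (F k) \<and> saturated H (F k) \<and> F k \<subseteq> F' (Suc k) \<and> affine hull (F k) = flat \<Phi> k"
      using IH(2)[OF F'(1)] F'(2) unfolding facets_within_def by (intro facet(2)) auto
    then show "closed (F k)" "saturated H (F k)" "affine hull (F k) = flat \<Phi> k" by auto
    show "F k \<subseteq> A" using * IH(2)[OF F'(1)] by blast
  qed
qed

lemma finite_facets_within:
  assumes "r \<le> k" "k < DIM('a)" "F \<in> face_chains (Suc k) \<Phi> A"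
  shows "finite (facets_within (flat \<Phi> k) (F (Suc k)))"
proof -
  interpret flat_cut "flat \<Phi> (Suc k)" "flat \<Phi> k" "pos \<Phi> k"
    "{x\<in>flat \<Phi> (Suc k). a k \<bullet> x \<le> b k}" "a k" "n k" "b k"
    using flag_normals_cut[OF normals assms(1,2)] .
  show ?thesis
    unfolding facets_within_def
    using H[OF assms(1,2)] finH saturated_flat[of "Suc k"] chain_face_properties[of "Suc k"] assms
    by (intro facet_in_cut_properties(1)[of H]) auto
qed

text \<open>Downward induction: the sum over the last facets becomes the jump of the indicator of
  the preceding face (\<open>facet_sum_generic\<close>), and linearity takes the jump out of the
  sum.\<close>

lemma chain_sum_generic:
  "k \<le> DIM('a) \<Longrightarrow> r \<le> k \<Longrightarrow> \<forall>x. generic_in H (flat \<Phi> k) x \<longrightarrow>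
     chain_sum k \<Phi> A (\<lambda>F. indicator F x) = jumps n k DIM('a) (indicator A) x"
proof (induction rule: inc_induct)
  case base
  have "face_chains DIM('a) \<Phi> A = {(\<lambda>j. if j = DIM('a) then A else {})}"
    unfolding face_chains_def by (auto simp: fun_eq_iff)
  then show ?case by (simp add: chain_sum_def)
next
  case (step k)
  have rk: "r \<le> k" "k < DIM('a)" using step by auto
  interpret flat_cut "flat \<Phi> (Suc k)" "flat \<Phi> k" "pos \<Phi> k"
    "{x\<in>flat \<Phi> (Suc k). a k \<bullet> x \<le> b k}" "a k" "n k" "b k"
    using flag_normals_cut[OF normals rk] .
  interpret m: flat_cut "flat \<Phi> (Suc k)" "flat \<Phi> k"
    "{x\<in>flat \<Phi> (Suc k). a k \<bullet> x \<le> b k}" "pos \<Phi> k" "- a k" "- n k" "- b k"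
    by (rule mirror)
  have ch: "finite (face_chains (Suc k) \<Phi> A)"
    "\<And>F. F \<in> face_chains (Suc k) \<Phi> A \<Longrightarrow> closed (F (Suc k)) \<and> saturated H (F (Suc k)) \<and>
       F (Suc k) \<subseteq> flat \<Phi> (Suc k) \<and> affine hull (F (Suc k)) = flat \<Phi> (Suc k)"
  proof -
    show "finite (face_chains (Suc k) \<Phi> A)" using chain_face_properties[of "Suc k"] rk by simp
    show "closed (F (Suc k)) \<and> saturated H (F (Suc k)) \<and>
       F (Suc k) \<subseteq> flat \<Phi> (Suc k) \<and> affine hull (F (Suc k)) = flat \<Phi> (Suc k)"
      if "F \<in> face_chains (Suc k) \<Phi> A" for F
      using chain_face_properties[of "Suc k"] rk that hull_subset[of "F (Suc k)" affine] by auto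
  qed
  have Hk: "(a k, b k) \<in> H" "(- a k, - b k) \<in> H" using H[OF rk] by auto
  have sat: "saturated H (flat \<Phi> (Suc k))" using saturated_flat rk by simp
  let ?g = "\<lambda>y. chain_sum (Suc k) \<Phi> A (\<lambda>F. indicator F y)"
  have IH: "?g y = jumps n (Suc k) DIM('a) (indicator A) y" if "generic_in H (flat \<Phi> (Suc k)) y" for y
    using step that by auto
  show ?case
  proof (intro allI impI)
    fix x assume x: "generic_in H (flat \<Phi> k) x"
    have "chain_sum k \<Phi> A (\<lambda>F. indicator F x) = chain_sum (Suc k) \<Phi> A
     (\<lambda>G. \<Sum>E\<in>facets_within (flat \<Phi> k) G. side_sign (pos \<Phi> k) E G * indicator E x)"
      using rk ch(1) finite_facets_within by (intro chain_sum_step) auto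
    also have "\<dots> = chain_sum (Suc k) \<Phi> A (\<lambda>G. jump (n k) (indicator G) x)"
      unfolding chain_sum_def facets_within_def
      by (intro sum.cong refl arg_cong2[of _ _ _ _ "(*)"] facet_sum_generic[OF finH Hk sat _ _ _ _ x])
         (use ch in auto)
    also have "\<dots> = jump (n k) ?g x"
      unfolding chain_sum_def
      by (subst jump_sum) (use ch finH in \<open>auto intro!: piecewise_constant_side_measurable side_measurable_indicator\<close>)
    \<comment> \<open>The induction hypothesis holds at generic points of the larger flat only; near
      \<open>x\<close>, the rays to both sides consist of such points.\<close>
    also have "\<dots> = jump (n k) (jumps n (Suc k) DIM('a) (indicator A)) x"
      unfolding jump_def
      by (intro arg_cong2[of _ _ _ _ "(-)"] ray_limit_cong
          eventually_mono[OF eventually_generic[OF finH x]] eventually_mono[OF m.eventually_generic[OF finH x]] IH)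
    also have "\<dots> = jumps n k DIM('a) (indicator A) x"
      using rk by (simp add: jumps_step)
    finally show "chain_sum k \<Phi> A (\<lambda>F. indicator F x) = jumps n k DIM('a) (indicator A) x" .
  qed
qed

end

text \<open>The empty polytope needs separate treatment: its affine hull is empty instead of
  \<open>UNIV\<close>, and an empty flat has no proper hyperplane.\<close>

lemma face_chains_empty:
  assumes "r < DIM('a)"
  shows "face_chains r \<Phi> ({} :: 'a::euclidean_space set) = {}"
proof (rule ccontr)
  assume "\<not> ?thesis"
  then obtain F where F: "F \<in> face_chains r \<Phi> ({} :: 'a set)" by blast
  have "DIM('a) - 1 \<in> {r..<DIM('a)}" using assms by auto
  then have "polytope_facet (F (DIM('a) - 1)) (F (Suc (DIM('a) - 1)))"
    using F unfolding face_chains_def by blast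
  moreover have "F (Suc (DIM('a) - 1)) = {}" using F unfolding face_chains_def by simp
  ultimately show False
    unfolding polytope_facet_def halfspace_in_def by auto
qed

section \<open>Lebesgue measure on flats\<close>

definition orthonormal :: "'a::euclidean_space set \<Rightarrow> bool" where
  "orthonormal B \<longleftrightarrow> pairwise orthogonal B \<and> (\<forall>b\<in>B. norm b = 1)"

lemma orthonormal_independent: "orthonormal B \<Longrightarrow> independent B"
  unfolding orthonormal_def by (intro pairwise_orthogonal_independent) auto

lemma orthonormal_finite: "orthonormal B \<Longrightarrow> finite B"
  using orthonormal_independent independent_imp_finite by blast

lemma orthonormal_inner:
  "orthonormal B \<Longrightarrow> b \<in> B \<Longrightarrow> c \<in> B \<Longrightarrow> b \<bullet> c = (if b = c then 1 else 0)"
  unfolding orthonormal_def pairwise_def orthogonal_def by (auto simp: norm_eq_1)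

lemma orthonormal_coordinate:
  assumes "orthonormal B" "b \<in> B"
  shows "(\<Sum>c\<in>B. t c *\<^sub>R c) \<bullet> b = t b"
proof -
  have "(\<Sum>c\<in>B. t c *\<^sub>R c) \<bullet> b = (\<Sum>c\<in>B. if c = b then t b else 0)"
    unfolding inner_sum_left using assms by (intro sum.cong) (auto simp: orthonormal_inner)
  then show ?thesis using assms orthonormal_finite[OF assms(1)] by simp
qed

lemma orthonormal_norm:
  assumes "orthonormal B"
  shows "(norm (\<Sum>b\<in>B. t b *\<^sub>R b))\<^sup>2 = (\<Sum>b\<in>B. (t b)\<^sup>2)"
proof -
  have "(norm (\<Sum>b\<in>B. t b *\<^sub>R b))\<^sup>2 = (\<Sum>b\<in>B. (\<Sum>c\<in>B. t c *\<^sub>R c) \<bullet> (t b *\<^sub>R b))"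
    by (simp only: power2_norm_eq_inner inner_sum_right)
  also have "\<dots> = (\<Sum>b\<in>B. (t b)\<^sup>2)"
    by (intro sum.cong refl) (simp add: orthonormal_coordinate[OF assms] power2_eq_square)
  finally show ?thesis .
qed

lemma orthonormal_expansion:
  "orthonormal B \<Longrightarrow> x \<in> span B \<Longrightarrow> (\<Sum>b\<in>B. (x \<bullet> b) *\<^sub>R b) = x"
  using orthonormal_basis_expand[of B x] orthonormal_finite[of B] unfolding orthonormal_def by blast

section \<open>Lebesgue measure on the span of an orthonormal set\<close>

interpretation lborel_product: product_sigma_finite "\<lambda>_ :: 'i. lborel :: real measure"
  by standard

text \<open>Serves two purposes: with the identity for \<open>\<pi>\<close> it gives invariance
  under translations and under reflection in the origin, with \<open>s = 0\<close> and
  \<open>\<sigma> = 1\<close> it allows passing between two bases of the same size.\<close>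

lemma PiM_lborel_affine_reindex:
  fixes \<sigma> :: real
  assumes B: "finite B" "finite B'" and \<pi>: "bij_betw \<pi> B' B" and \<sigma>: "\<bar>\<sigma>\<bar> = 1"
  shows "distr (\<Pi>\<^sub>M b\<in>B. lborel) (\<Pi>\<^sub>M b\<in>B'. lborel) (\<lambda>t. \<lambda>b\<in>B'. s b + \<sigma> * t (\<pi> b)) = (\<Pi>\<^sub>M b\<in>B'. lborel)"
    (is "distr ?M ?M' ?f = _")
proof (rule lborel_product.PiM_eqI[OF B(2)])
  have \<pi>B: "\<pi> b \<in> B" if "b \<in> B'" for b using \<pi> that by (auto simp: bij_betw_def)
  have meas: "?f \<in> measurable ?M ?M'"
    by (intro measurable_restrict) (use \<pi>B in measurable)
  fix A :: "_ \<Rightarrow> real set" assume A: "\<And>i. i \<in> B' \<Longrightarrow> A i \<in> sets lborel"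
  define \<rho> where "\<rho> = the_inv_into B' \<pi>"
  have \<rho>: "\<rho> b \<in> B'" "\<pi> (\<rho> b) = b" if "b \<in> B" for b
    using \<pi> that the_inv_into_into[of \<pi> B' b B'] f_the_inv_into_f_bij_betw[OF \<pi>, of b]
    by (auto simp: \<rho>_def bij_betw_def)
  have \<rho>\<pi>: "\<rho> (\<pi> b) = b" if "b \<in> B'" for b
    using \<pi> that by (simp add: \<rho>_def bij_betw_def the_inv_into_f_f)
  have aff: "emeasure lborel ((\<lambda>x. u + \<sigma> * x) -` X) = emeasure lborel X"
    "(\<lambda>x. u + \<sigma> * x) -` X \<in> sets borel" if "X \<in> sets borel" for X :: "real set" and u
  proof -
    have "distr lborel borel (\<lambda>x. u + \<sigma> * x) = lborel"
      using lborel_real_affine[of \<sigma> u] \<sigma> by (auto simp: density_1 one_ennreal_def[symmetric])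
    then have "emeasure lborel X = emeasure (distr lborel borel (\<lambda>x. u + \<sigma> * x)) X" by simp
    also have "\<dots> = emeasure lborel ((\<lambda>x. u + \<sigma> * x) -` X)"
      using that by (subst emeasure_distr) auto
    finally show "emeasure lborel ((\<lambda>x. u + \<sigma> * x) -` X) = emeasure lborel X" by simp
    have "(\<lambda>x. u + \<sigma> * x) -` X \<inter> space borel \<in> sets borel"
      using that by (intro measurable_sets[of _ borel borel]) auto
    then show "(\<lambda>x. u + \<sigma> * x) -` X \<in> sets borel" by simp
  qed
  have pre: "?f -` (Pi\<^sub>E B' A) \<inter> space ?M = Pi\<^sub>E B (\<lambda>b. (\<lambda>x. s (\<rho> b) + \<sigma> * x) -` A (\<rho> b))"
  proof (intro equalityI subsetI)
    fix t assume t: "t \<in> ?f -` (Pi\<^sub>E B' A) \<inter> space ?M"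
    show "t \<in> Pi\<^sub>E B (\<lambda>b. (\<lambda>x. s (\<rho> b) + \<sigma> * x) -` A (\<rho> b))"
    proof (rule PiE_I)
      fix b assume b: "b \<in> B"
      have "?f t (\<rho> b) \<in> A (\<rho> b)" using t \<rho>(1)[OF b] by (auto simp: PiE_iff)
      then show "t b \<in> (\<lambda>x. s (\<rho> b) + \<sigma> * x) -` A (\<rho> b)" using \<rho>[OF b] by simp
    next
      fix b assume b: "b \<notin> B"
      have "t \<in> Pi\<^sub>E B (\<lambda>_. UNIV)" using t by (simp add: space_PiM)
      then show "t b = undefined" using b by (rule PiE_arb)
    qed
  next
    fix t assume t: "t \<in> Pi\<^sub>E B (\<lambda>b. (\<lambda>x. s (\<rho> b) + \<sigma> * x) -` A (\<rho> b))"
    have "s b + \<sigma> * t (\<pi> b) \<in> A b" if b: "b \<in> B'" for b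
      using PiE_mem[OF t \<pi>B[OF b]] \<rho>\<pi>[OF b] by simp
    moreover have "t \<in> space ?M" using t by (auto simp: space_PiM PiE_iff)
    ultimately show "t \<in> ?f -` (Pi\<^sub>E B' A) \<inter> space ?M" by (simp add: restrict_PiE_iff)
  qed
  have "emeasure (distr ?M ?M' ?f) (Pi\<^sub>E B' A) = emeasure ?M (?f -` (Pi\<^sub>E B' A) \<inter> space ?M)"
    using A B by (intro emeasure_distr meas sets_PiM_I_finite) auto
  also have "\<dots> = (\<Prod>b\<in>B. emeasure lborel ((\<lambda>x. s (\<rho> b) + \<sigma> * x) -` A (\<rho> b)))"
    unfolding pre using A \<rho>(1) B aff(2) by (intro lborel_product.emeasure_PiM) auto
  also have "\<dots> = (\<Prod>b\<in>B. emeasure lborel (A (\<rho> b)))"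
    using A \<rho>(1) aff(1) by (intro prod.cong) auto
  also have "\<dots> = (\<Prod>b\<in>B'. emeasure lborel (A b))"
    using prod.reindex_bij_betw[OF \<pi>, of "\<lambda>b. emeasure lborel (A (\<rho> b))"] \<rho>\<pi> by simp
  finally show "emeasure (distr ?M ?M' ?f) (Pi\<^sub>E B' A) = (\<Prod>b\<in>B'. emeasure lborel (A b))" .
qed simp

text \<open>The measure is pushed forward to the ambient space, so that measures belonging to
  different subspaces live on the same Borel sets.\<close>

definition span_measure :: "'a::euclidean_space set \<Rightarrow> 'a measure" where
  "span_measure B = distr (\<Pi>\<^sub>M b\<in>B. lborel) borel (\<lambda>t. \<Sum>b\<in>B. t b *\<^sub>R b)"

lemma sets_span_measure [simp, measurable_cong]: "sets (span_measure B) = sets borel"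
  and space_span_measure [simp]: "space (span_measure B) = UNIV"
  by (simp_all add: span_measure_def)

lemma measurable_coordinate:
  assumes "b \<in> B"
  shows "(\<lambda>t. t b :: real) \<in> borel_measurable (\<Pi>\<^sub>M b\<in>B. lborel)"
  using measurable_component_singleton[OF assms, of "\<lambda>_. lborel :: real measure"] by simp

lemma measurable_combination [measurable]:
  fixes B :: "'a::euclidean_space set"
  shows "(\<lambda>t. \<Sum>b\<in>B. t b *\<^sub>R b) \<in> borel_measurable (\<Pi>\<^sub>M b\<in>B. lborel)"
  by (intro borel_measurable_sum borel_measurable_scaleR borel_measurable_const measurable_coordinate)

lemma sets_combination:
  fixes B S :: "'a::euclidean_space set"
  assumes "S \<in> sets borel"
  shows "{t \<in> space (\<Pi>\<^sub>M b\<in>B. lborel). (\<Sum>b\<in>B. t b *\<^sub>R b) \<in> S} \<in> sets (\<Pi>\<^sub>M b\<in>B. lborel)"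
proof -
  have "{t \<in> space (\<Pi>\<^sub>M b\<in>B. lborel). (\<Sum>b\<in>B. t b *\<^sub>R b) \<in> S} =
      (\<lambda>t. \<Sum>b\<in>B. t b *\<^sub>R b) -` S \<inter> space (\<Pi>\<^sub>M b\<in>B. lborel)" by auto
  then show ?thesis using measurable_sets[OF measurable_combination assms] by simp
qed

lemma emeasure_span_measure:
  "S \<in> sets borel \<Longrightarrow> emeasure (span_measure B) S =
     emeasure (\<Pi>\<^sub>M b\<in>B. lborel) {t \<in> space (\<Pi>\<^sub>M b\<in>B. lborel). (\<Sum>b\<in>B. t b *\<^sub>R b) \<in> S}"
  unfolding span_measure_def
  by (subst emeasure_distr) (auto intro!: arg_cong[where f = "emeasure _"])

lemma AE_span_measure: "finite B \<Longrightarrow> AE x in span_measure B. x \<in> span B"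
  unfolding span_measure_def
proof (subst AE_distr_iff)
  show "AE t in \<Pi>\<^sub>M b\<in>B. lborel. (\<Sum>b\<in>B. t b *\<^sub>R b) \<in> span B"
    by (intro AE_I2 span_sum span_scale span_base)
qed (auto intro: borel_closed)

lemma span_measure_affine:
  fixes B :: "'a::euclidean_space set"
  assumes B: "orthonormal B" and v: "v \<in> span B" and \<sigma>: "\<bar>\<sigma>\<bar> = 1"
  shows "distr (span_measure B) borel (\<lambda>x. v + \<sigma> *\<^sub>R x) = span_measure B"
proof -
  let ?M = "\<Pi>\<^sub>M b\<in>B. (lborel :: real measure)" and ?T = "\<lambda>t. \<Sum>b\<in>B. t b *\<^sub>R b"
  let ?f = "\<lambda>t. \<lambda>b\<in>B. v \<bullet> b + \<sigma> * t (id b)"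
  have fin: "finite B" using B by (rule orthonormal_finite)
  have meas: "?f \<in> measurable ?M ?M"
    by (intro measurable_restrict) simp
  have eq: "v + \<sigma> *\<^sub>R ?T t = ?T (?f t)" for t
  proof -
    have "?T (?f t) = (\<Sum>b\<in>B. (v \<bullet> b) *\<^sub>R b + \<sigma> *\<^sub>R (t b *\<^sub>R b))"
      by (intro sum.cong) (auto simp: scaleR_add_left)
    then show ?thesis
      using orthonormal_expansion[OF B v] by (simp add: sum.distrib scaleR_sum_right)
  qed
  have "distr (span_measure B) borel (\<lambda>x. v + \<sigma> *\<^sub>R x) = distr ?M borel (\<lambda>t. v + \<sigma> *\<^sub>R ?T t)"
    unfolding span_measure_def by (subst distr_distr) (auto simp: comp_def)
  also have "\<dots> = distr (distr ?M ?M ?f) borel ?T"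
    unfolding eq by (subst distr_distr[OF measurable_combination meas]) (simp add: comp_def)
  also have "\<dots> = span_measure B"
    using PiM_lborel_affine_reindex[OF fin fin _ \<sigma>, of id "\<lambda>b. v \<bullet> b"] by (simp add: span_measure_def)
  finally show ?thesis .
qed

text \<open>In coordinates the ball lies in a cube and, for positive radius, contains one.\<close>

lemma emeasure_span_measure_ball:
  fixes B :: "'a::euclidean_space set"
  assumes "orthonormal B"
  shows "emeasure (span_measure B) (ball 0 R) < \<infinity>"
    and "R > 0 \<Longrightarrow> emeasure (span_measure B) (ball 0 R) > 0"
proof -
  let ?M = "\<Pi>\<^sub>M b\<in>B. (lborel :: real measure)"
  have fin: "finite B" using assms by (rule orthonormal_finite)
  let ?S = "{t \<in> space ?M. (\<Sum>b\<in>B. t b *\<^sub>R b) \<in> ball 0 R}"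
  have S: "?S \<in> sets ?M"
    by (rule sets_combination) simp
  have "?S \<subseteq> Pi\<^sub>E B (\<lambda>b. {- R..R})"
  proof
    fix t assume t: "t \<in> ?S"
    have "\<bar>t b\<bar> \<le> R" if "b \<in> B" for b
    proof -
      have "\<bar>t b\<bar> = \<bar>(\<Sum>c\<in>B. t c *\<^sub>R c) \<bullet> b\<bar>" using orthonormal_coordinate[OF assms that, of t] by simp
      also have "\<dots> \<le> norm (\<Sum>c\<in>B. t c *\<^sub>R c) * norm b" by (rule Cauchy_Schwarz_ineq2)
      also have "\<dots> \<le> R" using t that assms by (simp add: orthonormal_def)
      finally show ?thesis .
    qed
    then show "t \<in> Pi\<^sub>E B (\<lambda>b. {- R..R})" using t by (auto simp: space_PiM PiE_iff abs_le_iff minus_le_iff)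
  qed
  then have "emeasure ?M ?S \<le> emeasure ?M (Pi\<^sub>E B (\<lambda>b. {- R..R}))"
    using fin by (intro emeasure_mono) (auto intro!: sets_PiM_I_finite)
  also have "\<dots> = (\<Prod>b\<in>B. emeasure lborel {- R..R})"
    using fin by (intro lborel_product.emeasure_PiM) auto
  also have "\<dots> < \<infinity>"
    by (cases "- R \<le> R") (auto simp: ennreal_power less_top[symmetric] power_eq_top_ennreal)
  finally show "emeasure (span_measure B) (ball 0 R) < \<infinity>"
    by (subst emeasure_span_measure) auto
  assume R: "R > 0"
  \<comment> \<open>The \<open>+ 1\<close> makes the estimate of the norm by the sum of the
    coordinates strict and covers empty \<open>B\<close>.\<close>
  define d where "d = R / (real (card B) + 1)"
  have d: "d > 0" using R by (simp add: d_def)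
  have "Pi\<^sub>E B (\<lambda>b. {- d..d}) \<subseteq> ?S"
  proof
    fix t assume t: "t \<in> Pi\<^sub>E B (\<lambda>b. {- d..d})"
    have "norm (\<Sum>b\<in>B. t b *\<^sub>R b) \<le> (\<Sum>b\<in>B. norm (t b *\<^sub>R b))" by (rule norm_sum)
    also have "\<dots> \<le> (\<Sum>b\<in>B. d)"
      using t assms by (intro sum_mono) (auto simp: orthonormal_def PiE_iff abs_le_iff minus_le_iff)
    also have "\<dots> < R" using R by (simp add: d_def field_simps)
    finally show "t \<in> ?S" using t by (auto simp: space_PiM PiE_iff)
  qed
  then have "emeasure ?M (Pi\<^sub>E B (\<lambda>b. {- d..d})) \<le> emeasure ?M ?S"
    using S by (intro emeasure_mono)
  moreover have "emeasure ?M (Pi\<^sub>E B (\<lambda>b. {- d..d})) = (\<Prod>b\<in>B. emeasure lborel {- d..d})"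
    using fin by (intro lborel_product.emeasure_PiM) auto
  moreover have "(\<Prod>b\<in>B. emeasure lborel {- d..d}) > 0"
    using d by (simp add: ennreal_power)
  ultimately have "emeasure ?M ?S > 0" by simp
  then show "emeasure (span_measure B) (ball 0 R) > 0"
    by (subst emeasure_span_measure) auto
qed

lemma sigma_finite_span_measure:
  assumes "orthonormal B"
  shows "sigma_finite_measure (span_measure B)"
proof
  show "\<exists>A. countable A \<and> A \<subseteq> sets (span_measure B) \<and> \<Union>A = space (span_measure B) \<and>
      (\<forall>a\<in>A. emeasure (span_measure B) a \<noteq> \<infinity>)"
  proof (intro exI[of _ "range (\<lambda>k::nat. ball 0 (real k))"] conjI)
    show "\<Union>(range (\<lambda>k::nat. ball 0 (real k))) = space (span_measure B)"
      by (auto simp: reals_Archimedean2)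
    show "\<forall>a\<in>range (\<lambda>k::nat. ball 0 (real k)). emeasure (span_measure B) a \<noteq> \<infinity>"
      using emeasure_span_measure_ball(1)[OF assms] by (auto simp: less_top)
  qed auto
qed

text \<open>The norm is the same function of the coordinates, the root of the sum of squares, for
  every orthonormal basis. Hence a bijection of the bases can take the place of a rotation.\<close>

lemma emeasure_span_measure_ball_eq:
  assumes "orthonormal B" "orthonormal B'" "span B = span B'"
  shows "emeasure (span_measure B) (ball 0 R) = emeasure (span_measure B') (ball 0 R)"
proof -
  let ?M = "\<lambda>B. \<Pi>\<^sub>M b\<in>B. (lborel :: real measure)"
  have fin: "finite B" "finite B'" using assms orthonormal_finite by auto
  have "card B = card B'"
    using assms by (metis orthonormal_independent dim_span dim_eq_card_independent)
  then obtain \<pi> where \<pi>: "bij_betw \<pi> B' B" using finite_same_card_bij[OF fin(2,1)] by auto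
  let ?f = "\<lambda>t. \<lambda>b\<in>B'. 0 + 1 * t (\<pi> b)"
  have \<pi>B: "\<pi> b \<in> B" if "b \<in> B'" for b using \<pi> that by (auto simp: bij_betw_def)
  have meas: "?f \<in> measurable (?M B) (?M B')"
    by (intro measurable_restrict) (use \<pi>B in simp)
  have nrm: "norm (\<Sum>b\<in>B'. ?f t b *\<^sub>R b) = norm (\<Sum>b\<in>B. t b *\<^sub>R b)" for t
  proof -
    have "(norm (\<Sum>b\<in>B'. ?f t b *\<^sub>R b))\<^sup>2 = (\<Sum>b\<in>B'. (t (\<pi> b))\<^sup>2)"
      by (simp only: orthonormal_norm[OF assms(2)]) (intro sum.cong, auto)
    also have "\<dots> = (\<Sum>b\<in>B. (t b)\<^sup>2)" by (rule sum.reindex_bij_betw[OF \<pi>])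
    also have "\<dots> = (norm (\<Sum>b\<in>B. t b *\<^sub>R b))\<^sup>2" by (rule orthonormal_norm[OF assms(1), symmetric])
    finally show ?thesis by (simp add: power2_eq_iff_nonneg)
  qed
  let ?S = "{t \<in> space (?M B'). (\<Sum>b\<in>B'. t b *\<^sub>R b) \<in> ball 0 R}"
  have "emeasure (span_measure B') (ball 0 R) = emeasure (?M B') ?S"
    by (rule emeasure_span_measure) simp
  also have "\<dots> = emeasure (distr (?M B) (?M B') ?f) ?S"
    using PiM_lborel_affine_reindex[OF fin \<pi>, of 1 "\<lambda>_. 0"] by simp
  also have "\<dots> = emeasure (?M B) (?f -` ?S \<inter> space (?M B))"
    by (intro emeasure_distr meas sets_combination) simp
  also have "?f -` ?S \<inter> space (?M B) = {t \<in> space (?M B). (\<Sum>b\<in>B. t b *\<^sub>R b) \<in> ball 0 R}"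
    using nrm measurable_space[OF meas] by auto
  also have "emeasure (?M B) \<dots> = emeasure (span_measure B) (ball 0 R)"
    by (rule emeasure_span_measure[symmetric]) simp
  finally show ?thesis by simp
qed

text \<open>Uniqueness of Haar measure: the integral of \<open>1\<^sub>A(x) 1\<^sub>G(x + y)\<close> over \<open>span B \<times> span B'\<close> is
  evaluated in two ways, using translation invariance of both factors and reflection invariance.\<close>

lemma span_measure_proportional:
  fixes B B' :: "'a::euclidean_space set"
  assumes B: "orthonormal B" "orthonormal B'" "span B = span B'"
    and A: "A \<in> sets borel" "G \<in> sets borel"
  shows "emeasure (span_measure B) A * emeasure (span_measure B') G =
    emeasure (span_measure B) G * emeasure (span_measure B') A"
proof -
  let ?m = "span_measure B" and ?m' = "span_measure B'"
  interpret m: sigma_finite_measure ?m by (rule sigma_finite_span_measure[OF B(1)])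
  interpret m': sigma_finite_measure ?m' by (rule sigma_finite_span_measure[OF B(2)])
  interpret pair_sigma_finite ?m ?m' ..
  note fin = orthonormal_finite[OF B(1)] orthonormal_finite[OF B(2)]
  have inv: "(\<integral>\<^sup>+x. f (v + \<sigma> *\<^sub>R x) \<partial>span_measure C) = (\<integral>\<^sup>+x. f x \<partial>span_measure C)"
    if "orthonormal C" "v \<in> span C" "\<bar>\<sigma>\<bar> = 1" "f \<in> borel_measurable borel" for C v \<sigma> and f :: "'a \<Rightarrow> ennreal"
  proof -
    have "(\<integral>\<^sup>+x. f x \<partial>span_measure C) = (\<integral>\<^sup>+x. f x \<partial>distr (span_measure C) borel (\<lambda>x. v + \<sigma> *\<^sub>R x))"
      using span_measure_affine[OF that(1-3)] by simp
    also have "\<dots> = (\<integral>\<^sup>+x. f (v + \<sigma> *\<^sub>R x) \<partial>span_measure C)"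
      using that(4) by (intro nn_integral_distr) auto
    finally show ?thesis by simp
  qed
  have [measurable]: "A \<in> sets borel" "G \<in> sets borel" by fact+
  have "emeasure ?m A * emeasure ?m' G = (\<integral>\<^sup>+x. indicator A x * emeasure ?m' G \<partial>?m)"
    by (simp add: nn_integral_multc)
  also have "\<dots> = (\<integral>\<^sup>+x. (\<integral>\<^sup>+y. indicator A x * indicator G (x + y) \<partial>?m') \<partial>?m)"
  proof (rule nn_integral_cong_AE)
    show "AE x in ?m. indicator A x * emeasure ?m' G = (\<integral>\<^sup>+y. indicator A x * indicator G (x + y) \<partial>?m')"
      using AE_span_measure[OF fin(1)]
    proof eventually_elim
      case (elim x)
      then have "(\<integral>\<^sup>+y. indicator G (x + 1 *\<^sub>R y) \<partial>?m') = (\<integral>\<^sup>+y. indicator G y \<partial>?m')"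
        using B by (intro inv) auto
      then show ?case by (simp add: nn_integral_cmult)
    qed
  qed
  also have "\<dots> = (\<integral>\<^sup>+y. (\<integral>\<^sup>+x. indicator A x * indicator G (x + y) \<partial>?m) \<partial>?m')"
    by (rule Fubini'[symmetric]) measurable
  also have "\<dots> = (\<integral>\<^sup>+y. (\<integral>\<^sup>+x. indicator A (x - y) * indicator G x \<partial>?m) \<partial>?m')"
  proof (rule nn_integral_cong_AE)
    show "AE y in ?m'. (\<integral>\<^sup>+x. indicator A x * indicator G (x + y) \<partial>?m) =
        (\<integral>\<^sup>+x. indicator A (x - y) * indicator G x \<partial>?m)"
      using AE_span_measure[OF fin(2)]
    proof eventually_elim
      case (elim y)
      have "(\<integral>\<^sup>+x. indicator A (y + 1 *\<^sub>R x - y) * indicator G (y + 1 *\<^sub>R x) \<partial>?m) =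
        (\<integral>\<^sup>+x. indicator A (x - y) * indicator G x \<partial>?m)"
        using B elim by (intro inv[of B y 1 "\<lambda>x. indicator A (x - y) * indicator G x"]) auto
      then show ?case by (simp add: add.commute)
    qed
  qed
  also have "\<dots> = (\<integral>\<^sup>+x. (\<integral>\<^sup>+y. indicator A (x - y) * indicator G x \<partial>?m') \<partial>?m)"
    by (rule Fubini') measurable
  also have "\<dots> = (\<integral>\<^sup>+x. indicator G x * emeasure ?m' A \<partial>?m)"
  proof (rule nn_integral_cong_AE)
    show "AE x in ?m. (\<integral>\<^sup>+y. indicator A (x - y) * indicator G x \<partial>?m') = indicator G x * emeasure ?m' A"
      using AE_span_measure[OF fin(1)]
    proof eventually_elim
      case (elim x)
      then have "(\<integral>\<^sup>+y. indicator A (x + (- 1) *\<^sub>R y) \<partial>?m') = (\<integral>\<^sup>+y. indicator A y \<partial>?m')"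
        using B by (intro inv) auto
      moreover have "(\<integral>\<^sup>+y. indicator A (x - y) * indicator G x \<partial>?m') =
          (\<integral>\<^sup>+y. indicator A (x - y) \<partial>?m') * indicator G x"
        by (rule nn_integral_multc) measurable
      ultimately show ?case by (simp add: mult.commute)
    qed
  qed
  also have "\<dots> = emeasure ?m G * emeasure ?m' A"
    by (simp add: nn_integral_multc)
  finally show ?thesis .
qed

text \<open>\<open>span_measure_proportional\<close> with the unit ball for \<open>G\<close>: the
  ball has the same positive finite mass for both measures, and this mass cancels.\<close>

lemma span_measure_cong:
  fixes B B' :: "'a::euclidean_space set"
  assumes "orthonormal B" "orthonormal B'" "span B = span B'"
  shows "span_measure B = span_measure B'"
proof (rule measure_eqI)
  fix A assume A: "A \<in> sets (span_measure B)"
  let ?c = "emeasure (span_measure B) (ball 0 1)"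
  have "emeasure (span_measure B) A * ?c = ?c * emeasure (span_measure B') A"
    using span_measure_proportional[OF assms, of A "ball 0 1"] A emeasure_span_measure_ball_eq[OF assms, of 1] by simp
  moreover have "?c \<noteq> 0" "?c \<noteq> \<infinity>"
    using emeasure_span_measure_ball[OF assms(1), of 1] by auto
  ultimately show "emeasure (span_measure B) A = emeasure (span_measure B') A"
    by (auto simp: mult.commute[of _ ?c] ennreal_mult_cancel_left infinity_ennreal_def)
qed simp

text \<open>The \<open>SOME\<close> term is the one in \<open>flat_volume\<close>, so both use the
  same frame; \<open>flat_measure_frame\<close> then allows any other frame.\<close>

definition flat_measure :: "'a::euclidean_space set \<Rightarrow> 'a measure" where
  "flat_measure V = (let (p, B) = SOME (p, B). pairwise orthogonal B \<and> (\<forall>b\<in>B. norm b = 1) \<and>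
                                V = (\<lambda>x. p + x) ` span B
      in distr (span_measure B) borel ((+) p))"

lemma flat_frame:
  fixes V :: "'a::euclidean_space set"
  assumes "affine V" "V \<noteq> {}"
  obtains p B where "(SOME (p, B). pairwise orthogonal B \<and> (\<forall>b\<in>B. norm b = 1) \<and>
      V = (\<lambda>x. p + x) ` span B) = (p, B)" "orthonormal B" "V = (+) p ` span B"
proof -
  let ?P = "\<lambda>(p, B). pairwise orthogonal B \<and> (\<forall>b\<in>B. norm b = 1) \<and> V = (\<lambda>x. p + x) ` span B"
  obtain q where q: "q \<in> V" using assms(2) by blast
  have "subspace ((+) (- q) ` V)" using affine_diffs_subspace[OF assms(1) q] .
  then obtain C where C: "pairwise orthogonal C" "\<And>x. x \<in> C \<Longrightarrow> norm x = 1" "span C = (+) (- q) ` V"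
    using orthonormal_basis_subspace by metis
  have "V = (\<lambda>x. q + x) ` span C" unfolding C(3) by (simp add: image_image)
  then have "?P (q, C)" using C by simp
  then have P: "?P (Eps ?P)" by (rule someI)
  obtain p B where pB: "Eps ?P = (p, B)" by force
  show ?thesis
    using that[OF pB] P unfolding pB orthonormal_def by simp
qed

lemma sets_flat_measure [simp, measurable_cong]: "sets (flat_measure V) = sets borel"
  and space_flat_measure [simp]: "space (flat_measure V) = UNIV"
  by (simp_all add: flat_measure_def Let_def case_prod_beta)

text \<open>A change of basis is covered by \<open>span_measure_cong\<close>. A change of origin is
  a vector \<open>u\<close> of the direction space, absorbed by translation invariance.\<close>

lemma flat_measure_frame:
  fixes V :: "'a::euclidean_space set"
  assumes "affine V" "V \<noteq> {}" "orthonormal B" "V = (+) p ` span B"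
  shows "flat_measure V = distr (span_measure B) borel ((+) p)"
proof -
  obtain q C where qC: "(SOME (p, B). pairwise orthogonal B \<and> (\<forall>b\<in>B. norm b = 1) \<and>
      V = (\<lambda>x. p + x) ` span B) = (q, C)" "orthonormal C" "V = (+) q ` span C"
    using flat_frame[OF assms(1,2)] .
  have "q \<in> V" "p \<in> V" using qC(3) assms(4) span_zero by force+
  then obtain u where u: "u \<in> span B" "q = p + u" using assms(4) by blast
  have "span C = (+) (- q) ` V" unfolding qC(3) by (simp add: image_image)
  also have "\<dots> = span B"
  proof -
    have "(+) (- q) ` V = (\<lambda>x. x - u) ` span B" unfolding assms(4) u(2) by (simp add: image_image algebra_simps)
    also have "\<dots> = span B"
    proof (intro equalityI subsetI)
      fix x assume "x \<in> span B"
      then have "x = (x + u) - u" "x + u \<in> span B" using u by (auto intro: span_add)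
      then show "x \<in> (\<lambda>x. x - u) ` span B" by blast
    qed (use u in \<open>auto intro: span_diff\<close>)
    finally show ?thesis .
  qed
  finally have sp: "span C = span B" .
  have "flat_measure V = distr (span_measure C) borel ((+) q)"
    unfolding flat_measure_def qC(1) by simp
  also have "\<dots> = distr (span_measure B) borel ((+) q)"
    using span_measure_cong[OF qC(2) assms(3) sp] by simp
  also have "\<dots> = distr (distr (span_measure B) borel (\<lambda>x. u + 1 *\<^sub>R x)) borel ((+) p)"
  proof -
    have "(+) q = (\<lambda>x. p + (u + 1 *\<^sub>R x))" by (auto simp: u(2) add.assoc)
    then show ?thesis by (subst distr_distr) (auto simp: comp_def)
  qed
  also have "\<dots> = distr (span_measure B) borel ((+) p)"
    using span_measure_affine[OF assms(3) u(1), of 1] by simp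
  finally show ?thesis .
qed

lemma flat_volume_eq:
  fixes V :: "'a::euclidean_space set"
  assumes "affine V" "V \<noteq> {}" "S \<in> sets borel"
  shows "flat_volume V S = measure (flat_measure V) S"
proof -
  obtain p B where pB: "(SOME (p, B). pairwise orthogonal B \<and> (\<forall>b\<in>B. norm b = 1) \<and>
      V = (\<lambda>x. p + x) ` span B) = (p, B)" "orthonormal B" "V = (+) p ` span B"
    using flat_frame[OF assms(1,2)] .
  have "measure (flat_measure V) S = measure (distr (\<Pi>\<^sub>M b\<in>B. lborel) borel (\<lambda>t. p + (\<Sum>b\<in>B. t b *\<^sub>R b))) S"
    unfolding flat_measure_frame[OF assms(1,2) pB(2,3)] span_measure_def
    by (subst distr_distr) (auto simp: comp_def)
  also have "\<dots> = measure (\<Pi>\<^sub>M b\<in>B. lborel) {t \<in> space (\<Pi>\<^sub>M b\<in>B. lborel). p + (\<Sum>b\<in>B. t b *\<^sub>R b) \<in> S}"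
    using assms(3) by (subst measure_distr) (auto intro!: arg_cong[where f = "measure _"])
  finally show ?thesis unfolding flat_volume_def pB(1) by simp
qed

lemma flat_measure_translate:
  fixes V :: "'a::euclidean_space set"
  assumes "affine V" "V \<noteq> {}"
  shows "flat_measure ((+) l ` V) = distr (flat_measure V) borel ((+) l)"
proof -
  obtain p B where pB: "orthonormal B" "V = (+) p ` span B"
    using flat_frame[OF assms] by metis
  have "affine ((+) l ` V)" using assms(1) affine_translation by blast
  then have "flat_measure ((+) l ` V) = distr (span_measure B) borel ((+) (l + p))"
    using assms pB by (intro flat_measure_frame) (auto simp: image_image add.assoc)
  also have "\<dots> = distr (flat_measure V) borel ((+) l)"
  proof -
    have "(+) (l + p) = (\<lambda>x. l + (p + x))" by (auto simp: add.assoc)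
    then show ?thesis
      unfolding flat_measure_frame[OF assms pB] by (subst distr_distr) (auto simp: comp_def)
  qed
  finally show ?thesis .
qed

lemma AE_flat_measure:
  fixes V :: "'a::euclidean_space set"
  assumes "affine V" "V \<noteq> {}"
  shows "AE x in flat_measure V. x \<in> V"
proof -
  obtain p B where pB: "orthonormal B" "V = (+) p ` span B"
    using flat_frame[OF assms] by metis
  have V: "V \<in> sets borel" using assms(1) by (simp add: affine_closed borel_closed)
  show ?thesis
    unfolding flat_measure_frame[OF assms pB]
  proof (subst AE_distr_iff)
    show "AE x in span_measure B. p + x \<in> V"
      using AE_span_measure[OF orthonormal_finite[OF pB(1)]] by eventually_elim (simp add: pB(2))
  qed (use V in auto)
qed

lemma flat_measure_bounded:
  fixes V :: "'a::euclidean_space set"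
  assumes "affine V" "V \<noteq> {}" "bounded S"
  shows "emeasure (flat_measure V) S < \<infinity>"
proof -
  obtain p B where pB: "orthonormal B" "V = (+) p ` span B"
    using flat_frame[OF assms(1,2)] by metis
  obtain R where R: "S \<subseteq> ball 0 R" using bounded_subset_ballD[OF assms(3), of 0] by blast
  have "emeasure (flat_measure V) S \<le> emeasure (flat_measure V) (ball 0 R)"
    using R by (intro emeasure_mono) auto
  also have "\<dots> = emeasure (span_measure B) ((+) p -` ball 0 R)"
    unfolding flat_measure_frame[OF assms(1,2) pB] by (subst emeasure_distr) auto
  also have "\<dots> \<le> emeasure (span_measure B) (ball 0 (R + norm p))"
  proof (intro emeasure_mono subsetI)
    fix x assume "x \<in> (+) p -` ball 0 R"
    then show "x \<in> ball 0 (R + norm p)" using norm_triangle_ineq4[of "p + x" p] by simp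
  qed auto
  also have "\<dots> < \<infinity>" by (rule emeasure_span_measure_ball(1)[OF pB(1)])
  finally show ?thesis .
qed

lemma flat_measure_ball_pos:
  fixes V :: "'a::euclidean_space set"
  assumes "affine V" "v \<in> V" "e > 0"
  shows "emeasure (flat_measure V) (ball v e) > 0"
proof -
  have ne: "V \<noteq> {}" using assms by blast
  have "subspace ((+) (- v) ` V)" using affine_diffs_subspace[OF assms(1,2)] .
  then obtain C where C: "pairwise orthogonal C" "\<And>x. x \<in> C \<Longrightarrow> norm x = 1" "span C = (+) (- v) ` V"
    using orthonormal_basis_subspace by metis
  have "V = (+) v ` span C" unfolding C(3) by (simp add: image_image)
  moreover have C': "orthonormal C" using C by (simp add: orthonormal_def)
  ultimately have "flat_measure V = distr (span_measure C) borel ((+) v)"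
    using flat_measure_frame[OF assms(1) ne] by blast
  then have "emeasure (flat_measure V) (ball v e) = emeasure (span_measure C) ((+) v -` ball v e)"
    by (simp add: emeasure_distr)
  also have "(+) v -` ball v e = ball 0 e" by (auto simp: dist_norm)
  finally show ?thesis using emeasure_span_measure_ball(2)[OF C' assms(3)] by simp
qed

text \<open>Fubini in a coordinate \<open>i\<close> with \<open>a \<bullet> i \<noteq> 0\<close>:
  each line in that direction meets the hyperplane in one point. If there is no such coordinate, the
  functional is constant on \<open>V\<close> and its value is not \<open>c\<close>.\<close>

lemma AE_flat_measure_hyperplane:
  fixes V :: "'a::euclidean_space set"
  assumes "affine V" "V \<noteq> {}" "\<not> V \<subseteq> {x. a \<bullet> x = c}"
  shows "AE x in flat_measure V. a \<bullet> x \<noteq> c"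
proof -
  obtain p B where pB: "orthonormal B" "V = (+) p ` span B"
    using flat_frame[OF assms(1,2)] by metis
  have fin: "finite B" using pB(1) by (rule orthonormal_finite)
  let ?M = "\<lambda>B. \<Pi>\<^sub>M b\<in>B. (lborel :: real measure)"
  have meas [measurable]: "(\<lambda>t. a \<bullet> p + (\<Sum>b\<in>B. t b * (a \<bullet> b))) \<in> borel_measurable (?M B)"
    by (intro borel_measurable_sum borel_measurable_times borel_measurable_add borel_measurable_const
        measurable_coordinate)
  have lin: "a \<bullet> (p + (\<Sum>b\<in>B. t b *\<^sub>R b)) = a \<bullet> p + (\<Sum>b\<in>B. t b * (a \<bullet> b))" for t
    by (simp add: inner_add_right inner_sum_right)
  have main: "AE t in ?M B. a \<bullet> p + (\<Sum>b\<in>B. t b * (a \<bullet> b)) \<noteq> c"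
  proof (cases "\<forall>b\<in>B. a \<bullet> b = 0")
    case True
    have "a \<bullet> p \<noteq> c"
    proof
      assume ap: "a \<bullet> p = c"
      have "a \<bullet> x = 0" if "x \<in> span B" for x
        using that True by (induction rule: span_induct_alt) (auto simp: inner_add_right)
      then have "V \<subseteq> {x. a \<bullet> x = c}" using pB(2) ap by (auto simp: inner_add_right)
      then show False using assms(3) by blast
    qed
    then show ?thesis using True by simp
  next
    case False
    then obtain i where i: "i \<in> B" "a \<bullet> i \<noteq> 0" by blast
    define I where "I = B - {i}"
    have I: "B = insert i I" "i \<notin> I" "finite I" using i fin by (auto simp: I_def)
    let ?N = "{t \<in> space (?M B). a \<bullet> p + (\<Sum>b\<in>B. t b * (a \<bullet> b)) = c}"
    have N: "?N \<in> sets (?M B)" by measurable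
    have "emeasure (?M B) ?N = (\<integral>\<^sup>+t. indicator ?N t \<partial>?M B)" using N by simp
    also have "\<dots> = (\<integral>\<^sup>+ t. (\<integral>\<^sup>+ y. indicator ?N (t(i := y)) \<partial>lborel) \<partial>?M I)"
      using N unfolding I(1) by (intro lborel_product.product_nn_integral_insert I(2,3)) auto
    also have "\<dots> = (\<integral>\<^sup>+ t. 0 \<partial>?M I)"
    proof (rule nn_integral_cong)
      fix t assume "t \<in> space (?M I)"
      define y0 where "y0 = (c - a \<bullet> p - (\<Sum>b\<in>I. t b * (a \<bullet> b))) / (a \<bullet> i)"
      have "indicator ?N (t(i := y)) \<le> (indicator {y0} y :: ennreal)" for y
      proof (cases "t(i := y) \<in> ?N")
        case True
        have "(\<Sum>b\<in>I. (t(i := y)) b * (a \<bullet> b)) = (\<Sum>b\<in>I. t b * (a \<bullet> b))"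
          using I(2) by (intro sum.cong) auto
        then have "a \<bullet> p + (y * (a \<bullet> i) + (\<Sum>b\<in>I. t b * (a \<bullet> b))) = c"
          using True I by simp
        then have "y = y0" using i(2) by (simp add: y0_def field_simps)
        then show ?thesis using True by simp
      qed simp
      then have "(\<integral>\<^sup>+ y. indicator ?N (t(i := y)) \<partial>lborel) \<le> (\<integral>\<^sup>+ y. indicator {y0} y \<partial>lborel)"
        by (intro nn_integral_mono)
      also have "\<dots> = 0" by simp
      finally show "(\<integral>\<^sup>+ y. indicator ?N (t(i := y)) \<partial>lborel) = 0" by simp
    qed
    finally have "emeasure (?M B) ?N = 0" by simp
    then have "?N \<in> null_sets (?M B)" using N by (simp add: null_sets_def)
    then show ?thesis by (intro AE_I'[of ?N]) auto
  qed
  have "flat_measure V = distr (?M B) borel (\<lambda>t. p + (\<Sum>b\<in>B. t b *\<^sub>R b))"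
    unfolding flat_measure_frame[OF assms(1,2) pB] span_measure_def
    by (subst distr_distr) (auto simp: comp_def)
  moreover have "AE x in distr (?M B) borel (\<lambda>t. p + (\<Sum>b\<in>B. t b *\<^sub>R b)). a \<bullet> x \<noteq> c"
  proof (subst AE_distr_iff)
    show "AE t in ?M B. a \<bullet> (p + (\<Sum>b\<in>B. t b *\<^sub>R b)) \<noteq> c" unfolding lin by (rule main)
    show "{x \<in> space borel. a \<bullet> x \<noteq> c} \<in> sets borel"
      by (auto intro!: borel_open open_Collect_neq continuous_intros)
  qed measurable
  ultimately show ?thesis by (simp only:)
qed

section \<open>Flag weights\<close>

lemma is_lattice_group:
  assumes "is_lattice L"
  shows "0 \<in> L" "x \<in> L \<Longrightarrow> y \<in> L \<Longrightarrow> x + y \<in> L" "x \<in> L \<Longrightarrow> - x \<in> L" "x \<in> L \<Longrightarrow> y \<in> L \<Longrightarrow> x - y \<in> L"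
  using assms unfolding is_lattice_def by (auto intro: group_closure_add group_closure.diff)

text \<open>Coordinates with respect to the generating basis are linear, hence bounded on balls, and
  they are integers on the lattice.\<close>

lemma is_lattice_finite:
  fixes L :: "'a::euclidean_space set"
  assumes "is_lattice L"
  shows "finite {l\<in>L. norm l \<le> R}"
proof -
  obtain B where B: "independent B" "card B = DIM('a)" "L = group_closure B"
    using assms unfolding is_lattice_def by blast
  have fin: "finite B" using B(1) by (rule independent_imp_finite)
  have "UNIV \<subseteq> span B" using B by (intro card_ge_dim_independent) auto
  then have sp: "span B = UNIV" by auto
  let ?r = "\<lambda>b v. representation B v b"
  have lin: "linear (?r b)" for b
    by (rule linearI) (simp_all add: representation_add[OF B(1)] representation_scale[OF B(1)] sp)
  have int: "?r b l \<in> \<int>" if "l \<in> L" for l b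
    using that unfolding B(3)
  proof induction
    case (base s)
    then show ?case
      using B(1) by (auto simp: representation_zero representation_basis)
  next
    case (diff s t)
    then show ?case using linear_diff[OF lin] by simp
  qed
  have "\<exists>N::int. \<forall>l. norm l \<le> R \<longrightarrow> \<bar>?r b l\<bar> \<le> of_int N" for b
  proof -
    obtain K where K: "K > 0" "\<And>v. norm (?r b v) \<le> K * norm v"
      using linear_bounded_pos[OF lin] by blast
    have "\<bar>?r b l\<bar> \<le> of_int \<lceil>K * R\<rceil>" if "norm l \<le> R" for l
    proof -
      have "\<bar>?r b l\<bar> \<le> K * norm l" using K(2)[of l] by simp
      also have "\<dots> \<le> K * R" using that K(1) by simp
      finally show ?thesis by linarith
    qed
    then show ?thesis by blast
  qed
  then obtain N :: "'a \<Rightarrow> int" where N: "\<And>b l. norm l \<le> R \<Longrightarrow> \<bar>?r b l\<bar> \<le> of_int (N b)" by metis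
  have "{l\<in>L. norm l \<le> R} \<subseteq> (\<lambda>z. \<Sum>b\<in>B. real_of_int (z b) *\<^sub>R b) ` (\<Pi>\<^sub>E b\<in>B. {- N b..N b})"
  proof
    fix l assume l: "l \<in> {l\<in>L. norm l \<le> R}"
    have z: "?r b l = of_int \<lfloor>?r b l\<rfloor>" for b using int[of l b] l by simp
    have "\<lfloor>?r b l\<rfloor> \<in> {- N b..N b}" for b
    proof -
      have "\<bar>of_int \<lfloor>?r b l\<rfloor> :: real\<bar> \<le> of_int (N b)" using N[of l b] l z[of b] by simp
      then show ?thesis by (simp add: abs_le_iff)
    qed
    then have "(\<lambda>b\<in>B. \<lfloor>?r b l\<rfloor>) \<in> (\<Pi>\<^sub>E b\<in>B. {- N b..N b})" by auto
    moreover have "l = (\<Sum>b\<in>B. real_of_int ((\<lambda>b\<in>B. \<lfloor>?r b l\<rfloor>) b) *\<^sub>R b)"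
    proof -
      have "(\<Sum>b\<in>B. ?r b l *\<^sub>R b) = l"
        using sp by (intro sum_representation_eq[OF B(1) _ fin order_refl]) auto
      moreover have "(\<Sum>b\<in>B. ?r b l *\<^sub>R b) = (\<Sum>b\<in>B. real_of_int ((\<lambda>b\<in>B. \<lfloor>?r b l\<rfloor>) b) *\<^sub>R b)"
        using z by (intro sum.cong) auto
      ultimately show ?thesis by simp
    qed
    ultimately show "l \<in> (\<lambda>z. \<Sum>b\<in>B. real_of_int (z b) *\<^sub>R b) ` (\<Pi>\<^sub>E b\<in>B. {- N b..N b})" by blast
  qed
  moreover have "finite ((\<lambda>z. \<Sum>b\<in>B. real_of_int (z b) *\<^sub>R b) ` (\<Pi>\<^sub>E b\<in>B. {- N b..N b}))"
    using fin by (intro finite_imageI finite_PiE) auto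
  ultimately show ?thesis by (rule finite_subset)
qed

section \<open>Arrangements of a polytope and the flats that carry its faces\<close>

context flat_cut
begin

text \<open>If \<open>n\<close> were parallel to all hyperplanes through a generic point \<open>x\<close> of the region, then \<open>G\<close> would
  look the same at \<open>x + s n\<close> and \<open>x - s n\<close>.\<close>

lemma region_saturated:
  assumes H: "finite H" and sat: "saturated H W" "saturated H G" and ne: "facet_region V G P \<noteq> {}"
  shows "saturated H V" "saturated H P"
proof -
  obtain x0 where x0: "x0 \<in> V" "locally_coincide x0 G P" using ne by blast
  obtain e where e: "e > 0" "\<And>y. dist x0 y < e \<Longrightarrow> locally_coincide y G P"
    using locally_coincide_near[OF x0(2)] by blast
  obtain x where x: "generic_in H V x" "dist x0 x < e"
    using generic_in_dense[OF H affV x0(1) e(1)] by blast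
  have xV: "x \<in> W" "a \<bullet> x = b" using generic_inD[OF x(1)] V by auto
  obtain e' where e': "e' > 0" "ball x e' \<inter> G = ball x e' \<inter> P"
    using e(2)[OF x(2)] unfolding locally_coincide_def by blast
  have "\<exists>(\<alpha>, \<beta>)\<in>H. \<alpha> \<bullet> x = \<beta> \<and> \<alpha> \<bullet> n \<noteq> 0"
  proof (rule ccontr)
    assume *: "\<not> ?thesis"
    obtain d where d: "d > 0" "\<And>z \<alpha> \<beta>. norm z < d \<Longrightarrow> (\<alpha>, \<beta>) \<in> H \<Longrightarrow>
      sgn (\<alpha> \<bullet> (x + z) - \<beta>) = (if \<alpha> \<bullet> x = \<beta> then sgn (\<alpha> \<bullet> z) else sgn (\<alpha> \<bullet> x - \<beta>))"
      using local_signs[OF H, of x] by blast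
    obtain s where s: "s > 0" "dist x (x + s *\<^sub>R n) < min d e'"
      using ray_near[of "min d e'" x n] d e' by auto
    have s': "norm (s *\<^sub>R n) < d" "norm ((- s) *\<^sub>R n) < d" using s by (auto simp: dist_norm)
    have "same_side H (x + s *\<^sub>R n) (x + (- s) *\<^sub>R n)"
      unfolding same_side_def
    proof clarify
      fix \<alpha> \<beta> assume h: "(\<alpha>, \<beta>) \<in> H"
      have "\<alpha> \<bullet> n = 0" if "\<alpha> \<bullet> x = \<beta>" using * h that by blast
      then show "sgn (\<alpha> \<bullet> (x + s *\<^sub>R n) - \<beta>) = sgn (\<alpha> \<bullet> (x + (- s) *\<^sub>R n) - \<beta>)"
        unfolding d(2)[OF s'(1) h] d(2)[OF s'(2) h] by simp
    qed
    then have iff: "x + s *\<^sub>R n \<in> G \<longleftrightarrow> x + (- s) *\<^sub>R n \<in> G" by (rule saturated_iff[OF sat(2)])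
    have "x + s *\<^sub>R n \<in> ball x e' \<inter> P"
      using s dir[OF xV(1)] xV pos by (auto simp: P inner_add_right)
    moreover have "x + (- s) *\<^sub>R n \<in> ball x e'" using s by (simp add: dist_norm)
    moreover have "x + (- s) *\<^sub>R n \<notin> P"
      using s xV pos by (auto simp: P inner_diff_right not_le)
    ultimately show False using iff e'(2) by blast
  qed
  then obtain \<alpha> \<beta> where h: "(\<alpha>, \<beta>) \<in> H" "\<alpha> \<bullet> x = \<beta>" "\<alpha> \<bullet> n \<noteq> 0" by blast
  define \<kappa> where "\<kappa> = (\<alpha> \<bullet> n) / (a \<bullet> n)"
  have \<kappa>: "\<kappa> \<noteq> 0" using h pos by (simp add: \<kappa>_def)
  have "V \<subseteq> {y. \<alpha> \<bullet> y = \<beta>}" using x(1) h unfolding generic_in_def by blast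
  then have eq: "\<alpha> \<bullet> w - \<beta> = \<kappa> * (a \<bullet> w - b)" if "w \<in> W" for w
    unfolding \<kappa>_def using that pos V by (intro halfplane_proportional[OF dir]) auto
  have "V = W \<inter> {w. \<alpha> \<bullet> w = \<beta>}" using eq \<kappa> V by fastforce
  then show "saturated H V" using sat(1) h(1) by (auto intro: saturated_Int saturated_hyperplane)
  show "saturated H P"
  proof (cases "\<kappa> > 0")
    case True
    have "a \<bullet> w \<ge> b \<longleftrightarrow> \<alpha> \<bullet> w \<ge> \<beta>" if "w \<in> W" for w
      using eq[OF that] True by (smt (verit) mult_nonneg_nonneg mult_pos_neg)
    then have "P = W \<inter> {w. \<alpha> \<bullet> w \<ge> \<beta>}" using P by blast
    then show ?thesis using sat(1) h(1) by (auto intro: saturated_Int saturated_halfspace_ge)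
  next
    case False
    then have "\<kappa> < 0" using \<kappa> by simp
    then have "a \<bullet> w \<ge> b \<longleftrightarrow> \<alpha> \<bullet> w \<le> \<beta>" if "w \<in> W" for w
      using eq[OF that] by (smt (verit) mult_nonpos_nonneg mult_neg_neg)
    then have "P = W \<inter> {w. \<alpha> \<bullet> w \<le> \<beta>}" using P by blast
    then show ?thesis using sat(1) h(1) by (auto intro: saturated_Int saturated_halfspace_le)
  qed
qed

text \<open>A facet in \<open>V\<close> forces a hyperplane of \<open>H\<close> to cut
  \<open>V\<close> out of \<open>W\<close> (\<open>region_saturated\<close>). An arrangement made
  for \<open>G\<close> alone therefore already knows every hyperplane of \<open>W\<close> that
  carries a facet.\<close>

lemma facet_saturated:
  assumes H: "finite H" and sat: "saturated H W" "saturated H G" and hull: "affine hull G = W"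
    and F: "polytope_facet F G" "F \<subseteq> V"
  shows "saturated H V" "saturated H F"
proof -
  interpret m: flat_cut W V N P "- a" "- n" "- b" by (rule mirror)
  have region: "saturated H V \<and> saturated H (closure C)"
    if C: "C \<in> components (facet_region V G K)" and K: "saturated H V" "saturated H K" for C K
  proof -
    have "facet_region V G K = V \<inter> {x. locally_coincide x G K}" by auto
    then have "saturated H (facet_region V G K)"
      using K sat H by (auto intro: saturated_Int saturated_locally_coincide)
    then show ?thesis using K saturated_closure[OF H saturated_components[OF _ C]] by blast
  qed
  have ne: "facet_region V G K \<noteq> {}" if "C \<in> components (facet_region V G K)" for C K
    using in_components_nonempty[OF that] in_components_subset[OF that] by blast
  have "F \<in> closure ` (components (facet_region V G P) \<union> components (facet_region V G N))"
    using F facets_in_cut[OF hull] by blast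
  then consider C where "F = closure C" "C \<in> components (facet_region V G P)"
    | C where "F = closure C" "C \<in> components (facet_region V G N)" by blast
  then have "saturated H V \<and> saturated H F"
  proof cases
    case 1
    then show ?thesis using region[OF 1(2)] region_saturated[OF H sat ne[OF 1(2)]] by blast
  next
    case 2
    then show ?thesis using region[OF 2(2)] m.region_saturated[OF H sat ne[OF 2(2)]] by blast
  qed
  then show "saturated H V" "saturated H F" by auto
qed

end

text \<open>\<open>H0\<close> belongs to \<open>A\<close> alone, whereas the \<open>H\<close> of the
  locale contains the hyperplanes of the flag. The same \<open>H0\<close> thus serves all translates
  of the flag.\<close>

lemma (in flag_arrangement) chain_saturated:
  assumes H0: "finite H0" "saturated H0 A"
  shows "k \<le> DIM('a) \<Longrightarrow> r \<le> k \<Longrightarrow> \<forall>F\<in>face_chains k \<Phi> A. saturated H0 (flat \<Phi> k) \<and> saturated H0 (F k)"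
proof (induction rule: inc_induct)
  case base
  have "F DIM('a) = A" if "F \<in> face_chains DIM('a) \<Phi> A" for F using that unfolding face_chains_def by simp
  moreover have "flat \<Phi> DIM('a) = UNIV" using normals by (simp add: flag_normals_def)
  ultimately show ?case using H0(2) by auto
next
  case (step k)
  have rk: "r \<le> k" "k < DIM('a)" using step by auto
  interpret flat_cut "flat \<Phi> (Suc k)" "flat \<Phi> k" "pos \<Phi> k"
    "{x\<in>flat \<Phi> (Suc k). a k \<bullet> x \<le> b k}" "a k" "n k" "b k"
    using flag_normals_cut[OF normals rk] .
  show ?case
  proof
    fix F assume "F \<in> face_chains k \<Phi> A"
    then obtain F' where F': "F' \<in> face_chains (Suc k) \<Phi> A" "F k \<in> facets_within (flat \<Phi> k) (F' (Suc k))"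
      unfolding face_chains_step(1)[OF rk(2)] by auto
    have "affine hull (F' (Suc k)) = flat \<Phi> (Suc k)"
      using chain_face_properties[of "Suc k"] rk F'(1) by auto
    moreover have "saturated H0 (flat \<Phi> (Suc k))" "saturated H0 (F' (Suc k))"
      using step F'(1) by auto
    ultimately show "saturated H0 (flat \<Phi> k) \<and> saturated H0 (F k)"
      using facet_saturated[OF H0(1)] F'(2) unfolding facets_within_def by blast
  qed
qed

text \<open>Stated for a general measure since it serves both \<open>flat_measure\<close> and
  \<open>lborel\<close>.\<close>

lemma AE_generic_in:
  assumes "finite H" "AE x in M. x \<in> V"
    and hyper: "\<And>a b. \<not> V \<subseteq> {y. a \<bullet> y = b} \<Longrightarrow> AE x in M. a \<bullet> x \<noteq> b"
  shows "AE x in M. generic_in H V x"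
proof -
  have "AE x in M. \<forall>h\<in>H. \<not> V \<subseteq> {y. fst h \<bullet> y = snd h} \<longrightarrow> fst h \<bullet> x \<noteq> snd h"
    using assms(1)
  proof (rule AE_finite_allI)
    fix h assume "h \<in> H"
    show "AE x in M. \<not> V \<subseteq> {y. fst h \<bullet> y = snd h} \<longrightarrow> fst h \<bullet> x \<noteq> snd h"
      using hyper[of "fst h" "snd h"] by (cases "V \<subseteq> {y. fst h \<bullet> y = snd h}") simp_all
  qed
  with assms(2) show ?thesis
  proof eventually_elim
    case (elim x)
    have "V \<subseteq> {y. \<alpha> \<bullet> y = \<beta>}" if "(\<alpha>, \<beta>) \<in> H" "\<alpha> \<bullet> x = \<beta>" for \<alpha> \<beta>
      using bspec[OF elim(2) that(1)] that(2) by auto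
    then show ?case using elim(1) unfolding generic_in_def by blast
  qed
qed

lemma AE_flat_measure_generic:
  fixes V :: "'a::euclidean_space set"
  assumes "affine V" "V \<noteq> {}" "finite H"
  shows "AE x in flat_measure V. generic_in H V x"
  using assms by (intro AE_generic_in AE_flat_measure AE_flat_measure_hyperplane)

text \<open>\<open>chain_sum_generic\<close> is integrated over the bottom flat, almost all of whose
  points are generic. The third part serves to discard the translates of a flag that have no face
  chains.\<close>

lemma flag_weight_integral:
  fixes A :: "'a::euclidean_space set" and \<Phi> :: "'a flag"
  assumes flag: "flag_normals r \<Phi> a b n" "r < DIM('a)" and V: "affine (flat \<Phi> r)" "flat \<Phi> r \<noteq> {}"
    and A: "solid_polytope A"
  shows "integrable (flat_measure (flat \<Phi> r)) (jumps n r DIM('a) (indicator A))"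
    and "flag_weight r \<Phi> A = (\<integral>x. jumps n r DIM('a) (indicator A) x \<partial>flat_measure (flat \<Phi> r))"
    and "face_chains r \<Phi> A = {} \<Longrightarrow> AE x in flat_measure (flat \<Phi> r). jumps n r DIM('a) (indicator A) x = 0"
proof -
  let ?\<mu> = "flat_measure (flat \<Phi> r)" and ?q = "jumps n r DIM('a) (indicator A)"
  have "integrable ?\<mu> ?q \<and> flag_weight r \<Phi> A = (\<integral>x. ?q x \<partial>?\<mu>) \<and> (face_chains r \<Phi> A = {} \<longrightarrow> (AE x in ?\<mu>. ?q x = 0))"
  proof (cases "A = {}")
    case True
    have "indicator A = (\<lambda>x. 0 :: real)" using True by auto
    then have "?q = (\<lambda>x. 0)" using jumps_zero[of r "DIM('a)" n] flag(2) by simp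
    moreover have "face_chains r \<Phi> A = {}" using face_chains_empty[OF flag(2)] True by simp
    ultimately show ?thesis by (simp add: flag_weight_def)
  next
    case False
    obtain H0 where H0: "finite H0" "saturated H0 A" using solid_polytope_saturated[OF A] by blast
    define H where "H = H0 \<union> (\<lambda>j. (a j, b j)) ` {r..<DIM('a)} \<union> (\<lambda>j. (- a j, - b j)) ` {r..<DIM('a)}"
    have finH: "finite H" using H0 by (simp add: H_def)
    have satA: "saturated H A" using H0(2) by (rule saturated_mono) (auto simp: H_def)
    interpret flag_arrangement r \<Phi> a n b H A
      by unfold_locales (use flag finH satA solid_polytope_closed[OF A] solid_polytope_affine_hull[OF A False]
        in \<open>auto simp: H_def\<close>)
    have props: "finite (face_chains r \<Phi> A)" "\<And>F. F \<in> face_chains r \<Phi> A \<Longrightarrow> closed (F r) \<and> F r \<subseteq> A"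
      using chain_face_properties[of r] flag(2) by auto
    let ?s = "\<lambda>F. \<Prod>j\<in>{r..<DIM('a)}. side_sign (pos \<Phi> j) (F j) (F (Suc j))"
    have F: "F r \<in> sets borel" "emeasure ?\<mu> (F r) < \<infinity>" if "F \<in> face_chains r \<Phi> A" for F
      using props(2)[OF that] solid_polytope_bounded[OF A] flat_measure_bounded[OF V]
      by (auto intro: borel_closed bounded_subset)
    have ind: "integrable ?\<mu> (indicator (F r) :: 'a \<Rightarrow> real)" if "F \<in> face_chains r \<Phi> A" for F
      using F[OF that] by (intro integrable_real_indicator) auto
    let ?c = "\<lambda>x. chain_sum r \<Phi> A (\<lambda>F. indicator F x)"
    have int: "integrable ?\<mu> ?c"
      unfolding chain_sum_def using ind by (intro Bochner_Integration.integrable_sum integrable_mult_right) auto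
    have AE: "AE x in ?\<mu>. ?c x = ?q x"
      using AE_flat_measure_generic[OF V finH] by eventually_elim (use chain_sum_generic[of r] flag(2) in simp)
    have sm: "side_measurable H ?q"
      using flag(2) by (intro side_measurable_jumps finH side_measurable_indicator satA) simp
    have q: "?q \<in> borel_measurable ?\<mu>"
      using side_measurable_borel[OF finH sm] by simp
    have cm: "?c \<in> borel_measurable ?\<mu>" using int by simp
    have "integrable ?\<mu> ?q" using int integrable_cong_AE[OF cm q AE] by simp
    moreover have "flag_weight r \<Phi> A = (\<integral>x. ?c x \<partial>?\<mu>)"
    proof -
      have "(\<integral>x. ?c x \<partial>?\<mu>) = (\<Sum>F\<in>face_chains r \<Phi> A. ?s F * (\<integral>x. indicator (F r) x \<partial>?\<mu>))"
        unfolding chain_sum_def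
        by (subst Bochner_Integration.integral_sum) (auto intro!: integrable_mult_right ind)
      also have "\<dots> = (\<Sum>F\<in>face_chains r \<Phi> A. ?s F * flat_volume (flat \<Phi> r) (F r))"
        using F flat_volume_eq[OF V] by (intro sum.cong) auto
      finally show ?thesis by (simp add: flag_weight_def)
    qed
    moreover have "(\<integral>x. ?c x \<partial>?\<mu>) = (\<integral>x. ?q x \<partial>?\<mu>)" by (rule integral_cong_AE[OF cm q AE])
    moreover have "AE x in ?\<mu>. ?q x = 0" if "face_chains r \<Phi> A = {}"
    proof -
      have "?c x = 0" for x unfolding chain_sum_def that by simp
      with AE show ?thesis by simp
    qed
    ultimately show ?thesis by simp
  qed
  then show "integrable ?\<mu> ?q" "flag_weight r \<Phi> A = (\<integral>x. ?q x \<partial>?\<mu>)"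
    "face_chains r \<Phi> A = {} \<Longrightarrow> AE x in ?\<mu>. ?q x = 0" by auto
qed

lemma translate_flag_add: "translate_flag l (translate_flag m \<Phi>) = translate_flag (l + m) \<Phi>"
  by (simp add: translate_flag_def image_image add.assoc)

lemma translate_flag_0 [simp]: "translate_flag 0 \<Phi> = \<Phi>"
  by (simp add: translate_flag_def)

lemma translate_affine_eq:
  fixes V :: "'a::euclidean_space set"
  assumes "affine V" "x \<in> V" "m + x \<in> V"
  shows "(+) m ` V = V"
proof -
  have *: "s *\<^sub>R m + v \<in> V" if "v \<in> V" for v s
    using mem_affine_3_minus[OF assms(1) that assms(3,2), of s] by (simp add: algebra_simps)
  show ?thesis
  proof (intro equalityI subsetI)
    fix v assume "v \<in> (+) m ` V"
    then show "v \<in> V" using *[of _ 1] by auto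
  next
    fix v assume "v \<in> V"
    then have "- m + v \<in> V" "v = m + (- m + v)" using *[of v "- 1"] by auto
    then show "v \<in> (+) m ` V" by blast
  qed
qed

lemma is_flag_flat:
  fixes \<Phi> :: "'a::euclidean_space flag"
  assumes "is_flag r \<Phi>" "r \<le> j" "j \<le> DIM('a)"
  shows "affine (flat \<Phi> j)" "flat \<Phi> j \<noteq> {}" "flat \<Phi> r \<subseteq> flat \<Phi> j"
proof -
  have "affine (flat \<Phi> j) \<and> aff_dim (flat \<Phi> j) = int j"
    using assms unfolding is_flag_def by simp
  then show "affine (flat \<Phi> j)" "flat \<Phi> j \<noteq> {}" by auto
  show "flat \<Phi> r \<subseteq> flat \<Phi> j"
    using assms(2,3)
  proof (induction rule: dec_induct)
    case (step k)
    then have "flat \<Phi> k \<subseteq> flat \<Phi> (Suc k)" using assms(1) unfolding is_flag_def by simp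
    then show ?case using step by auto
  qed simp
qed

text \<open>Such an \<open>m\<close> is parallel to the bottom flat, hence to every larger flat and
  to the hyperplanes bounding the half-spaces. Consequently a translate of a flag is determined by
  its bottom flat.\<close>

lemma translate_flag_fixed:
  fixes \<Phi> :: "'a::euclidean_space flag"
  assumes flag: "is_flag r \<Phi>" and m: "(+) m ` flat \<Phi> r = flat \<Phi> r"
  shows "translate_flag m \<Phi> = \<Phi>"
proof -
  have r: "r < DIM('a)" using flag by (simp add: is_flag_def)
  obtain x where x: "x \<in> flat \<Phi> r" using is_flag_flat[OF flag] r by fastforce
  then have mx: "m + x \<in> flat \<Phi> r" using m by blast
  have flat: "(+) m ` flat \<Phi> j = flat \<Phi> j" for j
  proof (cases "j \<in> {r..DIM('a)}")
    case True
    then show ?thesis using x mx is_flag_flat[OF flag, of j] by (intro translate_affine_eq[of _ x]) auto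
  next
    case False
    then show ?thesis using flag by (simp add: is_flag_def)
  qed
  have pos: "(+) m ` pos \<Phi> j = pos \<Phi> j" for j
  proof (cases "j \<in> {r..<DIM('a)}")
    case True
    then have "halfspace_in (flat \<Phi> (Suc j)) (flat \<Phi> j) (pos \<Phi> j)" using flag by (simp add: is_flag_def)
    then obtain a b where ab: "flat \<Phi> j = {x\<in>flat \<Phi> (Suc j). a \<bullet> x = b}" "pos \<Phi> j = {x\<in>flat \<Phi> (Suc j). a \<bullet> x \<ge> b}"
      unfolding halfspace_in_def by blast
    have "x \<in> flat \<Phi> j" "m + x \<in> flat \<Phi> j" using x mx is_flag_flat(3)[OF flag, of j] True by auto
    then have "a \<bullet> m = 0" unfolding ab(1) by (simp add: inner_add_right)
    then show ?thesis
      using translated_halfspace[of m "flat \<Phi> (Suc j)" "\<lambda>t. t \<ge> 0" a b] flat[of "Suc j"] ab(2) by simp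
  next
    case False
    then show ?thesis using flag by (simp add: is_flag_def)
  qed
  show ?thesis by (cases \<Phi>) (use flat pos in \<open>simp add: translate_flag_def\<close>)
qed

text \<open>By \<open>chain_saturated\<close> the bottom flats of these translates are saturated for
  one arrangement \<open>H0\<close>, and the bottom flat determines the translate. This makes the
  sum in \<open>Hadwiger\<close> effectively finite.\<close>

lemma finite_translates_with_chains:
  fixes A :: "'a::euclidean_space set"
  assumes flag: "is_flag r \<Phi>" and A: "solid_polytope A"
  shows "finite {\<Psi>. (\<exists>l. \<Psi> = translate_flag l \<Phi>) \<and> face_chains r \<Psi> A \<noteq> {}}"
proof -
  let ?T = "{\<Psi>. (\<exists>l. \<Psi> = translate_flag l \<Phi>) \<and> face_chains r \<Psi> A \<noteq> {}}"
  have r: "r < DIM('a)" using flag by (simp add: is_flag_def)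
  obtain a b n where abn: "flag_normals r \<Phi> a b n" using is_flag_normals[OF flag] by blast
  obtain H0 where H0: "finite H0" "saturated H0 A" using solid_polytope_saturated[OF A] by blast
  have inj: "inj_on (\<lambda>\<Psi>. flat \<Psi> r) ?T"
  proof (rule inj_onI, clarify)
    fix l l' assume eq: "flat (translate_flag l \<Phi>) r = flat (translate_flag l' \<Phi>) r"
    have "(+) (- l' + l) ` flat \<Phi> r = (+) (- l') ` ((+) l ` flat \<Phi> r)"
      unfolding image_image by (rule image_cong) (simp_all only: add.assoc)
    also have "\<dots> = (+) (- l') ` ((+) l' ` flat \<Phi> r)" using eq by simp
    also have "\<dots> = flat \<Phi> r" by (simp add: image_image)
    finally have "translate_flag (- l' + l) \<Phi> = \<Phi>" by (rule translate_flag_fixed[OF flag])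
    then have "translate_flag l' (translate_flag (- l' + l) \<Phi>) = translate_flag l' \<Phi>" by simp
    then show "translate_flag l \<Phi> = translate_flag l' \<Phi>" by (simp add: translate_flag_add)
  qed
  have "saturated H0 (flat \<Psi> r)" if \<Psi>: "\<Psi> \<in> ?T" for \<Psi>
  proof -
    obtain l F where l: "\<Psi> = translate_flag l \<Phi>" "F \<in> face_chains r \<Psi> A" using \<Psi> by blast
    have "A \<noteq> {}" using l(2) face_chains_empty[OF r] by blast
    define b' where "b' = (\<lambda>j. b j + a j \<bullet> l)"
    define H where "H = H0 \<union> (\<lambda>j. (a j, b' j)) ` {r..<DIM('a)} \<union> (\<lambda>j. (- a j, - b' j)) ` {r..<DIM('a)}"
    have finH: "finite H" using H0 by (simp add: H_def)
    have satA: "saturated H A" using H0(2) by (rule saturated_mono) (auto simp: H_def)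
    have n: "flag_normals r \<Psi> a b' n" unfolding l(1) b'_def by (rule flag_normals_translate[OF abn])
    interpret flag_arrangement r \<Psi> a n b' H A
      by unfold_locales (use n finH satA solid_polytope_closed[OF A] solid_polytope_affine_hull[OF A \<open>A \<noteq> {}\<close>]
        in \<open>auto simp: H_def\<close>)
    show ?thesis using chain_saturated[OF H0, of r] r l(2) by auto
  qed
  then have "(\<lambda>\<Psi>. flat \<Psi> r) ` ?T \<subseteq> {S. saturated H0 S}" by blast
  then have "finite ((\<lambda>\<Psi>. flat \<Psi> r) ` ?T)" using finite_saturated[OF H0(1)] finite_subset by blast
  then show ?thesis using inj by (rule finite_imageD)
qed

section \<open>Lattice sums and Hadwiger functionals\<close>

text \<open>Each radius has its own arrangement, as the tiling sum requires. The notion is strong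
  enough to be used along rays from generic points of a hyperplane, where an almost everywhere
  statement gives nothing.\<close>

definition generically :: "'a::euclidean_space set \<Rightarrow> ('a \<Rightarrow> bool) \<Rightarrow> bool" where
  "generically V Q \<longleftrightarrow> (\<forall>R. \<exists>H. finite H \<and> (\<forall>x. norm x < R \<longrightarrow> generic_in H V x \<longrightarrow> Q x))"

lemma generically_AE:
  assumes M: "\<And>H. finite H \<Longrightarrow> AE x in M. generic_in H V x" and Q: "generically V Q"
  shows "AE x in M. Q x"
proof -
  have "\<forall>k::nat. \<exists>H. finite H \<and> (\<forall>x. norm x < real k \<longrightarrow> generic_in H V x \<longrightarrow> Q x)"
    using Q unfolding generically_def by blast
  then obtain H where H: "\<And>k::nat. finite (H k)" "\<And>k x. norm x < real k \<Longrightarrow> generic_in (H k) V x \<Longrightarrow> Q x"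
    by metis
  have "AE x in M. \<forall>k. generic_in (H k) V x"
    unfolding AE_all_countable by (intro allI M H)
  then show ?thesis
  proof eventually_elim
    case (elim x)
    obtain k :: nat where "norm x < real k" using reals_Archimedean2 by blast
    then show ?case using H(2) elim by blast
  qed
qed

lemma side_measurable_translate:
  assumes "side_measurable H f"
  shows "side_measurable ((\<lambda>(a, b). (a, b - a \<bullet> l)) ` H) (\<lambda>x. f (x + l))"
  unfolding side_measurable_def
proof (intro allI impI)
  fix x y assume xy: "same_side ((\<lambda>(a, b). (a, b - a \<bullet> l)) ` H) x y"
  have "same_side H (x + l) (y + l)"
    unfolding same_side_def
  proof clarify
    fix a b assume "(a, b) \<in> H"
    then have "(a, b - a \<bullet> l) \<in> (\<lambda>(a, b). (a, b - a \<bullet> l)) ` H" by (force simp: image_iff)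
    then have "sgn (a \<bullet> x - (b - a \<bullet> l)) = sgn (a \<bullet> y - (b - a \<bullet> l))" using xy unfolding same_side_def by blast
    then show "sgn (a \<bullet> (x + l) - b) = sgn (a \<bullet> (y + l) - b)" by (simp add: inner_add_right algebra_simps)
  qed
  then show "f (x + l) = f (y + l)" using assms unfolding side_measurable_def by blast
qed

lemma piecewise_constant_local:
  assumes "\<And>R. \<exists>g. piecewise_constant g \<and> (\<forall>x. norm x < R \<longrightarrow> f x = g x)"
  shows "piecewise_constant f"
  unfolding piecewise_constant_def
proof
  fix R
  obtain g where g: "piecewise_constant g" "\<And>x. norm x < R \<Longrightarrow> f x = g x" using assms[of R] by blast
  obtain H where H: "finite H" "side_measurable_within H R g" using g(1) unfolding piecewise_constant_def by blast
  have "side_measurable_within H R f"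
    unfolding side_measurable_within_def
  proof (intro allI impI)
    fix x y assume xy: "norm x < R" "norm y < R" "same_side H x y"
    then have "g x = g y" using H(2) unfolding side_measurable_within_def by blast
    then show "f x = f y" using g(2) xy by simp
  qed
  then show "\<exists>H. finite H \<and> side_measurable_within H R f" using H(1) by blast
qed

section \<open>The tiling sum of a representative\<close>

locale lattice_tiling =
  fixes L :: "'a::euclidean_space set" and c :: "'a set \<Rightarrow>\<^sub>0 int"
  assumes lattice: "is_lattice L" and keys: "Poly_Mapping.keys c \<subseteq> {A. solid_polytope A}"
begin

definition chi :: "'a \<Rightarrow> real" where
  "chi x = (\<Sum>A\<in>Poly_Mapping.keys c. of_int (Poly_Mapping.lookup c A) * indicator A x)"

definition tiling_sum :: "'a \<Rightarrow> real" where
  "tiling_sum x = (\<Sum>\<^sub>\<infinity>l\<in>L. chi (x - l))"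

lemma arrangement: "\<exists>H. finite H \<and> side_measurable H chi \<and> (\<forall>A\<in>Poly_Mapping.keys c. saturated H A)"
proof -
  have "\<forall>A\<in>Poly_Mapping.keys c. \<exists>H. finite H \<and> saturated H A"
    using keys solid_polytope_saturated by blast
  then obtain H where H: "\<And>A. A \<in> Poly_Mapping.keys c \<Longrightarrow> finite (H A) \<and> saturated (H A) A" by metis
  let ?H = "\<Union>(H ` Poly_Mapping.keys c)"
  have sat: "saturated ?H A" if "A \<in> Poly_Mapping.keys c" for A
    by (rule saturated_mono[of "H A"]) (use H that in auto)
  have "side_measurable ?H chi"
    unfolding side_measurable_def chi_def
  proof (intro allI impI sum.cong refl arg_cong2[of _ _ _ _ "(*)"])
    fix x y A assume "same_side ?H x y" "A \<in> Poly_Mapping.keys c"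
    then show "indicator A x = (indicator A y :: real)"
      using saturated_iff[OF sat] by (simp add: indicator_def)
  qed
  then show ?thesis using H sat by (intro exI[of _ ?H]) auto
qed

lemma chi_translate_piecewise: "piecewise_constant (\<lambda>x. chi (x + l))"
proof -
  obtain H where "finite H" "side_measurable H chi" using arrangement by blast
  then show ?thesis
    using piecewise_constant_side_measurable[OF _ side_measurable_translate[of H chi l]] by simp
qed

lemma chi_support: "\<exists>R0>0. \<forall>x. norm x \<ge> R0 \<longrightarrow> chi x = 0"
proof -
  have "bounded (\<Union>(Poly_Mapping.keys c))"
    using keys solid_polytope_bounded by (intro bounded_Union) auto
  then obtain R0 where R0: "R0 > 0" "\<Union>(Poly_Mapping.keys c) \<subseteq> ball 0 R0"
    using bounded_subset_ballD by blast
  have "chi x = 0" if "norm x \<ge> R0" for x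
  proof -
    have "x \<notin> A" if "A \<in> Poly_Mapping.keys c" for A
      using R0(2) that \<open>norm x \<ge> R0\<close> by (auto simp: subset_iff)
    then show ?thesis unfolding chi_def by (intro sum.neutral) simp
  qed
  then show ?thesis using R0(1) by blast
qed

text \<open>Vectors longer than \<open>R + R0\<close> move every point of the ball off the support
  of \<open>f\<close>, so one finite index set serves the whole ball. The sign of \<open>l\<close>
  is reversed, by symmetry of the lattice, to fit \<open>jumps_translate\<close>.\<close>

lemma lattice_ball_sum:
  assumes f: "\<And>x. norm x \<ge> R0 \<Longrightarrow> f x = (0::real)" and x: "norm x < R"
  shows "(\<Sum>\<^sub>\<infinity>l\<in>L. f (x - l)) = (\<Sum>l | l \<in> L \<and> norm l \<le> R + R0. f (x + l))"
proof -
  let ?M = "{l\<in>L. norm l \<le> R + R0}"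
  have fin: "finite ?M" by (rule is_lattice_finite[OF lattice])
  have "(\<Sum>\<^sub>\<infinity>l\<in>L. f (x - l)) = (\<Sum>\<^sub>\<infinity>l\<in>?M. f (x - l))"
  proof (rule infsum_cong_neutral)
    fix l assume "l \<in> L - ?M"
    then have "norm l > R + R0" by auto
    then have "norm (x - l) \<ge> R0" using x norm_triangle_ineq2[of l x] by (simp add: norm_minus_commute)
    then show "f (x - l) = 0" by (rule f)
  qed auto
  also have "\<dots> = (\<Sum>l\<in>?M. f (x - l))" using fin by simp
  also have "\<dots> = (\<Sum>l\<in>?M. f (x + l))"
    by (rule sum.reindex_bij_witness[of _ uminus uminus]) (auto intro: is_lattice_group(3)[OF lattice])
  finally show ?thesis .
qed

lemma tiling_sum_piecewise: "piecewise_constant tiling_sum"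
proof (rule piecewise_constant_local)
  fix R
  obtain R0 where R0: "\<And>x. norm x \<ge> R0 \<Longrightarrow> chi x = 0" using chi_support by blast
  let ?M = "{l\<in>L. norm l \<le> R + R0}"
  have "piecewise_constant (\<lambda>x. \<Sum>l\<in>?M. 1 * chi (x + l))"
    by (intro piecewise_constant_sum is_lattice_finite[OF lattice] chi_translate_piecewise)
  moreover have "tiling_sum x = (\<Sum>l\<in>?M. 1 * chi (x + l))" if "norm x < R" for x
    unfolding tiling_sum_def using lattice_ball_sum[OF R0 that] by simp
  ultimately show "\<exists>g. piecewise_constant g \<and> (\<forall>x. norm x < R \<longrightarrow> tiling_sum x = g x)" by blast
qed

text \<open>Jumps are local on open sets, and on the open ball the tiling sum is a finite sum of
  translates.\<close>

lemma jumps_tiling_sum: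
  assumes "k \<le> d" "\<And>x. norm x \<ge> R0 \<Longrightarrow> chi x = 0" "norm x < R"
  shows "jumps n k d tiling_sum x = (\<Sum>l | l \<in> L \<and> norm l \<le> R + R0. jumps n k d chi (x + l))"
proof -
  let ?M = "{l\<in>L. norm l \<le> R + R0}"
  have "jumps n k d tiling_sum x = jumps n k d (\<lambda>x. \<Sum>l\<in>?M. 1 * chi (x + l)) x"
  proof (rule jumps_cong_open[OF assms(1) open_ball[of 0 R]])
    show "tiling_sum y = (\<Sum>l\<in>?M. 1 * chi (y + l))" if "y \<in> ball 0 R" for y
      unfolding tiling_sum_def using lattice_ball_sum[OF assms(2), where x = y and R = R] that by simp
  qed (use assms(3) in simp)
  also have "\<dots> = (\<Sum>l\<in>?M. 1 * jumps n k d (\<lambda>x. chi (x + l)) x)"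
    by (subst jumps_sum[OF assms(1)]) (auto intro: is_lattice_finite[OF lattice] chi_translate_piecewise)
  also have "\<dots> = (\<Sum>l\<in>?M. jumps n k d chi (x + l))"
    by (simp only: jumps_translate[OF assms(1), of n chi] mult_1)
  finally show ?thesis .
qed

text \<open>The bound is strict because locality of jumps needs an open set; from the sphere of
  radius \<open>R0\<close> rays may lead into the support.\<close>

lemma jumps_chi_support:
  assumes "k \<le> d" "\<And>x. norm x \<ge> R0 \<Longrightarrow> chi x = 0" "norm x > R0"
  shows "jumps n k d chi x = 0"
proof -
  have "open (- cball 0 R0 :: 'a set)" by (simp add: open_Compl)
  then have "jumps n k d chi x = jumps n k d (\<lambda>x. 0) x"
    using assms(2,3) by (intro jumps_cong_open[OF assms(1), of "- cball 0 R0"]) auto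
  then show ?thesis using jumps_zero[OF assms(1), of n] by simp
qed

lemma jumps_chi:
  assumes "k \<le> d"
  shows "jumps n k d chi = (\<lambda>x. \<Sum>A\<in>Poly_Mapping.keys c. of_int (Poly_Mapping.lookup c A) * jumps n k d (indicator A) x)"
proof -
  obtain H where H: "finite H" "\<forall>A\<in>Poly_Mapping.keys c. saturated H A" using arrangement by blast
  have eq: "chi = (\<lambda>x. \<Sum>A\<in>Poly_Mapping.keys c. of_int (Poly_Mapping.lookup c A) * indicator A x)"
    by (rule ext) (rule chi_def)
  have "piecewise_constant (indicator A)" if "A \<in> Poly_Mapping.keys c" for A
    using H that piecewise_constant_side_measurable side_measurable_indicator by blast
  then show ?thesis
    unfolding eq by (intro jumps_sum assms) auto
qed

end

section \<open>A flag and its lattice translates\<close>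

locale lattice_tiling_flag = lattice_tiling L c
  for L :: "'a::euclidean_space set" and c +
  fixes r :: nat and \<Phi> :: "'a flag" and a n :: "nat \<Rightarrow> 'a" and b :: "nat \<Rightarrow> real"
  assumes flag: "is_flag r \<Phi>" and normals: "flag_normals r \<Phi> a b n"
begin

abbreviation V :: "'a set" where "V \<equiv> flat \<Phi> r"

abbreviation \<mu> :: "'a measure" where "\<mu> \<equiv> flat_measure V"

abbreviation q :: "'a \<Rightarrow> real" where "q \<equiv> jumps n r DIM('a) chi"

lemma r_less: "r < DIM('a)"
  using flag by (simp add: is_flag_def)

lemma V: "affine V" "V \<noteq> {}"
  using is_flag_flat[OF flag order_refl] r_less by auto

lemma measurable_q [measurable]: "q \<in> borel_measurable borel"
proof -
  obtain H where H: "finite H" "side_measurable H chi" using arrangement by blast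
  then have "side_measurable H q" using r_less by (intro side_measurable_jumps) auto
  then show ?thesis using side_measurable_borel[OF H(1)] by blast
qed

lemma integral_translate:
  fixes f :: "'a \<Rightarrow> real"
  assumes "f \<in> borel_measurable borel"
  shows "(\<integral>x. f x \<partial>flat_measure ((+) l ` V)) = (\<integral>x. f (l + x) \<partial>\<mu>)"
    and "integrable (flat_measure ((+) l ` V)) f \<Longrightarrow> integrable \<mu> (\<lambda>x. f (l + x))"
  unfolding flat_measure_translate[OF V] using assms
  by (auto simp: integral_distr integrable_distr_eq)

text \<open>A translated flag has the same directions \<open>n\<close>, so its weight integrates the
  same function \<open>qA\<close>, only over a translated flat; the integral is moved back to the
  fixed flat \<open>V\<close>.\<close>

lemma weight_translate:
  assumes A: "A \<in> Poly_Mapping.keys c"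
  defines "qA \<equiv> jumps n r DIM('a) (indicator A)"
  shows "integrable \<mu> (\<lambda>x. qA (l + x))"
    and "flag_weight r (translate_flag l \<Phi>) A = (\<integral>x. qA (l + x) \<partial>\<mu>)"
    and "face_chains r (translate_flag l \<Phi>) A = {} \<Longrightarrow> AE x in \<mu>. qA (l + x) = 0"
proof -
  have solid: "solid_polytope A" using A keys by blast
  note nt = flag_normals_translate[OF normals, of l]
  have aff: "affine (flat (translate_flag l \<Phi>) r)" "flat (translate_flag l \<Phi>) r \<noteq> {}"
    using V affine_translation[of V l] by auto
  note w = flag_weight_integral[OF nt r_less aff solid, folded qA_def, unfolded flat_translate_flag]
  obtain H where H: "finite H" "saturated H A" using solid_polytope_saturated[OF solid] by blast
  have "side_measurable H qA"
    unfolding qA_def using H r_less by (intro side_measurable_jumps side_measurable_indicator) auto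
  then have meas [measurable]: "qA \<in> borel_measurable borel" using side_measurable_borel[OF H(1)] by blast
  show "integrable \<mu> (\<lambda>x. qA (l + x))" using integral_translate(2)[OF meas w(1)] .
  show "flag_weight r (translate_flag l \<Phi>) A = (\<integral>x. qA (l + x) \<partial>\<mu>)"
    using w(2) integral_translate(1)[OF meas] by simp
  show "AE x in \<mu>. qA (l + x) = 0" if "face_chains r (translate_flag l \<Phi>) A = {}"
  proof -
    have "AE x in distr \<mu> borel ((+) l). qA x = 0"
      using w(3)[OF that] unfolding flat_measure_translate[OF V] .
    then show ?thesis by (subst (asm) AE_distr_iff) auto
  qed
qed

lemma integrable_q: "integrable \<mu> (\<lambda>x. q (l + x))"
  unfolding jumps_chi[OF less_imp_le[OF r_less]]
  by (intro Bochner_Integration.integrable_sum integrable_mult_right weight_translate(1))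

text \<open>The only translates that can contribute to the Hadwiger sums of the polytopes in
  \<open>c\<close>. Being a set of flags and not of lattice vectors, it counts every translate once;
  \<open>shift\<close> selects one lattice vector for each.\<close>

definition charged :: "'a flag set" where
  "charged = {\<Psi>. (\<exists>l\<in>L. \<Psi> = translate_flag l \<Phi>) \<and> (\<exists>A\<in>Poly_Mapping.keys c. face_chains r \<Psi> A \<noteq> {})}"

lemma finite_charged: "finite charged"
proof -
  have "charged \<subseteq> (\<Union>A\<in>Poly_Mapping.keys c. {\<Psi>. (\<exists>l. \<Psi> = translate_flag l \<Phi>) \<and> face_chains r \<Psi> A \<noteq> {}})"
    unfolding charged_def by blast
  moreover have "finite \<dots>" using keys finite_translates_with_chains[OF flag] by (intro finite_UN_I) auto
  ultimately show ?thesis by (rule finite_subset)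
qed

definition shift :: "'a flag \<Rightarrow> 'a" where
  "shift \<Psi> = (SOME l. l \<in> L \<and> \<Psi> = translate_flag l \<Phi>)"

lemma shift: "\<Psi> \<in> charged \<Longrightarrow> shift \<Psi> \<in> L \<and> translate_flag (shift \<Psi>) \<Phi> = \<Psi>"
  unfolding shift_def charged_def by (rule someI2_ex) auto

lemma Hadwiger_eq:
  assumes A: "A \<in> Poly_Mapping.keys c"
  shows "Hadwiger r \<Phi> L A = (\<Sum>\<Psi>\<in>charged. flag_weight r \<Psi> A)"
proof -
  have "Hadwiger r \<Phi> L A = (\<Sum>\<^sub>\<infinity>\<Psi>\<in>charged. flag_weight r \<Psi> A)"
    unfolding Hadwiger_def
  proof (rule infsum_cong_neutral)
    fix \<Psi> assume "\<Psi> \<in> {translate_flag l \<Phi> |l. l \<in> L} - charged"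
    then have "face_chains r \<Psi> A = {}" using A unfolding charged_def by blast
    then show "flag_weight r \<Psi> A = 0" by (simp add: flag_weight_def)
  qed (auto simp: charged_def)
  then show ?thesis using finite_charged by simp
qed

lemma frag_eval_Hadwiger: "frag_eval (Hadwiger r \<Phi> L) c = (\<Sum>\<Psi>\<in>charged. \<integral>x. q (shift \<Psi> + x) \<partial>\<mu>)"
proof -
  have "frag_eval (Hadwiger r \<Phi> L) c =
    (\<Sum>A\<in>Poly_Mapping.keys c. \<Sum>\<Psi>\<in>charged. of_int (Poly_Mapping.lookup c A) * flag_weight r \<Psi> A)"
    unfolding frag_eval_def by (intro sum.cong refl) (simp add: Hadwiger_eq sum_distrib_left)
  also have "\<dots> = (\<Sum>\<Psi>\<in>charged. \<Sum>A\<in>Poly_Mapping.keys c. of_int (Poly_Mapping.lookup c A) * flag_weight r \<Psi> A)"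
    by (rule sum.swap)
  also have "\<dots> = (\<Sum>\<Psi>\<in>charged. \<integral>x. q (shift \<Psi> + x) \<partial>\<mu>)"
  proof (rule sum.cong[OF refl])
    fix \<Psi> assume "\<Psi> \<in> charged"
    then have "flag_weight r \<Psi> A = (\<integral>x. jumps n r DIM('a) (indicator A) (shift \<Psi> + x) \<partial>\<mu>)"
      if "A \<in> Poly_Mapping.keys c" for A
      using weight_translate(2)[OF that, of "shift \<Psi>"] shift by simp
    then show "(\<Sum>A\<in>Poly_Mapping.keys c. of_int (Poly_Mapping.lookup c A) * flag_weight r \<Psi> A) = (\<integral>x. q (shift \<Psi> + x) \<partial>\<mu>)"
      unfolding jumps_chi[OF less_imp_le[OF r_less]]
      by (subst Bochner_Integration.integral_sum) (auto intro!: integrable_mult_right weight_translate(1))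
  qed
  finally show ?thesis .
qed

lemma AE_uncharged:
  assumes "l \<in> L" "translate_flag l \<Phi> \<notin> charged"
  shows "AE x in \<mu>. q (l + x) = 0"
proof -
  have "face_chains r (translate_flag l \<Phi>) A = {}" if "A \<in> Poly_Mapping.keys c" for A
    using assms that unfolding charged_def by blast
  then have "AE x in \<mu>. \<forall>A\<in>Poly_Mapping.keys c. jumps n r DIM('a) (indicator A) (l + x) = 0"
    by (intro AE_finite_allI weight_translate(3)) auto
  then show ?thesis
    unfolding jumps_chi[OF less_imp_le[OF r_less]] by eventually_elim simp
qed

text \<open>Two lattice vectors give the same translate of \<open>\<Phi>\<close> exactly when their
  difference lies in the stabilizer.\<close>

definition stabilizer :: "'a set" where
  "stabilizer = {m\<in>L. translate_flag m \<Phi> = \<Phi>}"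

lemma stabilizer_group:
  "0 \<in> stabilizer" "x \<in> stabilizer \<Longrightarrow> y \<in> stabilizer \<Longrightarrow> x + y \<in> stabilizer"
  "x \<in> stabilizer \<Longrightarrow> - x \<in> stabilizer" "x \<in> stabilizer \<Longrightarrow> y \<in> stabilizer \<Longrightarrow> x - y \<in> stabilizer"
proof -
  show "0 \<in> stabilizer" using is_lattice_group(1)[OF lattice] by (simp add: stabilizer_def)
  show *: "x + y \<in> stabilizer" if "x \<in> stabilizer" "y \<in> stabilizer" for x y
    using that is_lattice_group(2)[OF lattice] by (simp add: stabilizer_def translate_flag_add[symmetric])
  show **: "- x \<in> stabilizer" if "x \<in> stabilizer" for x
  proof -
    have "translate_flag (- x) \<Phi> = translate_flag (- x) (translate_flag x \<Phi>)"
      using that by (simp add: stabilizer_def)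
    then show ?thesis using that is_lattice_group(3)[OF lattice] by (simp add: stabilizer_def translate_flag_add)
  qed
  show "x - y \<in> stabilizer" if "x \<in> stabilizer" "y \<in> stabilizer" for x y
    using *[OF that(1) **[OF that(2)]] by simp
qed

lemma stabilizer_V: "m \<in> stabilizer \<Longrightarrow> (+) m ` V = V"
  unfolding stabilizer_def using flat_translate_flag[of m \<Phi> r] by auto

text \<open>A lattice vector whose translate is charged is \<open>shift \<Psi> + m\<close> with
  unique \<open>\<Psi>\<close> and unique \<open>m\<close> in the stabilizer. So at almost every
  point of \<open>V\<close> near the origin, \<open>\<gamma>\<close> is the sum of all
  \<open>q (shift \<Psi> + (m + x))\<close>. Integrating against \<open>h\<close> and moving
  \<open>m\<close> from \<open>q\<close> to \<open>h\<close>, where the sum over \<open>m\<close> is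
  1, leaves the integrals of \<open>frag_eval_Hadwiger\<close>. The factor is the integral of
  \<open>h\<close>.\<close>

lemma Hadwiger_proportional:
  assumes const: "generically V (\<lambda>x. jumps n r DIM('a) tiling_sum x = \<gamma>)"
  obtains \<kappa> where "\<kappa> > 0" "frag_eval (Hadwiger r \<Phi> L) c = \<gamma> * \<kappa>"
proof -
  obtain R0 where R0: "R0 > 0" "\<And>x. norm x \<ge> R0 \<Longrightarrow> chi x = 0" using chi_support by blast
  obtain v0 where v0: "v0 \<in> V" using V by blast
  \<comment> \<open>Large enough that for charged \<open>\<Psi>\<close> all functions
    \<open>q (shift \<Psi> + x)\<close> vanish outside the ball of radius \<open>R\<close>, and that
    this ball meets \<open>V\<close>.\<close>
  define R where "R = R0 + 1 + (\<Sum>\<Psi>\<in>charged. norm (shift \<Psi>)) + norm v0"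
  have Rv0: "norm v0 < R" and Rpos: "R > 0"
    using R0(1) sum_nonneg[of charged "\<lambda>\<Psi>. norm (shift \<Psi>)"] by (auto simp: R_def intro: add_pos_nonneg add_nonneg_pos)
  have q_out: "q x = 0" if "norm x > R0" for x
    using jumps_chi_support[OF less_imp_le[OF r_less] R0(2) that] .
  have q_shift: "q (shift \<Psi> + x) = 0" if \<Psi>: "\<Psi> \<in> charged" and x: "norm x \<ge> R" for \<Psi> x
  proof (rule q_out)
    have "norm (shift \<Psi>) \<le> (\<Sum>\<Psi>\<in>charged. norm (shift \<Psi>))"
      using \<Psi> finite_charged by (intro member_le_sum) auto
    then have "norm x - norm (shift \<Psi>) > R0" using x norm_ge_zero[of v0] unfolding R_def by linarith
    then show "norm (shift \<Psi> + x) > R0" using norm_triangle_ineq2[of x "- shift \<Psi>"] by (simp add: add.commute)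
  qed
  define M1 where "M1 = {l\<in>L. norm l \<le> R + R0}"
  \<comment> \<open>Only these elements of the stabilizer can move a point of the ball of radius
    \<open>R\<close> to another point of it.\<close>
  define M0 where "M0 = {m\<in>stabilizer. norm m < 2 * R}"
  have fin1: "finite M1" unfolding M1_def by (rule is_lattice_finite[OF lattice])
  have fin0: "finite M0"
    by (rule finite_subset[OF _ is_lattice_finite[OF lattice, of "2 * R"]]) (auto simp: M0_def stabilizer_def)
  have zero0: "0 \<in> M0" using stabilizer_group(1) Rpos by (simp add: M0_def)
  have unfold_sum: "(\<Sum>l\<in>M1. q (x + l)) = (\<Sum>\<Psi>\<in>charged. \<Sum>m\<in>M0. q (shift \<Psi> + (m + x)))"
    if x: "norm x < R" and un: "\<And>l. l \<in> M1 \<Longrightarrow> translate_flag l \<Phi> \<notin> charged \<Longrightarrow> q (l + x) = 0" for x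
  proof -
    let ?e = "\<lambda>(\<Psi>, m). shift \<Psi> + m"
    have inj: "inj_on ?e (charged \<times> M0)"
    proof (rule inj_onI, clarify)
      fix \<Psi> m \<Psi>' m' assume *: "\<Psi> \<in> charged" "\<Psi>' \<in> charged" "m \<in> M0" "m' \<in> M0" "shift \<Psi> + m = shift \<Psi>' + m'"
      have tr: "translate_flag (shift \<Psi> + m) \<Phi> = \<Psi>" if "\<Psi> \<in> charged" "m \<in> M0" for \<Psi> m
        using that shift[of \<Psi>] by (simp add: translate_flag_add[symmetric] M0_def stabilizer_def)
      have "\<Psi> = \<Psi>'" using tr[OF *(1,3)] tr[OF *(2,4)] *(5) by simp
      then show "\<Psi> = \<Psi>' \<and> m = m'" using *(5) by simp
    qed
    have "(\<Sum>\<Psi>\<in>charged. \<Sum>m\<in>M0. q (shift \<Psi> + (m + x))) = (\<Sum>p\<in>charged \<times> M0. q (x + ?e p))"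
      unfolding sum.cartesian_product by (intro sum.cong) (auto simp: algebra_simps)
    also have "\<dots> = (\<Sum>l\<in>?e ` (charged \<times> M0). q (x + l))"
      by (subst sum.reindex[OF inj]) simp
    \<comment> \<open>The index sets differ in vanishing terms only: image vectors outside
      \<open>M1\<close> are too long for the support of \<open>q\<close>; vectors of
      \<open>M1\<close> outside the image are either uncharged or have an \<open>m\<close> of norm
      at least \<open>2 * R\<close>.\<close>
    also have "\<dots> = (\<Sum>l\<in>M1. q (x + l))"
    proof (rule sum.mono_neutral_cong)
      fix l assume "l \<in> ?e ` (charged \<times> M0) - M1"
      then have "norm l > R + R0"
        using shift is_lattice_group(2)[OF lattice] by (force simp: M1_def M0_def stabilizer_def)
      then have "norm (x + l) > R0" using x norm_triangle_ineq2[of l "- x"] by (simp add: add.commute)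
      then show "q (x + l) = 0" by (rule q_out)
    next
      fix l assume l: "l \<in> M1 - ?e ` (charged \<times> M0)"
      show "q (x + l) = 0"
      proof (cases "translate_flag l \<Phi> \<in> charged")
        case False
        then show ?thesis using un[of l] l by (simp add: add.commute)
      next
        case True
        define \<Psi> where "\<Psi> = translate_flag l \<Phi>"
        define m where "m = l - shift \<Psi>"
        have \<Psi>: "\<Psi> \<in> charged" using True by (simp add: \<Psi>_def)
        have "translate_flag m \<Phi> = translate_flag (- shift \<Psi>) (translate_flag l \<Phi>)"
          by (simp add: translate_flag_add m_def)
        also have "\<dots> = translate_flag (- shift \<Psi>) (translate_flag (shift \<Psi>) \<Phi>)"
          using shift[OF \<Psi>] by (simp add: \<Psi>_def)
        also have "\<dots> = \<Phi>" by (simp add: translate_flag_add)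
        finally have "translate_flag m \<Phi> = \<Phi>" .
        moreover have "m \<in> L" using l shift[OF \<Psi>] is_lattice_group(4)[OF lattice] by (simp add: m_def M1_def)
        ultimately have "m \<in> stabilizer" by (simp add: stabilizer_def)
        moreover have "m \<notin> M0"
        proof
          assume "m \<in> M0"
          then have "l \<in> ?e ` (charged \<times> M0)" using \<Psi> by (intro image_eqI[of _ _ "(\<Psi>, m)"]) (auto simp: m_def)
          then show False using l by blast
        qed
        ultimately have "norm m \<ge> 2 * R" by (simp add: M0_def)
        then have "norm (m + x) \<ge> R" using x norm_triangle_ineq2[of m "- x"] by simp
        then have "q (shift \<Psi> + (m + x)) = 0" by (rule q_shift[OF \<Psi>])
        then show ?thesis by (simp add: m_def algebra_simps)
      qed
    qed (use fin1 fin0 finite_charged in auto)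
    finally show ?thesis by simp
  qed
  \<comment> \<open>For \<open>x\<close> in the ball this counts the stabilizer translates of the
    ball that cover \<open>x\<close>; dividing by it gives the partition of unity.\<close>
  define N where "N x = (\<Sum>m\<in>M0. indicator (ball 0 R) (x - m) :: real)" for x
  define h where "h x = indicator (ball 0 R) x / N x" for x
  have ind_ball: "indicator (ball 0 R) \<in> borel_measurable (borel :: 'a measure)"
    by (rule borel_measurable_indicator) simp
  have N_meas [measurable]: "N \<in> borel_measurable borel"
    unfolding N_def
    by (intro borel_measurable_sum measurable_compose[OF _ ind_ball] borel_measurable_diff) auto
  have [measurable]: "h \<in> borel_measurable borel"
    unfolding h_def by (intro borel_measurable_divide ind_ball N_meas)
  have N_ge1: "N x \<ge> 1" if "norm x < R" for x
  proof -
    have "1 = (\<Sum>m\<in>{0}. indicator (ball 0 R) (x - m) :: real)" using that by simp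
    also have "\<dots> \<le> N x" unfolding N_def using zero0 fin0 by (intro sum_mono2) auto
    finally show ?thesis .
  qed
  have N_card: "N x = real (card {m\<in>stabilizer. norm (x - m) < R})" if "norm x < R" for x
  proof -
    have "norm m < 2 * R" if "norm (x - m) < R" for m
      using that \<open>norm x < R\<close> norm_triangle_ineq4[of x "x - m"] by simp
    then have "{m\<in>stabilizer. norm (x - m) < R} = {m\<in>M0. norm (x - m) < R}" by (auto simp: M0_def)
    moreover have "N x = (\<Sum>m\<in>M0. if norm (x - m) < R then 1 else 0)"
      unfolding N_def by (intro sum.cong) (auto simp: indicator_def)
    ultimately show ?thesis using fin0 by (simp add: sum.If_cases Int_def)
  qed
  \<comment> \<open>\<open>M0\<close> is not closed under addition, but at points of the ball it may
    be replaced by the whole stabilizer (\<open>N_card\<close>), on which adding \<open>m\<close> is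
    a bijection.\<close>
  have N_inv: "N (x - m) = N x" if "norm x < R" "norm (x - m) < R" "m \<in> stabilizer" for x m
  proof -
    have "bij_betw (\<lambda>k. k + m) {k\<in>stabilizer. norm (x - m - k) < R} {k\<in>stabilizer. norm (x - k) < R}"
      by (rule bij_betw_byWitness[where f' = "\<lambda>k. k - m"])
         (use that stabilizer_group in \<open>auto simp: algebra_simps\<close>)
    from bij_betw_same_card[OF this] show ?thesis
      unfolding N_card[OF that(1)] N_card[OF that(2)] by (simp only:)
  qed
  have h_unity: "(\<Sum>m\<in>M0. h (x - m)) = 1" if x: "norm x < R" for x
  proof -
    have "(\<Sum>m\<in>M0. h (x - m)) = (\<Sum>m\<in>M0. indicator (ball 0 R) (x - m) / N x)"
    proof (rule sum.cong[OF refl])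
      fix m assume "m \<in> M0"
      then show "h (x - m) = indicator (ball 0 R) (x - m) / N x"
        using N_inv[OF x, of m] by (cases "norm (x - m) < R") (auto simp: h_def M0_def)
    qed
    also have "\<dots> = 1" using N_ge1[OF x] by (simp add: sum_divide_distrib[symmetric] N_def[symmetric])
    finally show ?thesis .
  qed
  have h_bound: "0 \<le> h x" "h x \<le> indicator (ball 0 R) x" for x
    using N_ge1[of x] by (auto simp: h_def indicator_def divide_le_eq_1)
  have h_abs: "\<bar>h x\<bar> \<le> 1" for x
    using h_bound[of x] by (cases "norm x < R") auto
  have int_ball: "integrable \<mu> (indicator (ball 0 R) :: 'a \<Rightarrow> real)"
    using flat_measure_bounded[OF V, of "ball 0 R"] by (intro integrable_real_indicator) auto
  have int_h: "integrable \<mu> h"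
    by (rule Bochner_Integration.integrable_bound[OF int_ball])
       (auto intro!: AE_I2 simp: h_bound abs_of_nonneg)
  have int_hq: "integrable \<mu> (\<lambda>x. h (x - m) * q (l + x))" for l m
  proof (rule Bochner_Integration.integrable_bound[OF integrable_q[of l]])
    show "AE x in \<mu>. norm (h (x - m) * q (l + x)) \<le> norm (q (l + x))"
      using h_abs by (auto intro!: AE_I2 mult_left_le_one_le simp: abs_mult)
  qed measurable
  \<comment> \<open>The stabilizer preserves \<open>V\<close> and hence \<open>\<mu>\<close>, so the
    translation by \<open>m\<close> can be moved from \<open>q\<close> to \<open>h\<close>.\<close>
  have inv: "(\<integral>x. h x * q (shift \<Psi> + (m + x)) \<partial>\<mu>) = (\<integral>x. h (x - m) * q (shift \<Psi> + x) \<partial>\<mu>)"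
    if "m \<in> M0" for \<Psi> m
  proof -
    have "(\<lambda>x. h (x - m) * q (shift \<Psi> + x)) \<in> borel_measurable borel" by measurable
    from integral_translate(1)[OF this, of m] show ?thesis
      using stabilizer_V[of m] that by (simp add: M0_def)
  qed
  have AE1: "AE x in \<mu>. \<forall>l\<in>M1. translate_flag l \<Phi> \<notin> charged \<longrightarrow> q (l + x) = 0"
  proof (rule AE_finite_allI[OF fin1])
    fix l assume "l \<in> M1"
    then show "AE x in \<mu>. translate_flag l \<Phi> \<notin> charged \<longrightarrow> q (l + x) = 0"
      using AE_uncharged[of l] by (cases "translate_flag l \<Phi> \<in> charged") (auto simp: M1_def)
  qed
  have AE2: "AE x in \<mu>. jumps n r DIM('a) tiling_sum x = \<gamma>"
    using AE_flat_measure_generic[OF V] const by (rule generically_AE)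
  \<comment> \<open>Outside the ball both sides vanish with \<open>h\<close>; inside it the constant
    is the finite lattice sum, unfolded.\<close>
  have "AE x in \<mu>. h x * \<gamma> = (\<Sum>\<Psi>\<in>charged. \<Sum>m\<in>M0. h x * q (shift \<Psi> + (m + x)))"
    using AE1 AE2
  proof eventually_elim
    case (elim x)
    show ?case
    proof (cases "norm x < R")
      case True
      have "\<gamma> = (\<Sum>l\<in>M1. q (x + l))"
        using elim(2) jumps_tiling_sum[OF less_imp_le[OF r_less] R0(2) True] by (simp add: M1_def)
      also have "\<dots> = (\<Sum>\<Psi>\<in>charged. \<Sum>m\<in>M0. q (shift \<Psi> + (m + x)))"
        using elim(1) by (intro unfold_sum True) blast
      finally show ?thesis by (simp add: sum_distrib_left)
    qed (simp add: h_def)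
  qed
  then have "(\<integral>x. h x * \<gamma> \<partial>\<mu>) = (\<integral>x. (\<Sum>\<Psi>\<in>charged. \<Sum>m\<in>M0. h x * q (shift \<Psi> + (m + x))) \<partial>\<mu>)"
    by (intro integral_cong_AE) measurable
  also have "\<dots> = (\<Sum>\<Psi>\<in>charged. \<Sum>m\<in>M0. \<integral>x. h x * q (shift \<Psi> + (m + x)) \<partial>\<mu>)"
  proof -
    have "integrable \<mu> (\<lambda>x. h x * q (shift \<Psi> + (m + x)))" for \<Psi> m
      using int_hq[of 0 "shift \<Psi> + m"] by (simp add: add.assoc)
    then show ?thesis
      by (subst Bochner_Integration.integral_sum, simp, subst Bochner_Integration.integral_sum) auto
  qed
  also have "\<dots> = (\<Sum>\<Psi>\<in>charged. \<Sum>m\<in>M0. \<integral>x. h (x - m) * q (shift \<Psi> + x) \<partial>\<mu>)"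
    by (intro sum.cong refl inv)
  also have "\<dots> = (\<Sum>\<Psi>\<in>charged. \<integral>x. (\<Sum>m\<in>M0. h (x - m) * q (shift \<Psi> + x)) \<partial>\<mu>)"
    using int_hq by (subst Bochner_Integration.integral_sum) auto
  also have "\<dots> = (\<Sum>\<Psi>\<in>charged. \<integral>x. q (shift \<Psi> + x) \<partial>\<mu>)"
  proof (intro sum.cong refl Bochner_Integration.integral_cong)
    fix \<Psi> x assume \<Psi>: "\<Psi> \<in> charged"
    show "(\<Sum>m\<in>M0. h (x - m) * q (shift \<Psi> + x)) = q (shift \<Psi> + x)"
      using h_unity[of x] q_shift[OF \<Psi>, of x] by (cases "norm x < R") (simp_all add: sum_distrib_right[symmetric])
  qed
  also have "\<dots> = frag_eval (Hadwiger r \<Phi> L) c" by (rule frag_eval_Hadwiger[symmetric])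
  finally have eq: "frag_eval (Hadwiger r \<Phi> L) c = \<gamma> * (\<integral>x. h x \<partial>\<mu>)" by (simp add: mult.commute)
  have "(\<integral>x. h x \<partial>\<mu>) > 0"
  proof -
    have "ball v0 (R - norm v0) \<subseteq> ball 0 R"
    proof
      fix y assume "y \<in> ball v0 (R - norm v0)"
      then show "y \<in> ball 0 R" using norm_triangle_ineq[of "y - v0" v0] by (simp add: dist_norm norm_minus_commute)
    qed
    then have "emeasure \<mu> (ball v0 (R - norm v0)) \<le> emeasure \<mu> (ball 0 R)" by (intro emeasure_mono) auto
    then have "emeasure \<mu> (ball 0 R) > 0"
      using flat_measure_ball_pos[OF V(1) v0, of "R - norm v0"] Rv0 by simp
    moreover have "emeasure \<mu> (ball 0 R) < \<infinity>" by (rule flat_measure_bounded[OF V]) simp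
    ultimately have pos: "measure \<mu> (ball 0 R) > 0"
      by (simp add: measure_def enn2real_positive_iff)
    have N_le: "N x \<le> real (card M0)" for x
      unfolding N_def using sum_mono[of M0 "\<lambda>m. indicator (ball 0 R) (x - m)" "\<lambda>_. 1 :: real"] by (simp add: indicator_def)
    have card: "card M0 > 0" using zero0 fin0 by (auto simp: card_gt_0_iff)
    \<comment> \<open>\<open>N\<close> never exceeds \<open>card M0\<close>, which bounds
      \<open>h\<close> from below on a ball of positive measure.\<close>
    have "(\<integral>x. indicator (ball 0 R) x / real (card M0) \<partial>\<mu>) \<le> (\<integral>x. h x \<partial>\<mu>)"
    proof (rule integral_mono)
      show "integrable \<mu> (\<lambda>x. indicator (ball 0 R) x / real (card M0))" using int_ball by simp
      show "indicator (ball 0 R) x / real (card M0) \<le> h x" for x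
        using N_ge1[of x] N_le[of x] card by (auto simp: h_def indicator_def intro!: divide_left_mono)
    qed (rule int_h)
    moreover have "(\<integral>x. indicator (ball 0 R) x / real (card M0) \<partial>\<mu>) = measure \<mu> (ball 0 R) / real (card M0)"
      by simp
    ultimately show ?thesis using pos card by (smt (verit) divide_pos_pos of_nat_0_less_iff)
  qed
  then show ?thesis using that eq by blast
qed

end

section \<open>Functions without jumps\<close>

text \<open>The value of \<open>g\<close> at a crossing point is uncontrolled, so the limit in the
  direction of the segment is followed instead. As a function of \<open>t\<close> it is locally
  constant, at crossings by \<open>cross\<close>, hence constant on the connected interval; at the
  generic endpoints it equals \<open>g\<close>.\<close>

lemma piecewise_constant_segment:
  fixes W :: "'a::euclidean_space set" and g :: "'a \<Rightarrow> real"
  assumes W: "affine W" and H: "finite H" "side_measurable_within H R g"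
    and x: "norm x < R" "generic_in H W x" and y: "norm y < R" "generic_in H W y"
    and cross: "\<And>a b t. (a, b) \<in> H \<Longrightarrow> \<not> W \<subseteq> {w. a \<bullet> w = b} \<Longrightarrow> t \<in> {0..1} \<Longrightarrow>
      a \<bullet> (x + t *\<^sub>R (y - x)) = b \<Longrightarrow>
      \<exists>e>0. \<exists>k. \<forall>w\<in>W. dist (x + t *\<^sub>R (y - x)) w < e \<longrightarrow> norm w < R \<longrightarrow> a \<bullet> w \<noteq> b \<longrightarrow> g w = k"
  shows "g x = g y"
proof -
  define v where "v = y - x"
  define p where "p t = x + t *\<^sub>R v" for t :: real
  have xW: "x \<in> W" and yW: "y \<in> W" using x y by (auto dest: generic_inD)
  have pW: "p t \<in> W" for t
    using mem_affine_3_minus[OF W xW yW xW, of t] by (simp add: p_def v_def)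
  have pR: "norm (p t) < R" if "t \<in> {0..1}" for t
  proof -
    have "p t = (1 - t) *\<^sub>R x + t *\<^sub>R y" by (simp add: p_def v_def algebra_simps)
    moreover have "(1 - t) *\<^sub>R x + t *\<^sub>R y \<in> ball 0 R"
      using that x y convex_ball[of 0 R] by (intro convexD) auto
    ultimately show ?thesis by simp
  qed
  have cont: "\<exists>\<delta>>0. \<forall>s. \<bar>s - t\<bar> < \<delta> \<longrightarrow> dist (p t) (p s) < e \<and> norm (p s) < R"
    if e: "e > 0" and t: "t \<in> {0..1}" for e t
  proof -
    have "(p \<longlongrightarrow> p t) (at t)" unfolding p_def by (intro tendsto_intros)
    then have "isCont p t" by (simp add: isCont_def)
    moreover have "min e (R - norm (p t)) > 0" using e pR[OF t] by simp
    ultimately obtain \<delta> where \<delta>: "\<delta> > 0" "\<And>s. dist s t < \<delta> \<Longrightarrow> dist (p s) (p t) < min e (R - norm (p t))"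
      unfolding continuous_at_eps_delta by blast
    have "dist (p t) (p s) < e \<and> norm (p s) < R" if "\<bar>s - t\<bar> < \<delta>" for s
      using \<delta>(2)[of s] that norm_triangle_ineq2[of "p s" "p t"]
      by (auto simp: dist_real_def dist_commute) (simp add: dist_norm)
    then show ?thesis using \<delta>(1) by blast
  qed
  have const: "\<exists>\<delta>>0. \<forall>s. \<bar>s - t\<bar> < \<delta> \<longrightarrow> g (p s) = g (p t)" if t: "t \<in> {0..1}" and gen: "generic_in H W (p t)" for t
  proof -
    obtain e where e: "e > 0" "\<And>w. w \<in> W \<Longrightarrow> dist (p t) w < e \<Longrightarrow> same_side H (p t) w"
      using generic_in_cell[OF H(1) gen] by blast
    obtain \<delta> where \<delta>: "\<delta> > 0" "\<And>s. \<bar>s - t\<bar> < \<delta> \<Longrightarrow> dist (p t) (p s) < e \<and> norm (p s) < R"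
      using cont[OF e(1) t] by blast
    have "g (p s) = g (p t)" if s: "\<bar>s - t\<bar> < \<delta>" for s
    proof -
      have "same_side H (p t) (p s)" using e(2)[OF pW] \<delta>(2)[OF s] by blast
      then have "g (p t) = g (p s)"
        using H(2) pR[OF t] \<delta>(2)[OF s] unfolding side_measurable_within_def by blast
      then show ?thesis by simp
    qed
    then show ?thesis using \<delta>(1) by blast
  qed
  have near: "\<exists>\<delta>>0. \<exists>k. \<forall>s. s \<noteq> t \<longrightarrow> \<bar>s - t\<bar> < \<delta> \<longrightarrow> g (p s) = k" if t: "t \<in> {0..1}" for t
  proof (cases "generic_in H W (p t)")
    case True
    then show ?thesis using const[OF t] by blast
  next
    case False
    then obtain a b where ab: "(a, b) \<in> H" "a \<bullet> p t = b" "\<not> W \<subseteq> {w. a \<bullet> w = b}"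
      using pW unfolding generic_in_def by blast
    obtain e k where e: "e > 0" "\<And>w. w \<in> W \<Longrightarrow> dist (p t) w < e \<Longrightarrow> norm w < R \<Longrightarrow> a \<bullet> w \<noteq> b \<Longrightarrow> g w = k"
      using cross[OF ab(1,3) t] ab(2) unfolding p_def v_def by blast
    obtain \<delta> where \<delta>: "\<delta> > 0" "\<And>s. \<bar>s - t\<bar> < \<delta> \<Longrightarrow> dist (p t) (p s) < e \<and> norm (p s) < R"
      using cont[OF e(1) t] by blast
    have "a \<bullet> x \<noteq> b" using x(2) ab unfolding generic_in_def by blast
    then have av: "a \<bullet> v \<noteq> 0" using ab(2) by (auto simp: p_def inner_add_right)
    have "g (p s) = k" if "s \<noteq> t" "\<bar>s - t\<bar> < \<delta>" for s
    proof (rule e(2)[OF pW])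
      have "a \<bullet> p s - b = (s - t) * (a \<bullet> v)" unfolding ab(2)[symmetric] by (simp add: p_def inner_add_right algebra_simps)
      then show "a \<bullet> p s \<noteq> b" using av that by auto
    qed (use \<delta>(2)[OF that(2)] in auto)
    then show ?thesis using \<delta>(1) by blast
  qed
  have ray: "ray_limit v g (p s) = k"
    if k: "\<And>s. s \<noteq> t \<Longrightarrow> \<bar>s - t\<bar> < \<delta> \<Longrightarrow> g (p s) = k" and s: "\<bar>s - t\<bar> < \<delta>" for s t \<delta> k
  proof (rule ray_limit_eqI)
    have "eventually (\<lambda>\<sigma>. 0 < \<sigma> \<and> \<sigma> < (if s < t then min (t - s) (\<delta> - \<bar>s - t\<bar>) else \<delta> - \<bar>s - t\<bar>)) (at_right (0::real))"
      using s by (intro eventually_conj eventually_at_right_less eventually_at_rightI[of 0 "if s < t then min (t - s) (\<delta> - \<bar>s - t\<bar>) else \<delta> - \<bar>s - t\<bar>"]) auto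
    then show "eventually (\<lambda>\<sigma>. g (p s + \<sigma> *\<^sub>R v) = k) (at_right 0)"
    proof eventually_elim
      case (elim \<sigma>)
      have "p s + \<sigma> *\<^sub>R v = p (s + \<sigma>)" by (simp add: p_def algebra_simps)
      moreover have "g (p (s + \<sigma>)) = k" using elim by (intro k) (auto split: if_splits)
      ultimately show ?case by simp
    qed
  qed
  have "ray_limit v g (p 0) = ray_limit v g (p 1)"
  proof (rule connected_local_const[of "{0..1::real}" 0 1 "\<lambda>t. ray_limit v g (p t)"])
    show "\<forall>t\<in>{0..1}. eventually (\<lambda>s. ray_limit v g (p t) = ray_limit v g (p s)) (at t within {0..1})"
    proof
      fix t :: real assume "t \<in> {0..1}"
      then obtain \<delta> k where k: "\<delta> > 0" "\<And>s. s \<noteq> t \<Longrightarrow> \<bar>s - t\<bar> < \<delta> \<Longrightarrow> g (p s) = k" using near by metis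
      have "ray_limit v g (p s) = k" if "\<bar>s - t\<bar> < \<delta>" for s using ray[OF k(2)] that by blast
      then show "eventually (\<lambda>s. ray_limit v g (p t) = ray_limit v g (p s)) (at t within {0..1})"
        unfolding eventually_at using k(1) by (intro exI[of _ \<delta>]) (auto simp: dist_real_def)
    qed
  qed auto
  moreover have lim: "ray_limit v g (p t) = g (p t)" if t: "t \<in> {0..1}" and gen: "generic_in H W (p t)" for t
  proof -
    obtain \<delta> where \<delta>: "\<delta> > 0" "\<And>s. \<bar>s - t\<bar> < \<delta> \<Longrightarrow> g (p s) = g (p t)" using const[OF t gen] by blast
    show ?thesis
    proof (rule ray)
      show "g (p s) = g (p t)" if "\<bar>s - t\<bar> < \<delta>" for s using that by (rule \<delta>(2))
    qed (use \<delta>(1) in simp)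
  qed
  moreover have "p 0 = x" "p 1 = y" by (simp_all add: p_def v_def)
  ultimately show ?thesis using lim[of 0] lim[of 1] x(2) y(2) by simp
qed

text \<open>Jumps vanish only at generic points of each hyperplane, so a segment helps only if it
  meets each hyperplane at such a point. For this the endpoint \<open>y\<close> is moved, within its
  cell, to a suitable \<open>z\<close>.\<close>

lemma generic_constant_of_jumps:
  fixes W :: "'a::euclidean_space set" and g :: "'a \<Rightarrow> real"
  assumes W: "affine W" and g: "piecewise_constant g"
    and jump: "\<And>a b n. (\<And>w s. w \<in> W \<Longrightarrow> w + s *\<^sub>R n \<in> W) \<Longrightarrow> a \<bullet> n > 0 \<Longrightarrow> {x\<in>W. a \<bullet> x = b} \<noteq> {} \<Longrightarrow>
      generically {x\<in>W. a \<bullet> x = b} (\<lambda>x. jump n g x = 0)"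
  shows "\<exists>H. finite H \<and> (\<forall>x y. norm x < R \<longrightarrow> norm y < R \<longrightarrow> generic_in H W x \<longrightarrow> generic_in H W y \<longrightarrow> g x = g y)"
proof -
  obtain H where H: "finite H" "side_measurable_within H R g"
    using g unfolding piecewise_constant_def by blast
  let ?V = "\<lambda>h. {x\<in>W. fst h \<bullet> x = snd h}"
  let ?proper = "\<lambda>h. ?V h \<noteq> {} \<and> \<not> W \<subseteq> {w. fst h \<bullet> w = snd h}"
  define good where "good h n H' \<longleftrightarrow> (\<forall>w\<in>W. \<forall>s. w + s *\<^sub>R n \<in> W) \<and> fst h \<bullet> n > 0 \<and> finite H' \<and>
      (\<forall>x. norm x < R \<longrightarrow> generic_in H' (?V h) x \<longrightarrow> jump n g x = 0)" for h n H'
  have ex: "\<exists>p. good h (fst p) (snd p)" if h: "?proper h" for h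
  proof -
    obtain v where v: "v \<in> W" "fst h \<bullet> v = snd h" using h by blast
    obtain w where w: "w \<in> W" "fst h \<bullet> w \<noteq> snd h" using h by blast
    define n where "n = (if fst h \<bullet> w > snd h then w - v else v - w)"
    have 1: "u + s *\<^sub>R (w - v) \<in> W" if "u \<in> W" for u s
      using mem_affine_3_minus[OF W that w(1) v(1), of s] by simp
    have 2: "u + s *\<^sub>R n \<in> W" if "u \<in> W" for u s
      using 1[OF that, of s] 1[OF that, of "- s"] by (auto simp: n_def algebra_simps)
    have 3: "fst h \<bullet> n > 0" using v w by (auto simp: n_def inner_diff_right)
    have "generically (?V h) (\<lambda>x. jump n g x = 0)" using jump[OF 2 3] h by blast
    then obtain H' where H': "finite H'" "\<forall>x. norm x < R \<longrightarrow> generic_in H' (?V h) x \<longrightarrow> jump n g x = 0"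
      unfolding generically_def by meson
    have "good h n H'" unfolding good_def using 2 3 H' by (intro conjI ballI allI) simp_all
    then show ?thesis by (intro exI[of _ "(n, H')"]) simp
  qed
  define p where "p h = (SOME p. good h (fst p) (snd p))" for h
  define n where "n h = fst (p h)" for h
  define H' where "H' h = snd (p h)" for h
  have good: "good h (n h) (H' h)" if "?proper h" for h
    unfolding n_def H'_def p_def using ex[OF that] by (rule someI_ex)
  have nH: "\<And>h w s. ?proper h \<Longrightarrow> w \<in> W \<Longrightarrow> w + s *\<^sub>R n h \<in> W"
    "\<And>h. ?proper h \<Longrightarrow> fst h \<bullet> n h > 0" "\<And>h. ?proper h \<Longrightarrow> finite (H' h)"
    "\<And>h x. ?proper h \<Longrightarrow> norm x < R \<Longrightarrow> generic_in (H' h) (?V h) x \<Longrightarrow> jump (n h) g x = 0"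
    using good unfolding good_def by (simp, simp, simp, meson)
  have main: "g x = g y" if x: "norm x < R" "generic_in H W x" and y: "norm y < R" "generic_in H W y" for x y
  proof -
    \<comment> \<open>The level set of \<open>lam h h'\<close> through \<open>x\<close> contains the
      intersection of \<open>h\<close> and \<open>h'\<close>: at a point \<open>w\<close> of
      \<open>h\<close> the functional differs from its value at \<open>x\<close> by
      \<open>(snd h - fst h \<bullet> x) * (fst h' \<bullet> w - snd h')\<close>.\<close>
    define lam where "lam h h' = (snd h - fst h \<bullet> x) *\<^sub>R fst h' - (snd h' - fst h' \<bullet> x) *\<^sub>R fst h" for h h' :: "'a \<times> real"
    \<comment> \<open>If the segment from \<open>x\<close> to \<open>z\<close> meets
      \<open>h\<close> in a point of \<open>h'\<close>, then \<open>z\<close> lies in that level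
      set. Genericity of \<open>z\<close> then forces the level set to contain \<open>W\<close>,
      hence \<open>h'\<close> to contain the trace of \<open>h\<close> on \<open>W\<close>, which
      genericity of the crossing point permits.\<close>
    define E where "E = (\<Union>h\<in>{h\<in>H. ?proper h}. (\<lambda>h'. (lam h h', lam h h' \<bullet> x)) ` (H \<union> H' h))"
    have finE: "finite (H \<union> E)" unfolding E_def using H(1) nH(3) by auto
    have yW: "y \<in> W" using y(2) by (rule generic_inD)
    obtain e where e: "e > 0" "\<And>w. w \<in> W \<Longrightarrow> dist y w < e \<Longrightarrow> same_side H y w"
      using generic_in_cell[OF H(1) y(2)] by blast
    have "min e (R - norm y) > 0" using e y by simp
    then obtain z where z: "generic_in (H \<union> E) W z" "dist y z < min e (R - norm y)"
      using generic_in_dense[OF finE W yW] by blast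
    have zR: "norm z < R" using z(2) norm_triangle_ineq2[of z y] by (simp add: dist_norm norm_minus_commute)
    have zW: "z \<in> W" using z(1) by (rule generic_inD)
    have "same_side H y z" using e(2)[OF zW] z(2) by simp
    then have gz: "g y = g z" using H(2) y(1) zR unfolding side_measurable_within_def by blast
    have "g x = g z"
    proof (rule piecewise_constant_segment[OF W H x zR])
      show "generic_in H W z" using z(1) by (rule generic_in_mono) simp
    next
      fix a b t assume ab: "(a, b) \<in> H" "\<not> W \<subseteq> {w. a \<bullet> w = b}" and t: "t \<in> {0..1::real}"
        and pt: "a \<bullet> (x + t *\<^sub>R (z - x)) = b"
      define u where "u = x + t *\<^sub>R (z - x)"
      have uW: "u \<in> W"
        using mem_affine_3_minus[OF W generic_inD[OF x(2)] zW generic_inD[OF x(2)], of t] by (simp add: u_def)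
      have uR: "norm u < R"
      proof -
        have "u = (1 - t) *\<^sub>R x + t *\<^sub>R z" by (simp add: u_def algebra_simps)
        moreover have "(1 - t) *\<^sub>R x + t *\<^sub>R z \<in> ball 0 R"
          using t x zR convex_ball[of 0 R] by (intro convexD) auto
        ultimately show ?thesis by simp
      qed
      let ?h = "(a, b)"
      have au: "a \<bullet> u = b" using pt by (simp add: u_def)
      have proper: "?proper ?h" using ab uW au by auto
      have ax: "a \<bullet> x \<noteq> b" using x(2) ab unfolding generic_in_def by blast
      have t0: "t \<noteq> 0" using ax pt by auto
      have gen: "generic_in (H \<union> H' ?h) (?V ?h) u"
        unfolding generic_in_def
      proof (intro conjI ballI, goal_cases)
        case 1
        then show ?case using uW au by simp
      next
        case (2 h')
        obtain a' b' where h': "h' = (a', b')" by force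
        have "?V ?h \<subseteq> {y. a' \<bullet> y = b'}" if a'u: "a' \<bullet> u = b'"
        proof -
          have "lam ?h h' \<bullet> u - lam ?h h' \<bullet> x = 0"
            using au a'u by (simp add: lam_def h' inner_diff_left algebra_simps)
          moreover have "lam ?h h' \<bullet> u - lam ?h h' \<bullet> x = t * (lam ?h h' \<bullet> z - lam ?h h' \<bullet> x)"
            by (simp add: u_def inner_add_right inner_diff_right)
          ultimately have "lam ?h h' \<bullet> z = lam ?h h' \<bullet> x" using t0 by simp
          moreover have "(lam ?h h', lam ?h h' \<bullet> x) \<in> H \<union> E"
            using ab(1) proper 2 unfolding E_def by blast
          ultimately have sub: "W \<subseteq> {w. lam ?h h' \<bullet> w = lam ?h h' \<bullet> x}"
            using z(1) unfolding generic_in_def by blast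
          show ?thesis
          proof clarify
            fix w assume w: "w \<in> W" "fst ?h \<bullet> w = snd ?h"
            have "lam ?h h' \<bullet> w = lam ?h h' \<bullet> x" using sub w(1) by blast
            then have "(b - a \<bullet> x) * (a' \<bullet> w - b') = 0"
              using w(2) by (simp add: lam_def h' inner_diff_left algebra_simps)
            then show "a' \<bullet> w = b'" using ax by simp
          qed
        qed
        then show ?case by (simp add: h')
      qed
      have "generic_in (H' ?h) (?V ?h) u" using gen by (rule generic_in_mono) simp
      then have j0: "jump (n ?h) g u = 0" using nH(4)[OF proper uR] by blast
      interpret cut: flat_cut W "?V ?h" "{x\<in>W. a \<bullet> x \<ge> b}" "{x\<in>W. a \<bullet> x \<le> b}" a "n ?h" b
        by unfold_locales (use W nH(1,2)[OF proper] in auto)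
      interpret m: flat_cut W "?V ?h" "{x\<in>W. a \<bullet> x \<le> b}" "{x\<in>W. a \<bullet> x \<ge> b}" "- a" "- n ?h" "- b"
        by (rule cut.mirror)
      have genH: "generic_in H (?V ?h) u" using gen by (rule generic_in_mono) simp
      \<comment> \<open>Applied to the cut and to its mirror image: on each side near
        \<open>u\<close> the function equals its one-sided limit, and the vanishing jump identifies
        the two limits.\<close>
      have side: "\<exists>e>0. \<forall>w\<in>W. dist u w < e \<longrightarrow> norm w < R \<longrightarrow> \<alpha> \<bullet> w > \<beta> \<longrightarrow> g w = ray_limit \<nu> g u"
        if "flat_cut W (?V ?h) P N \<alpha> \<nu> \<beta>" for P N \<alpha> \<nu> \<beta>
      proof -
        interpret c: flat_cut W "?V ?h" P N \<alpha> \<nu> \<beta> by fact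
        obtain e where e: "e > 0" "\<And>w w'. w \<in> W \<Longrightarrow> w' \<in> W \<Longrightarrow> dist u w < e \<Longrightarrow> dist u w' < e \<Longrightarrow>
            \<alpha> \<bullet> w > \<beta> \<Longrightarrow> \<alpha> \<bullet> w' > \<beta> \<Longrightarrow> same_side H w w'"
          using c.upper_signs[OF H(1) genH] by metis
        have "min e (R - norm u) > 0" using e(1) uR by simp
        from eventually_conj[OF eventually_ray_near[OF this, of u \<nu>] eventually_ray_limit[OF g, of u \<nu>]]
        obtain s where s: "s > 0" "dist u (u + s *\<^sub>R \<nu>) < min e (R - norm u)" "g (u + s *\<^sub>R \<nu>) = ray_limit \<nu> g u"
          using eventually_happens[of _ "at_right (0::real)"] by force
        have "\<alpha> \<bullet> u = \<beta>" using c.V uW au by auto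
        then have s': "u + s *\<^sub>R \<nu> \<in> W" "\<alpha> \<bullet> (u + s *\<^sub>R \<nu>) > \<beta>" "norm (u + s *\<^sub>R \<nu>) < R"
          using c.dir[OF uW, of s] c.pos s norm_triangle_ineq[of u "s *\<^sub>R \<nu>"] by (auto simp: inner_add_right dist_norm)
        have "g w = ray_limit \<nu> g u" if w: "w \<in> W" "dist u w < e" "norm w < R" "\<alpha> \<bullet> w > \<beta>" for w
        proof -
          have "same_side H w (u + s *\<^sub>R \<nu>)" using s s' w by (intro e(2)) auto
          then have "g w = g (u + s *\<^sub>R \<nu>)" using H(2) w(3) s'(3) unfolding side_measurable_within_def by blast
          then show ?thesis using s(3) by simp
        qed
        then show ?thesis using e(1) by blast
      qed
      obtain e1 where e1: "e1 > 0" "\<And>w. w \<in> W \<Longrightarrow> dist u w < e1 \<Longrightarrow> norm w < R \<Longrightarrow> a \<bullet> w > b \<Longrightarrow> g w = ray_limit (n ?h) g u"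
        using side[OF cut.flat_cut_axioms] by blast
      obtain e2 where e2: "e2 > 0" "\<And>w. w \<in> W \<Longrightarrow> dist u w < e2 \<Longrightarrow> norm w < R \<Longrightarrow> a \<bullet> w < b \<Longrightarrow> g w = ray_limit (- n ?h) g u"
        using side[OF m.flat_cut_axioms] by auto
      have eq: "ray_limit (- n ?h) g u = ray_limit (n ?h) g u" using j0 by (simp add: jump_def)
      have "g w = ray_limit (n ?h) g u" if "w \<in> W" "dist u w < min e1 e2" "norm w < R" "a \<bullet> w \<noteq> b" for w
        using e1(2)[of w] e2(2)[of w] that eq by (cases "a \<bullet> w > b") auto
      then show "\<exists>e>0. \<exists>k. \<forall>w\<in>W. dist (x + t *\<^sub>R (z - x)) w < e \<longrightarrow> norm w < R \<longrightarrow> a \<bullet> w \<noteq> b \<longrightarrow> g w = k"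
        using e1(1) e2(1) unfolding u_def[symmetric] by (intro exI[of _ "min e1 e2"]) auto
    qed
    then show ?thesis using gz by simp
  qed
  show ?thesis by (intro exI[of _ H] conjI H(1) allI impI main)
qed

text \<open>\<open>generic_constant_of_jumps\<close> gives a constant for each radius. They agree
  because near \<open>w0\<close>, inside all balls considered, there are points generic for any two
  of the arrangements.\<close>

lemma generically_constant_of_jumps:
  fixes W :: "'a::euclidean_space set" and g :: "'a \<Rightarrow> real"
  assumes W: "affine W" "W \<noteq> {}" and g: "piecewise_constant g"
    and jump: "\<And>a b n. (\<And>w s. w \<in> W \<Longrightarrow> w + s *\<^sub>R n \<in> W) \<Longrightarrow> a \<bullet> n > 0 \<Longrightarrow> {x\<in>W. a \<bullet> x = b} \<noteq> {} \<Longrightarrow>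
      generically {x\<in>W. a \<bullet> x = b} (\<lambda>x. jump n g x = 0)"
  shows "\<exists>\<gamma>. generically W (\<lambda>x. g x = \<gamma>)"
proof -
  obtain w0 where w0: "w0 \<in> W" using W by blast
  define R0 where "R0 = norm w0 + 1"
  have const: "\<exists>H. finite H \<and> (\<forall>x y. norm x < R \<longrightarrow> norm y < R \<longrightarrow> generic_in H W x \<longrightarrow> generic_in H W y \<longrightarrow> g x = g y)" for R
    by (rule generic_constant_of_jumps[OF W(1) g jump])
  obtain H0 where H0: "finite H0" "\<And>x y. norm x < R0 \<Longrightarrow> norm y < R0 \<Longrightarrow> generic_in H0 W x \<Longrightarrow> generic_in H0 W y \<Longrightarrow> g x = g y"
    using const[of R0] by blast
  have dense: "\<exists>z. generic_in H W z \<and> norm z < R0" if H: "finite H" for H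
  proof -
    obtain z where z: "generic_in H W z" "dist w0 z < 1" using generic_in_dense[OF H W(1) w0, of 1] by auto
    then have "norm z < R0" using norm_triangle_ineq2[of z w0] by (simp add: R0_def dist_norm norm_minus_commute)
    then show ?thesis using z by blast
  qed
  obtain z0 where z0: "generic_in H0 W z0" "norm z0 < R0" using dense[OF H0(1)] by blast
  have "generically W (\<lambda>x. g x = g z0)"
    unfolding generically_def
  proof
    fix R
    obtain H where H: "finite H" "\<And>x y. norm x < max R R0 \<Longrightarrow> norm y < max R R0 \<Longrightarrow> generic_in H W x \<Longrightarrow> generic_in H W y \<Longrightarrow> g x = g y"
      using const[of "max R R0"] by blast
    obtain z where z: "generic_in (H \<union> H0) W z" "norm z < R0" using dense[of "H \<union> H0"] H(1) H0(1) by auto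
    have "g z = g z0" using H0(2)[OF z(2) z0(2) _ z0(1)] generic_in_mono[OF z(1), of H0] by blast
    moreover have "g x = g z" if "norm x < R" "generic_in H W x" for x
      using H(2)[of x z] that z(2) generic_in_mono[OF z(1), of H] by auto
    ultimately show "\<exists>H. finite H \<and> (\<forall>x. norm x < R \<longrightarrow> generic_in H W x \<longrightarrow> g x = g z0)"
      using H(1) by auto
  qed
  then show ?thesis by blast
qed

section \<open>The tiling criterion\<close>

lemma jumps_cong_directions:
  assumes "\<And>j. k \<le> j \<Longrightarrow> j < d \<Longrightarrow> n j = n' j"
  shows "jumps n k d f = jumps n' k d f"
  unfolding jumps_def using assms by (intro foldr_cong) auto

text \<open>\<open>is_flag\<close> extended by the case \<open>r = DIM('a)\<close>, the whole space
  alone, so that the descent can start before any hyperplane is chosen.\<close>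

definition partial_flag :: "nat \<Rightarrow> 'a::euclidean_space flag \<Rightarrow> bool" where
  "partial_flag r \<Phi> \<longleftrightarrow>
     r \<le> DIM('a) \<and>
     flat \<Phi> DIM('a) = UNIV \<and>
     (\<forall>j\<in>{r..DIM('a)}. affine (flat \<Phi> j) \<and> aff_dim (flat \<Phi> j) = int j) \<and>
     (\<forall>j\<in>{r..<DIM('a)}. flat \<Phi> j \<subseteq> flat \<Phi> (Suc j) \<and>
        halfspace_in (flat \<Phi> (Suc j)) (flat \<Phi> j) (pos \<Phi> j)) \<and>
     (\<forall>j. j \<notin> {r..DIM('a)} \<longrightarrow> flat \<Phi> j = {}) \<and>
     (\<forall>j. j \<notin> {r..<DIM('a)} \<longrightarrow> pos \<Phi> j = {})"

lemma is_flag_iff_partial: "is_flag r (\<Phi> :: 'a::euclidean_space flag) \<longleftrightarrow> r < DIM('a) \<and> partial_flag r \<Phi>"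
  unfolding is_flag_def partial_flag_def by auto

lemma partial_flag_extend:
  fixes \<Phi> :: "'a::euclidean_space flag"
  assumes \<Phi>: "partial_flag (Suc r) \<Phi>" "flag_normals (Suc r) \<Phi> a b n"
    and dir: "\<And>w s. w \<in> flat \<Phi> (Suc r) \<Longrightarrow> w + s *\<^sub>R \<nu> \<in> flat \<Phi> (Suc r)" and pos: "\<alpha> \<bullet> \<nu> > 0"
    and ne: "{x\<in>flat \<Phi> (Suc r). \<alpha> \<bullet> x = \<beta>} \<noteq> {}"
  defines "\<Phi>' \<equiv> Flag ((flat \<Phi>)(r := {x\<in>flat \<Phi> (Suc r). \<alpha> \<bullet> x = \<beta>})) ((flag.pos \<Phi>)(r := {x\<in>flat \<Phi> (Suc r). \<alpha> \<bullet> x \<ge> \<beta>}))"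
  shows "partial_flag r \<Phi>'" "flag_normals r \<Phi>' (a(r := \<alpha>)) (b(r := \<beta>)) (n(r := \<nu>))"
proof -
  let ?W = "flat \<Phi> (Suc r)"
  let ?V = "{x\<in>?W. \<alpha> \<bullet> x = \<beta>}"
  have r: "r < DIM('a)" using \<Phi>(1) by (simp add: partial_flag_def)
  have W: "affine ?W" "aff_dim ?W = int (Suc r)" using \<Phi>(1) r by (auto simp: partial_flag_def)
  interpret flat_cut ?W ?V "{x\<in>?W. \<alpha> \<bullet> x \<ge> \<beta>}" "{x\<in>?W. \<alpha> \<bullet> x \<le> \<beta>}" \<alpha> \<nu> \<beta>
    by unfold_locales (use W dir pos in auto)
  have VW: "?V \<noteq> ?W" using V_neq_W ne by blast
  have int: "?V = ?W \<inter> {x. \<alpha> \<bullet> x = \<beta>}" by auto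
  have "aff_dim ?V = aff_dim ?W - 1"
    unfolding int using aff_dim_affine_Int_hyperplane[OF W(1), of \<alpha> \<beta>] ne VW by (auto simp: int split: if_splits)
  then have dimV: "aff_dim ?V = int r" using W(2) by simp
  have hs: "halfspace_in ?W ?V {x\<in>?W. \<alpha> \<bullet> x \<ge> \<beta>}" unfolding halfspace_in_def using VW by blast
  have flats: "flat \<Phi>' j = (if j = r then ?V else flat \<Phi> j)"
    "flag.pos \<Phi>' j = (if j = r then {x\<in>?W. \<alpha> \<bullet> x \<ge> \<beta>} else flag.pos \<Phi> j)" for j
    by (simp_all add: \<Phi>'_def)
  show "partial_flag r \<Phi>'"
    unfolding partial_flag_def
  proof (intro conjI ballI allI impI)
    show "r \<le> DIM('a)" "flat \<Phi>' DIM('a) = UNIV" using r \<Phi>(1) by (auto simp: flats partial_flag_def)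
    show "affine (flat \<Phi>' j)" "aff_dim (flat \<Phi>' j) = int j" if "j \<in> {r..DIM('a)}" for j
      using that affV dimV \<Phi>(1) unfolding flats by (auto simp: partial_flag_def)
    show "flat \<Phi>' j \<subseteq> flat \<Phi>' (Suc j)" "halfspace_in (flat \<Phi>' (Suc j)) (flat \<Phi>' j) (flag.pos \<Phi>' j)"
      if "j \<in> {r..<DIM('a)}" for j
      using that hs \<Phi>(1) unfolding flats by (auto simp: partial_flag_def)
    show "flat \<Phi>' j = {}" if "j \<notin> {r..DIM('a)}" for j
      using that r \<Phi>(1) unfolding flats by (auto simp: partial_flag_def)
    show "flag.pos \<Phi>' j = {}" if "j \<notin> {r..<DIM('a)}" for j
      using that r \<Phi>(1) unfolding flats by (auto simp: partial_flag_def)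
  qed
  show "flag_normals r \<Phi>' (a(r := \<alpha>)) (b(r := \<beta>)) (n(r := \<nu>))"
    unfolding flag_normals_def
  proof (intro conjI ballI)
    show "r \<le> DIM('a)" "flat \<Phi>' DIM('a) = UNIV" using r \<Phi>(1) by (auto simp: flats partial_flag_def)
    fix j assume j: "j \<in> {r..<DIM('a)}"
    show "flat_cut (flat \<Phi>' (Suc j)) (flat \<Phi>' j) (flag.pos \<Phi>' j)
        {x \<in> flat \<Phi>' (Suc j). (a(r := \<alpha>)) j \<bullet> x \<le> (b(r := \<beta>)) j} ((a(r := \<alpha>)) j) ((n(r := \<nu>)) j) ((b(r := \<beta>)) j)"
    proof (cases "j = r")
      case True
      then show ?thesis using flat_cut_axioms by (simp add: flats)
    next
      case False
      then show ?thesis using flag_normals_cut[OF \<Phi>(2), of j] j by (simp add: flats)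
    qed
  qed
qed

lemma flag_of_nonconstant:
  fixes f :: "'a::euclidean_space \<Rightarrow> real"
  assumes f: "piecewise_constant f"
  shows "partial_flag k \<Phi> \<Longrightarrow> flag_normals k \<Phi> a b n \<Longrightarrow>
    \<not> (\<exists>\<gamma>. generically (flat \<Phi> k) (\<lambda>x. jumps n k DIM('a) f x = \<gamma>)) \<Longrightarrow>
    \<exists>r \<Psi> a' b' n' \<gamma>. is_flag r \<Psi> \<and> flag_normals r \<Psi> a' b' n' \<and> \<gamma> \<noteq> 0 \<and>
      generically (flat \<Psi> r) (\<lambda>x. jumps n' r DIM('a) f x = \<gamma>)"
proof (induction k arbitrary: \<Phi> a b n)
  case 0
  have "aff_dim (flat \<Phi> 0) = 0" using 0(1) by (simp add: partial_flag_def)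
  then obtain p where p: "flat \<Phi> 0 = {p}" by (auto simp: aff_dim_eq_0)
  have "generically (flat \<Phi> 0) (\<lambda>x. jumps n 0 DIM('a) f x = jumps n 0 DIM('a) f p)"
    unfolding generically_def p by (intro allI exI[of _ "{}"]) (auto dest!: generic_inD)
  then show ?case using 0(3) by blast
next
  case (Suc r)
  let ?W = "flat \<Phi> (Suc r)" and ?g = "jumps n (Suc r) DIM('a) f"
  have r: "Suc r \<le> DIM('a)" using Suc.prems(1) by (simp add: partial_flag_def)
  have W: "affine ?W" "aff_dim ?W = int (Suc r)" using Suc.prems(1) r by (auto simp: partial_flag_def)
  have "?W \<noteq> {}" using W(2) by auto
  have g: "piecewise_constant ?g" using piecewise_constant_jumps[OF r f] .
  have "\<exists>\<alpha> \<beta> \<nu>. (\<forall>w\<in>?W. \<forall>s. w + s *\<^sub>R \<nu> \<in> ?W) \<and> \<alpha> \<bullet> \<nu> > 0 \<and>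
    {x\<in>?W. \<alpha> \<bullet> x = \<beta>} \<noteq> {} \<and> \<not> generically {x\<in>?W. \<alpha> \<bullet> x = \<beta>} (\<lambda>x. jump \<nu> ?g x = 0)"
  proof (rule ccontr)
    assume no: "\<not> ?thesis"
    have "\<exists>\<gamma>. generically ?W (\<lambda>x. ?g x = \<gamma>)"
      by (rule generically_constant_of_jumps[OF W(1) \<open>?W \<noteq> {}\<close> g]) (use no in blast)
    then show False using Suc.prems(3) by blast
  qed
  then obtain \<alpha> \<beta> \<nu> where step: "\<And>w s. w \<in> ?W \<Longrightarrow> w + s *\<^sub>R \<nu> \<in> ?W" "\<alpha> \<bullet> \<nu> > 0"
    "{x\<in>?W. \<alpha> \<bullet> x = \<beta>} \<noteq> {}" "\<not> generically {x\<in>?W. \<alpha> \<bullet> x = \<beta>} (\<lambda>x. jump \<nu> ?g x = 0)"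
    by blast
  define \<Phi>' where "\<Phi>' = Flag ((flat \<Phi>)(r := {x\<in>?W. \<alpha> \<bullet> x = \<beta>})) ((pos \<Phi>)(r := {x\<in>?W. \<alpha> \<bullet> x \<ge> \<beta>}))"
  define n' where "n' = n(r := \<nu>)"
  note ext = partial_flag_extend[OF Suc.prems(1,2) step(1-3), folded \<Phi>'_def n'_def]
  have flatr: "flat \<Phi>' r = {x\<in>?W. \<alpha> \<bullet> x = \<beta>}" by (simp add: \<Phi>'_def)
  have jr: "jumps n' r DIM('a) f = jump \<nu> ?g"
    using r jumps_cong_directions[of "Suc r" "DIM('a)" n' n f] by (simp add: jumps_step n'_def)
  show ?case
  proof (cases "\<exists>\<gamma>. generically (flat \<Phi>' r) (\<lambda>x. jumps n' r DIM('a) f x = \<gamma>)")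
    case True
    then obtain \<gamma> where \<gamma>: "generically (flat \<Phi>' r) (\<lambda>x. jumps n' r DIM('a) f x = \<gamma>)" by blast
    \<comment> \<open>The hyperplane was chosen so that the jump across it is not generically
      zero.\<close>
    then have "\<gamma> \<noteq> 0" using step(4) unfolding flatr jr by blast
    moreover have "is_flag r \<Phi>'" using ext(1) r by (simp add: is_flag_iff_partial)
    ultimately show ?thesis using ext(2) \<gamma> by blast
  next
    case False
    from Suc.IH[OF ext False] show ?thesis .
  qed
qed

text \<open>Rays from generic points of a flat run through generic points of the next, where a
  single constant is seen on both sides, so the first jump already vanishes. \<open>\<gamma>\<close>
  itself remains only for \<open>k = DIM('a)\<close>, where no jump is taken.\<close>

lemma jumps_of_constant:
  fixes f :: "'a::euclidean_space \<Rightarrow> real"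
  assumes normals: "flag_normals r \<Phi> a b n" and f: "generically UNIV (\<lambda>x. f x = \<gamma>)"
  shows "k \<le> DIM('a) \<Longrightarrow> r \<le> k \<Longrightarrow>
    generically (flat \<Phi> k) (\<lambda>x. jumps n k DIM('a) f x = (if k = DIM('a) then \<gamma> else 0))"
proof (induction rule: inc_induct)
  case base
  then show ?case using normals f by (simp add: flag_normals_def)
next
  case (step k)
  have rk: "r \<le> k" "k < DIM('a)" using step by auto
  interpret flat_cut "flat \<Phi> (Suc k)" "flat \<Phi> k" "pos \<Phi> k"
    "{x\<in>flat \<Phi> (Suc k). a k \<bullet> x \<le> b k}" "a k" "n k" "b k"
    using flag_normals_cut[OF normals rk] .
  interpret m: flat_cut "flat \<Phi> (Suc k)" "flat \<Phi> k"
    "{x\<in>flat \<Phi> (Suc k). a k \<bullet> x \<le> b k}" "pos \<Phi> k" "- a k" "- n k" "- b k"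
    by (rule mirror)
  let ?g = "jumps n (Suc k) DIM('a) f" and ?\<gamma> = "if Suc k = DIM('a) then \<gamma> else 0"
  have IH: "generically (flat \<Phi> (Suc k)) (\<lambda>x. ?g x = ?\<gamma>)" using step by simp
  show ?case
    unfolding generically_def
  proof
    fix R
    obtain H where H: "finite H" "\<And>x. norm x < R \<Longrightarrow> generic_in H (flat \<Phi> (Suc k)) x \<Longrightarrow> ?g x = ?\<gamma>"
      using IH unfolding generically_def by meson
    have "jumps n k DIM('a) f x = 0" if x: "norm x < R" "generic_in H (flat \<Phi> k) x" for x
    proof -
      have lim: "ray_limit v ?g x = ?\<gamma>"
        if "eventually (\<lambda>s. generic_in H (flat \<Phi> (Suc k)) (x + s *\<^sub>R v)) (at_right 0)" for v
      proof (rule ray_limit_eqI)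
        have "R - norm x > 0" using x(1) by simp
        from that eventually_ray_near[OF this, of x v]
        show "eventually (\<lambda>s. ?g (x + s *\<^sub>R v) = ?\<gamma>) (at_right 0)"
        proof eventually_elim
          case (elim s)
          have "norm (x + s *\<^sub>R v) < R" using elim(2) norm_triangle_ineq[of x "s *\<^sub>R v"] by (auto simp: dist_norm)
          then show ?case using H(2) elim(1) by blast
        qed
      qed
      show ?thesis
        using lim[OF eventually_generic[OF H(1) x(2)]] lim[OF m.eventually_generic[OF H(1) x(2)]] rk
        by (simp add: jumps_step jump_def)
    qed
    then show "\<exists>H. finite H \<and> (\<forall>x. norm x < R \<longrightarrow> generic_in H (flat \<Phi> k) x \<longrightarrow>
        jumps n k DIM('a) f x = (if k = DIM('a) then \<gamma> else 0))"
      using H(1) rk by (intro exI[of _ H]) simp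
  qed
qed

section \<open>Generic and almost everywhere statements on the whole space\<close>

lemma generically_AE_lborel:
  fixes Q :: "'a::euclidean_space \<Rightarrow> bool"
  assumes "generically UNIV Q"
  shows "AE x in lborel. Q x"
proof -
  have hyper: "AE x in lborel. a \<bullet> x \<noteq> b" if "\<not> UNIV \<subseteq> {y. a \<bullet> y = b}" for a :: 'a and b
  proof -
    have "a \<noteq> 0 \<or> b \<noteq> 0" using that by auto
    then have "{x. a \<bullet> x = b} \<in> null_sets lebesgue"
      using negligible_hyperplane by (simp add: negligible_iff_null_sets)
    moreover have "{x. a \<bullet> x = b} \<in> sets lborel" by (simp add: borel_closed closed_hyperplane)
    ultimately have "{x. a \<bullet> x = b} \<in> null_sets lborel" by (simp add: null_sets_def)
    then show ?thesis by (intro AE_I') auto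
  qed
  have "AE x in lborel. generic_in H UNIV x" if "finite H" for H :: "('a \<times> real) set"
    using that hyper by (intro AE_generic_in) auto
  then show ?thesis using assms by (rule generically_AE)
qed

text \<open>Around a generic point \<open>f\<close> is constant on a ball. A ball is not negligible,
  so an exceptional value there would contradict the almost everywhere equality.\<close>

lemma generically_of_AE:
  fixes f :: "'a::euclidean_space \<Rightarrow> real"
  assumes f: "piecewise_constant f" and AE: "AE x in lborel. f x = \<gamma>"
  shows "generically UNIV (\<lambda>x. f x = \<gamma>)"
  unfolding generically_def
proof
  fix R
  obtain H where H: "finite H" "side_measurable_within H R f"
    using f unfolding piecewise_constant_def by blast
  have "f x = \<gamma>" if x: "norm x < R" "generic_in H UNIV x" for x
  proof (rule ccontr)
    assume ne: "f x \<noteq> \<gamma>"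
    obtain e where e: "e > 0" "\<And>y. y \<in> UNIV \<Longrightarrow> dist x y < e \<Longrightarrow> same_side H x y"
      using generic_in_cell[OF H(1) x(2)] by blast
    define d where "d = min e (R - norm x)"
    have d: "d > 0" using e x by (simp add: d_def)
    have sub: "ball x d \<subseteq> {y. f y \<noteq> \<gamma>}"
    proof
      fix y assume y: "y \<in> ball x d"
      then have "norm y < R" using norm_triangle_ineq2[of y x] by (simp add: d_def dist_norm norm_minus_commute)
      moreover have "same_side H x y" using e(2) y by (simp add: d_def)
      ultimately have "f x = f y" using H(2) x(1) unfolding side_measurable_within_def by blast
      then show "y \<in> {y. f y \<noteq> \<gamma>}" using ne by simp
    qed
    obtain N where N: "N \<in> null_sets lborel" "{y. f y \<noteq> \<gamma>} \<subseteq> N"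
      using AE unfolding eventually_ae_filter by auto
    have "N \<in> null_sets lebesgue" using N(1) by (rule null_sets_completionI)
    then have "negligible N" by (simp add: negligible_iff_null_sets)
    then have "negligible (ball x d)" using sub N(2) by (meson negligible_subset order_trans)
    moreover have "ball x d \<noteq> {}" using d by simp
    ultimately show False using open_not_negligible[OF open_ball] by blast
  qed
  then show "\<exists>H. finite H \<and> (\<forall>x. norm x < R \<longrightarrow> generic_in H UNIV x \<longrightarrow> f x = \<gamma>)" using H(1) by blast
qed

lemma polytope_group_representative:
  assumes "P \<in> carrier polytope_group"
  shows "(SOME c. c \<in> P) \<in> P" "c \<in> P \<Longrightarrow> Poly_Mapping.keys c \<subseteq> {A. solid_polytope A}"
proof -
  let ?G = "free_Abelian_group {A. solid_polytope A}"
  let ?R = "generate ?G polytope_relators"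
  interpret comm_group ?G by (rule abelian_free_Abelian_group)
  have sub: "subgroup ?R ?G"
    by (rule generate_is_subgroup[OF polytope_relators_subset])
  obtain g where g: "g \<in> carrier ?G" "P = ?R #>\<^bsub>?G\<^esub> g"
    using assms unfolding polytope_group_def FactGroup_def RCOSETS_def by auto
  have "\<one>\<^bsub>?G\<^esub> \<in> ?R" by (rule subgroup.one_closed[OF sub])
  then have "\<exists>c. c \<in> P" unfolding g(2) r_coset_def by blast
  then show "(SOME c. c \<in> P) \<in> P" by (rule someI_ex)
  assume "c \<in> P"
  then obtain u where u: "u \<in> ?R" "c = u + g"
    unfolding g(2) r_coset_def by auto
  have "Poly_Mapping.keys u \<subseteq> {A. solid_polytope A}" "Poly_Mapping.keys g \<subseteq> {A. solid_polytope A}"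
    using subgroup.mem_carrier[OF sub u(1)] g(1) by simp_all
  then show "Poly_Mapping.keys c \<subseteq> {A. solid_polytope A}" using keys_add[of u g] u(2) by blast
qed

text \<open>This is what makes the level an integer: the coefficients of \<open>c\<close> are
  integers and finitely many lattice translates contribute.\<close>

lemma (in lattice_tiling) tiling_sum_Ints: "tiling_sum x \<in> \<int>"
proof -
  obtain R0 where R0: "\<And>x. norm x \<ge> R0 \<Longrightarrow> chi x = 0" using chi_support by blast
  have "chi y \<in> \<int>" for y unfolding chi_def by (intro Ints_sum Ints_mult) (auto simp: indicator_def)
  then show ?thesis
    unfolding tiling_sum_def using lattice_ball_sum[where f = chi and x = x and R = "norm x + 1", OF R0] by (simp add: Ints_sum)
qed

lemma (in lattice_tiling) constant_iff_Hadwiger: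
  "(\<exists>\<gamma>. generically UNIV (\<lambda>x. tiling_sum x = \<gamma>)) \<longleftrightarrow>
     (\<forall>r \<Phi>. is_flag r \<Phi> \<longrightarrow> frag_eval (Hadwiger r \<Phi> L) c = 0)"
proof
  assume "\<exists>\<gamma>. generically UNIV (\<lambda>x. tiling_sum x = \<gamma>)"
  then obtain \<gamma> where \<gamma>: "generically UNIV (\<lambda>x. tiling_sum x = \<gamma>)" by blast
  show "\<forall>r \<Phi>. is_flag r \<Phi> \<longrightarrow> frag_eval (Hadwiger r \<Phi> L) c = 0"
  proof (intro allI impI)
    fix r and \<Phi> :: "'a flag" assume flag: "is_flag r \<Phi>"
    obtain a b n where normals: "flag_normals r \<Phi> a b n" using is_flag_normals[OF flag] by blast
    interpret lattice_tiling_flag L c r \<Phi> a n b by unfold_locales fact+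
    have "generically (flat \<Phi> r) (\<lambda>x. jumps n r DIM('a) tiling_sum x = 0)"
      using jumps_of_constant[OF normals \<gamma>, of r] r_less by simp
    then show "frag_eval (Hadwiger r \<Phi> L) c = 0" using Hadwiger_proportional by force
  qed
next
  assume H0: "\<forall>r \<Phi>. is_flag r \<Phi> \<longrightarrow> frag_eval (Hadwiger r \<Phi> L) c = 0"
  show "\<exists>\<gamma>. generically UNIV (\<lambda>x. tiling_sum x = \<gamma>)"
  proof (rule ccontr)
    assume nc: "\<not> ?thesis"
    \<comment> \<open>The whole space alone. It has no cuts, so the normals supplied for it are
      dummies.\<close>
    define \<Phi> :: "'a flag" where "\<Phi> = Flag (\<lambda>j. if j = DIM('a) then UNIV else {}) (\<lambda>j. {})"
    have 1: "partial_flag DIM('a) \<Phi>" by (auto simp: partial_flag_def \<Phi>_def)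
    have 2: "flag_normals DIM('a) \<Phi> (\<lambda>_. 0) (\<lambda>_. 0) (\<lambda>_. 0)" by (simp add: flag_normals_def \<Phi>_def)
    have "\<not> (\<exists>\<gamma>. generically (flat \<Phi> DIM('a)) (\<lambda>x. jumps (\<lambda>_. 0) DIM('a) DIM('a) tiling_sum x = \<gamma>))"
      using nc by (simp add: \<Phi>_def)
    from flag_of_nonconstant[OF tiling_sum_piecewise 1 2 this] obtain r \<Psi> a b n \<gamma> where \<Psi>: "is_flag r \<Psi>" "flag_normals r \<Psi> a b n" "\<gamma> \<noteq> 0"
      "generically (flat \<Psi> r) (\<lambda>x. jumps n r DIM('a) tiling_sum x = \<gamma>)"
      by blast
    interpret lattice_tiling_flag L c r \<Psi> a n b by unfold_locales fact+
    obtain \<kappa> where "\<kappa> > 0" "frag_eval (Hadwiger r \<Psi> L) c = \<gamma> * \<kappa>" using Hadwiger_proportional[OF \<Psi>(4)] .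
    then show False using H0 \<Psi>(1,3) by simp
  qed
qed

theorem theorem4p1:
  fixes P :: "((real ^ 'n) set \<Rightarrow>\<^sub>0 int) set" and L :: "(real ^ 'n) set"
  assumes "P \<in> carrier polytope_group" and "is_lattice L"
  shows "(\<exists>k. tiles_at_level P L k) \<longleftrightarrow>
         (\<forall>r \<Phi>. 0 \<le> r \<and> r \<le> CARD('n) - 1 \<and> is_flag r \<Phi> \<longrightarrow> Hadwiger_ext r \<Phi> L P = 0)"
proof -
  \<comment> \<open>This representative is the one chosen by \<open>polytope_chi\<close> and by
    \<open>extend_additive\<close>, so both sides of the equivalence speak about the same
    \<open>c\<close>.\<close>
  define c where "c = (SOME c. c \<in> P)"
  have "c \<in> P" unfolding c_def by (rule polytope_group_representative(1)[OF assms(1)])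
  then have keys: "Poly_Mapping.keys c \<subseteq> {A. solid_polytope A}"
    by (rule polytope_group_representative(2)[OF assms(1)])
  interpret lattice_tiling L c by unfold_locales fact+
  have tiles: "tiles_at_level P L k \<longleftrightarrow> (AE x in lborel. tiling_sum x = of_int k)" for k
    by (simp only: tiles_at_level_def polytope_chi_def tiling_sum_def chi_def frag_eval_def c_def[symmetric])
  have "(\<exists>k. tiles_at_level P L k) \<longleftrightarrow> (\<exists>\<gamma>. generically UNIV (\<lambda>x. tiling_sum x = \<gamma>))"
  proof
    assume "\<exists>k. tiles_at_level P L k"
    then show "\<exists>\<gamma>. generically UNIV (\<lambda>x. tiling_sum x = \<gamma>)"
      unfolding tiles using generically_of_AE[OF tiling_sum_piecewise] by blast
  next
    assume "\<exists>\<gamma>. generically UNIV (\<lambda>x. tiling_sum x = \<gamma>)"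
    then obtain \<gamma> where \<gamma>: "generically UNIV (\<lambda>x. tiling_sum x = \<gamma>)" by blast
    then obtain H where H: "finite H" "\<forall>x. norm x < 1 \<longrightarrow> generic_in H UNIV x \<longrightarrow> tiling_sum x = \<gamma>"
      unfolding generically_def by blast
    \<comment> \<open>The generic constant is attained at some generic point and is therefore an
      integer.\<close>
    obtain x where "generic_in H UNIV x" "dist 0 x < 1"
      using generic_in_dense[OF H(1) affine_UNIV UNIV_I, of 1 0] by auto
    then have "\<gamma> = tiling_sum x" using H(2) by simp
    then obtain k where "\<gamma> = of_int k" using tiling_sum_Ints[of x] by (auto elim: Ints_cases)
    then show "\<exists>k. tiles_at_level P L k" unfolding tiles using generically_AE_lborel[OF \<gamma>] by blast
  qed
  also have "\<dots> \<longleftrightarrow> (\<forall>r \<Phi>. is_flag r \<Phi> \<longrightarrow> frag_eval (Hadwiger r \<Phi> L) c = 0)"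
    by (rule constant_iff_Hadwiger)
  also have "\<dots> \<longleftrightarrow> (\<forall>r \<Phi>. 0 \<le> r \<and> r \<le> CARD('n) - 1 \<and> is_flag r \<Phi> \<longrightarrow> Hadwiger_ext r \<Phi> L P = 0)"
  proof -
    have "r \<le> CARD('n) - 1" if "is_flag r (\<Phi> :: (real ^ 'n) flag)" for r \<Phi>
    proof -
      have "r < CARD('n)" using that by (simp add: is_flag_def)
      then show ?thesis by simp
    qed
    then show ?thesis
      unfolding Hadwiger_ext_def extend_additive_def c_def[symmetric] by auto
  qed
  finally show ?thesis .
qed

end
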